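(* Let $\mathrm g_{\mathrm{cl}}$ be the Gibbs cluster measure on $\Gamma_X$, $X=\mathbb R^d$, with background Gibbs measure $\mathrm g\in\mathscr G(\theta,\Phi)$ and cluster distribution $\eta(d\bar y)=h(\bar y)\,d\bar y$ on $\mathfrak X$, where: $\sup_{x\in X}\theta(B+x)<\infty$ for every compact $B\subset X$; the first correlation function $\kappa^1_{\mathrm g}$ exists and is bounded; $\int_{\mathfrak X}N_X(\bar y)\,\eta(d\bar y)<\infty$; and $h(\bar y)>0$ for a.a. $\bar y\in\mathfrak X$. Then $\mathrm g_{\mathrm{cl}}$ is quasi-invariant with respect to the action of $\mathrm{Diff}_0(X)$ on $\Gamma_X$, $\varphi(\gamma):=\{\varphi(x):x\in\gamma\}$, and for each $\varphi\in\mathrm{Diff}_0(X)$ the Radon–Nikodym density $R^\varphi_{\mathrm g_{\mathrm{cl}}}=d(\varphi^*\mathrm g_{\mathrm{cl}})/d\mathrm g_{\mathrm{cl}}$ is given by $$R^\varphi_{\mathrm g_{\mathrm{cl}}}=\mathcal I_{\mathfrak q}^*R^{\hat\varphi}_{\hat{\mathrm g}},\qquad R^{\hat\varphi}_{\hat{\mathrm g}}(\hat\gamma)=\prod_{z\in\hat\gamma}\rho_\varphi(z).$$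
   Context: $X=\mathbb R^d$; $\mathfrak X:=\bigsqcup_{n\in\mathbb Z_+}X^n$ ($X^0=\{\emptyset\}$) with disjoint union topology; $d\bar y$ is Lebesgue measure on each $X^n$ (unit mass on $X^0$); $N_X(\bar y)$ is the number of coordinates of $\bar y$; $\bar y+x:=(y_1+x,\dots,y_n+x)$; $\mathcal Z:=X\times\mathfrak X$. For a Polish space $Y$, $\Gamma_Y$ is the set of locally finite (finite on compacts) subsets $\gamma\subset Y$, identified with measures $\sum_{y\in\gamma}\delta_y$, with the $\sigma$-algebra generated by the sets $\{\gamma(B)=n\}$; $\Gamma_Y^0$ is the set of finite configurations. Gibbs measures: $\theta$ is a Borel measure on $X$ (reference measure), $\Phi:\Gamma_X^0\to\mathbb R\cup\{+\infty\}$ a measurable interaction potential with $\Phi(\emptyset)=0$. For $\gamma\in\Gamma_X$, $x\notin\gamma$, $E(\{x\},\gamma):=\sum_{\gamma'\subset\gamma\text{ finite}}\Phi(\{x\}\cup\gamma')$ if absolutely convergent and $+\infty$ otherwise; $E(\{x\},\gamma):=+\infty$ if $x\in\gamma$. $\mathscr G(\theta,\Phi)$ is the set of probability measures $\mathrm g$ on $\Gamma_X$ such that for all measurable $H:X\times\Gamma_X\to[0,\infty)$, $\int\sum_{x\in\gamma}H(x,\gamma)\,\mathrm g(d\gamma)=\int\int_XH(x,\gamma\cup\{x\})e^{-E(\{x\},\gamma)}\theta(dx)\,\mathrm g(d\gamma)$ (equivalent to the DLR equation). $\kappa^1_{\mathrm g}$ is defined by $\int\gamma(B)\,\mathrm g(d\gamma)=\int_B\kappa^1_{\mathrm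 g}\,d\theta$ for Borel $B$. $\eta$ is a probability measure on $\mathfrak X$ symmetric under permutations of coordinates. $\hat{\mathrm g}$ is the distribution on $\Gamma_{\mathcal Z}$ of $\hat\gamma=\bigcup_{x\in\gamma}\{(x,\bar y_x)\}$, where $\gamma\sim\mathrm g$ and, given $\gamma$, the $\bar y_x$ are i.i.d. with distribution $\eta$. The map $\mathfrak q$ sends $\hat\gamma$ to the collection (with multiplicities) of all points $y_i+x$, $(x,\bar y)\in\hat\gamma$, $y_i$ a coordinate of $\bar y$. The Gibbs cluster measure is $\mathrm g_{\mathrm{cl}}=\hat{\mathrm g}\circ\mathfrak q^{-1}$ (the distribution of the cluster process in which each center $x\in\gamma$ is replaced by the points of $x+\bar y_x$); under the stated assumptions it is concentrated on $\Gamma_X$. $\mathrm{Diff}_0(X)$ is the group of diffeomorphisms $\varphi$ of $X$ that equal the identity outside a compact set. $\varphi^*\mu:=\mu\circ\varphi^{-1}$. $\bar\varphi(y_1,\dots,y_n):=(\varphi(y_1),\dots,\varphi(y_n))$. $\hat\varphi(x,\bar y):=(x,\bar\varphi(\bar y+x)-x)$ on $\mathcal Z$, lifted pointwise to $\Gamma_{\mathcal Z}$. With $\sigma:=\theta\otimes\eta$, $$\rho_\varphi(x,\bar y):=\frac{d(\hat\varphi^*\sigma)}{d\sigma}(x,\bar y)=\frac{h(\bar\varphi^{-1}(\bar y+x)-x)}{h(\bar y)}\prod_{y_i\in\bar y}\bigl|\det D(\varphi^{-1})(y_i+x)\bigr|,$$ with $\rho_\varphi:=1$ where $h(\bar y)=0$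 or $h(\bar\varphi^{-1}(\bar y+x)-x)=0$. For $\hat{\mathrm g}$-a.a. $\hat\gamma$ the product over $z\in\hat\gamma$ has only finitely many factors different from $1$. $\mathcal I_{\mathfrak q}F:=F\circ\mathfrak q$ is an isometry $L^2(\Gamma_X,\mathrm g_{\mathrm{cl}})\to L^2(\Gamma_{\mathcal Z},\hat{\mathrm g})$; $\mathcal I_{\mathfrak q}^*$ is its adjoint, extended to $L^1(\Gamma_{\mathcal Z},\hat{\mathrm g})\to L^1(\Gamma_X,\mathrm g_{\mathrm{cl}})$ by $\int F\,\mathcal I_{\mathfrak q}^*G\,d\mathrm g_{\mathrm{cl}}=\int (F\circ\mathfrak q)\,G\,d\hat{\mathrm g}$ for all $F\in L^\infty(\Gamma_X,\mathrm g_{\mathrm{cl}})$. *)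

theory Defs
  imports "HOL-Probability.Probability" "HOL-Combinatorics.Permutations"
begin

text \<open>
  The disjoint union of the powers \<open>X\<^sup>n\<close>, \<open>n \<ge> 0\<close>, is the type of lists over \<open>X\<close>, a list of
  length \<open>n\<close> being a point of \<open>X\<^sup>n\<close>.  It carries the disjoint union topology: a set is open iff
  its trace on each \<open>X\<^sup>n\<close> (in the coordinates \<open>v \<mapsto> [v 0, ..., v (n - 1)]\<close>) is open in the
  product topology.
\<close>

definition list_of_vec :: "nat \<Rightarrow> (nat \<Rightarrow> 'a) \<Rightarrow> 'a list" where
  "list_of_vec n v = map v [0..<n]"

instantiation list :: (topological_space) topological_space
begin

definition open_list :: "'a list set \<Rightarrow> bool" where
  "open_list U \<longleftrightarrow>
     (\<forall>n. openin (product_topology (\<lambda>_. euclidean) {..<n})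
            {v \<in> extensional {..<n}. list_of_vec n v \<in> U})"

instance
proof
  show "open (UNIV :: 'a list set)"
    unfolding open_list_def
  proof
    fix n
    have *: "{v \<in> extensional {..<n}. list_of_vec n v \<in> (UNIV :: 'a list set)} =
          topspace (product_topology (\<lambda>_. euclidean) {..<n})"
      by (auto simp: PiE_def extensional_def)
    show "openin (product_topology (\<lambda>_. euclidean) {..<n})
            {v \<in> extensional {..<n}. list_of_vec n v \<in> (UNIV :: 'a list set)}"
      unfolding * by (rule openin_topspace)
  qed
next
  fix S T :: "'a list set"
  assume ST: "open S" "open T"
  show "open (S \<inter> T)"
    unfolding open_list_def
  proof
    fix n
    have *: "{v \<in> extensional {..<n}. list_of_vec n v \<in> S \<inter> T} =
        {v \<in> extensional {..<n}. list_of_vec n v \<in> S} \<inter>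
        {v \<in> extensional {..<n}. list_of_vec n v \<in> T}"
      by blast
    show "openin (product_topology (\<lambda>_. euclidean) {..<n})
            {v \<in> extensional {..<n}. list_of_vec n v \<in> S \<inter> T}"
      unfolding * using ST unfolding open_list_def by (intro openin_Int) blast+
  qed
next
  fix K :: "'a list set set"
  assume K: "\<forall>S\<in>K. open S"
  show "open (\<Union>K)"
    unfolding open_list_def
  proof
    fix n
    have *: "{v \<in> extensional {..<n}. list_of_vec n v \<in> \<Union>K} =
        \<Union> ((\<lambda>S. {v \<in> extensional {..<n}. list_of_vec n v \<in> S}) ` K)"
      by blast
    show "openin (product_topology (\<lambda>_. euclidean) {..<n})
            {v \<in> extensional {..<n}. list_of_vec n v \<in> \<Union>K}"
      unfolding * using K unfolding open_list_def by (intro openin_Union) blast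
  qed
qed

end

text \<open>For \<open>n = 0\<close> the product measure is the unit mass at the only point of \<open>X\<^sup>0\<close>.\<close>

definition list_lborel :: "'a::euclidean_space list measure" where
  "list_lborel = measure_of UNIV (sets borel)
     (\<lambda>B. \<Sum>n. emeasure (distr (\<Pi>\<^sub>M i\<in>{..<n}. lborel) borel (list_of_vec n)) B)"

definition shift :: "'a list \<Rightarrow> 'a \<Rightarrow> 'a::plus list" where
  "shift ys x = map (\<lambda>y. y + x) ys"

definition perm_invariant :: "'a::topological_space list measure \<Rightarrow> bool" where
  "perm_invariant \<eta> \<longleftrightarrow>
     (\<forall>n p. \<forall>B\<in>sets borel. p permutes {..<n} \<longrightarrow>
        emeasure \<eta> {ys. length ys = n \<and> permute_list p ys \<in> B} =
        emeasure \<eta> {ys. length ys = n \<and> ys \<in> B})"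

definition configs :: "'a::topological_space set set" where
  "configs = {\<gamma>. \<forall>K. compact K \<longrightarrow> finite (\<gamma> \<inter> K)}"

definition config_space :: "'a::topological_space set measure" where
  "config_space = sigma configs
     {{\<gamma> \<in> configs. finite (\<gamma> \<inter> B) \<and> card (\<gamma> \<inter> B) = n} | B n. B \<in> sets borel}"

definition finite_config_space :: "'a::topological_space set measure" where
  "finite_config_space = restrict_space config_space {\<gamma>. finite \<gamma>}"

definition interaction_potential :: "('a::topological_space set \<Rightarrow> ereal) \<Rightarrow> bool" where
  "interaction_potential \<Phi> \<longleftrightarrow>
     \<Phi> \<in> borel_measurable finite_config_space \<and> \<Phi> {} = 0 \<and> (\<forall>\<gamma>. finite \<gamma> \<longrightarrow> \<Phi> \<gamma> \<noteq> -\<infinity>)"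

text \<open>A sum with an infinite term is not absolutely convergent.\<close>

definition energy :: "('a set \<Rightarrow> ereal) \<Rightarrow> 'a \<Rightarrow> 'a set \<Rightarrow> ereal" where
  "energy \<Phi> x \<gamma> =
     (let S = {\<gamma>'. \<gamma>' \<subseteq> \<gamma> \<and> finite \<gamma>'}; u = (\<lambda>\<gamma>'. \<Phi> (insert x \<gamma>')) in
      if x \<notin> \<gamma> \<and> (\<forall>\<gamma>'\<in>S. \<bar>u \<gamma>'\<bar> \<noteq> \<infinity>) \<and> (\<lambda>\<gamma>'. \<bar>real_of_ereal (u \<gamma>')\<bar>) summable_on S
      then ereal (\<Sum>\<^sub>\<infinity>\<gamma>'\<in>S. real_of_ereal (u \<gamma>'))
      else \<infinity>)"

definition exp_minus :: "ereal \<Rightarrow> ennreal" where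
  "exp_minus e = (if e = \<infinity> then 0 else ennreal (exp (- real_of_ereal e)))"

definition gibbs_measures ::
  "'a::topological_space measure \<Rightarrow> ('a set \<Rightarrow> ereal) \<Rightarrow> 'a set measure set" where
  "gibbs_measures \<theta> \<Phi> = {g. prob_space g \<and> sets g = sets config_space \<and>
     (\<forall>H :: 'a \<times> 'a set \<Rightarrow> real.
        H \<in> borel_measurable (borel \<Otimes>\<^sub>M config_space) \<longrightarrow> (\<forall>z. 0 \<le> H z) \<longrightarrow>
        (\<integral>\<^sup>+\<gamma>. (\<integral>\<^sup>+x. ennreal (H (x, \<gamma>)) \<partial>count_space \<gamma>) \<partial>g) =
        (\<integral>\<^sup>+\<gamma>. (\<integral>\<^sup>+x. ennreal (H (x, insert x \<gamma>)) * exp_minus (energy \<Phi> x \<gamma>) \<partial>\<theta>) \<partial>g))}"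

definition first_correlation ::
  "'a::topological_space measure \<Rightarrow> 'a set measure \<Rightarrow> ('a \<Rightarrow> real) \<Rightarrow> bool" where
  "first_correlation \<theta> g \<kappa> \<longleftrightarrow> \<kappa> \<in> borel_measurable borel \<and> (\<forall>x. 0 \<le> \<kappa> x) \<and>
     (\<forall>B\<in>sets borel.
        (\<integral>\<^sup>+\<gamma>. emeasure (count_space UNIV) (\<gamma> \<inter> B) \<partial>g) = (\<integral>\<^sup>+x\<in>B. ennreal (\<kappa> x) \<partial>\<theta>))"

text \<open>The marks \<open>f x\<close>, \<open>x \<in> \<gamma>\<close>, are i.i.d. with distribution \<open>\<eta>\<close> given \<open>\<gamma>\<close>.\<close>

definition marked_measure ::
  "'a::topological_space set measure \<Rightarrow> 'a list measure \<Rightarrow> ('a \<times> 'a list) set measure" where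
  "marked_measure g \<eta> =
     g \<bind> (\<lambda>\<gamma>. distr (\<Pi>\<^sub>M x\<in>\<gamma>. \<eta>) config_space (\<lambda>f. (\<lambda>x. (x, f x)) ` \<gamma>))"

text \<open>
  The collection \<open>q(\<gamma>)\<close> of all droplet points may have multiple points and accumulation points;
  it is represented by its multiplicity function.  It is an element of the configuration space iff
  it is \<open>simple_config\<close>, in which case it is identified with its support \<open>q_config\<close>.
\<close>

definition q_mult :: "('a \<times> 'a list) set \<Rightarrow> 'a::plus \<Rightarrow> enat" where
  "q_mult \<gamma> p = (\<Sum>\<^sub>\<infinity>(x, ys)\<in>\<gamma>. of_nat (count_list (shift ys x) p))"

definition q_config :: "('a \<times> 'a list) set \<Rightarrow> 'a::plus set" where
  "q_config \<gamma> = {p. q_mult \<gamma> p \<noteq> 0}"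

definition simple_config :: "('a \<times> 'a::{plus,topological_space} list) set \<Rightarrow> bool" where
  "simple_config \<gamma> \<longleftrightarrow> (\<forall>p. q_mult \<gamma> p \<le> 1) \<and> q_config \<gamma> \<in> configs"

text \<open>
  Image measure under \<open>q\<close>, as a measure on the configuration space: its value at \<open>A\<close> is
  the measure of those \<open>\<gamma>\<close> for which \<open>q(\<gamma>)\<close> is a configuration belonging to \<open>A\<close>.
\<close>

definition q_image ::
  "('a \<times> 'a::{plus,topological_space} list) set measure \<Rightarrow> 'a set measure" where
  "q_image M = distr (restrict_space M {\<gamma>. simple_config \<gamma>}) config_space q_config"

definition cluster_measure ::
  "'a::{plus,topological_space} set measure \<Rightarrow> 'a list measure \<Rightarrow> 'a set measure" where
  "cluster_measure g \<eta> = q_image (marked_measure g \<eta>)"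

text \<open>
  The composition \<open>F \<circ> q\<close>, set to \<open>0\<close> where \<open>q(\<gamma>)\<close> is not a configuration.
\<close>

definition q_pullback ::
  "('a set \<Rightarrow> real) \<Rightarrow> ('a \<times> 'a::{plus,topological_space} list) set \<Rightarrow> real" where
  "q_pullback F \<gamma> = (if simple_config \<gamma> then F (q_config \<gamma>) else 0)"

text \<open>
  \<open>R\<close> is a version of the image of \<open>G\<close> under the adjoint of \<open>F \<mapsto> F \<circ> q\<close>, extended to a
  map between \<open>L\<^sup>1\<close> spaces; this determines \<open>R\<close> up to null sets.
\<close>

definition is_q_adjoint ::
  "('a \<times> 'a::{plus,topological_space} list) set measure \<Rightarrow>
   (('a \<times> 'a list) set \<Rightarrow> real) \<Rightarrow> ('a set \<Rightarrow> real) \<Rightarrow> bool" where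
  "is_q_adjoint M G R \<longleftrightarrow> integrable M G \<and> integrable (q_image M) R \<and>
     (\<forall>F \<in> borel_measurable config_space. bounded (range F) \<longrightarrow>
        (LINT \<gamma>|q_image M. F \<gamma> * R \<gamma>) = (LINT \<gamma>|M. q_pullback F \<gamma> * G \<gamma>))"

definition jacobian :: "(real^'n \<Rightarrow> real^'n) \<Rightarrow> real^'n \<Rightarrow> real^'n^'n" where
  "jacobian f x = matrix (frechet_derivative f (at x))"

definition C1_map :: "(real^'n \<Rightarrow> real^'n) \<Rightarrow> bool" where
  "C1_map f \<longleftrightarrow> (\<forall>x. f differentiable (at x)) \<and> continuous_on UNIV (jacobian f)"

text \<open>
  Diffeomorphisms are of class \<open>C\<^sup>1\<close>; this includes those of class \<open>C\<^sup>k\<close> for all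
  \<open>1 \<le> k \<le> \<infinity>\<close>.
\<close>

definition Diff0 :: "(real^'n \<Rightarrow> real^'n) set" where
  "Diff0 = {\<phi>. bij \<phi> \<and> C1_map \<phi> \<and> C1_map (inv \<phi>) \<and> (\<exists>K. compact K \<and> (\<forall>x. x \<notin> K \<longrightarrow> \<phi> x = x))}"

definition hat_map :: "('a \<Rightarrow> 'a) \<Rightarrow> 'a \<times> 'a list \<Rightarrow> 'a \<times> 'a::group_add list" where
  "hat_map \<phi> = (\<lambda>(x, ys). (x, shift (map \<phi> (shift ys x)) (- x)))"

definition rho :: "((real^'n) list \<Rightarrow> real) \<Rightarrow> (real^'n \<Rightarrow> real^'n) \<Rightarrow> (real^'n) \<times> (real^'n) list \<Rightarrow> real"
  where
  "rho h \<phi> = (\<lambda>(x, ys).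
     let ys' = shift (map (inv \<phi>) (shift ys x)) (- x) in
     if h ys = 0 \<or> h ys' = 0 then 1
     else h ys' / h ys * (\<Prod>y\<leftarrow>ys. \<bar>det (jacobian (inv \<phi>) (y + x))\<bar>))"

text \<open>
  The product over all \<open>z \<in> \<gamma>\<close>; almost surely only finitely many factors differ from \<open>1\<close>.
\<close>

definition hat_density ::
  "((real^'n) list \<Rightarrow> real) \<Rightarrow> (real^'n \<Rightarrow> real^'n) \<Rightarrow> ((real^'n) \<times> (real^'n) list) set \<Rightarrow> real" where
  "hat_density h \<phi> \<gamma> = (\<Prod>z\<in>{z \<in> \<gamma>. rho h \<phi> z \<noteq> 1}. rho h \<phi> z)"

end

theory Submission
  imports Defs
begin

text \<open>
  Conditionally on the centres \<open>\<gamma>\<close> the marks are i.i.d., and \<open>hat_map \<phi>\<close> acts on each mark separately,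
  changing its distribution \<open>\<eta>\<close> by the factor \<open>rho h \<phi> (x, \<cdot>)\<close>; this is the change of variables
  formula on each \<open>X\<^sup>n\<close>.  A mark whose droplets all miss the support \<open>K\<close> of \<open>\<phi>\<close> is not moved.  By the
  bounds on \<open>\<theta>\<close>, \<open>\<kappa>\<close> and the mean cluster size, the expected number of clusters hitting \<open>K\<close> is
  finite, so almost surely only clusters with centres in some ball of radius \<open>m\<close> are moved.  On the
  event \<open>localized K m\<close> only finitely many coordinates of the product measure change, whence the
  density is a finite product there; letting \<open>m\<close> tend to infinity gives the density of the marked
  measure.  Since taking droplets intertwines \<open>hat_map \<phi>\<close> with \<open>\<phi>\<close> and the density is positive, the
  result descends to the cluster measure.
\<close>

section \<open>The disjoint union topology on lists\<close>

text \<open>Infinite products of mutually equivalent laws can be mutually singular (Kakutani), so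
  equivalence mark by mark is not enough; what is used is that only finitely many marks move. Which
  ones do depends on the marks themselves. The event \<open>localized K m\<close> replaces this
  random index set by \<open>\<gamma> \<inter> cball 0 (real m)\<close>, which is fixed once the
  centres are, and it is invariant under \<open>hat_map \<phi>\<close>; on it the map can be
  exchanged for one acting on those coordinates alone. The expected number of clusters hitting
  \<open>K\<close> is at most the product of a bound for \<open>\<kappa>\<close>, the supremum of
  \<open>\<theta>\<close> over the translates of \<open>K\<close>, and the mean cluster size.
  Positivity of \<open>h\<close> makes it nonzero almost everywhere both at a mark and at its
  preimage, so the default value 1 of \<open>rho\<close> is only met on a null set. Two
  measurability questions shape the rest. The marking kernel is tested on void events, which
  generate and whose probabilities are limits of finite products. The droplet map is used on
  \<open>simple_config\<close> only, a measurable set that \<open>hat_map \<phi>\<close> leaves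
  invariant.\<close>

lemma open_list_iff:
  "open U \<longleftrightarrow> (\<forall>ys\<in>U. \<exists>Us. (\<forall>A\<in>set Us. open A) \<and> list_all2 (\<in>) ys Us \<and> {zs. list_all2 (\<in>) zs Us} \<subseteq> U)"
proof (intro iffI ballI)
  fix ys assume U: "open U" and ys: "ys \<in> U"
  define n v where "n = length ys" and "v = restrict ((!) ys) {..<n}"
  have lv: "list_of_vec n (restrict ((!) zs) {..<n}) = zs" if "length zs = n" for zs :: "'a list"
    using that by (auto simp: list_of_vec_def intro!: nth_equalityI)
  have "v \<in> {v \<in> extensional {..<n}. list_of_vec n v \<in> U}"
    using ys lv[of ys] by (auto simp: v_def n_def)
  \<comment> \<open>The product topology constrains \<open>W i\<close> for \<open>i < n\<close>
    only; the other values are replaced by \<open>UNIV\<close>, so that every \<open>W i\<close> is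
    open.\<close>
  then obtain W where W: "\<And>i. open (W i)" "v \<in> Pi\<^sub>E {..<n} W"
    "Pi\<^sub>E {..<n} W \<subseteq> {v \<in> extensional {..<n}. list_of_vec n v \<in> U}"
    using U unfolding open_list_def openin_product_topology_alt
    apply (drule_tac x=n in spec)
    apply (drule_tac x=v in bspec, assumption)
    apply clarsimp
    subgoal for W
    by (erule meta_allE[of _ "\<lambda>i. if i < n then W i else UNIV"]) (auto simp: PiE_iff subset_iff split: if_splits)
    done
  show "\<exists>Us. (\<forall>A\<in>set Us. open A) \<and> list_all2 (\<in>) ys Us \<and> {zs. list_all2 (\<in>) zs Us} \<subseteq> U"
  proof (intro exI conjI subsetI)
    show "\<forall>A\<in>set (map W [0..<n]). open A"
      using W(1) by auto
    show "list_all2 (\<in>) ys (map W [0..<n])"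
      using W(2) by (auto simp: list_all2_conv_all_nth v_def n_def PiE_iff)
    fix zs assume "zs \<in> {zs. list_all2 (\<in>) zs (map W [0..<n])}"
    hence "length zs = n" "restrict ((!) zs) {..<n} \<in> Pi\<^sub>E {..<n} W"
      by (auto simp: list_all2_conv_all_nth)
    thus "zs \<in> U"
      using subsetD[OF W(3), of "restrict ((!) zs) {..<n}"] lv[of zs] by simp
  qed
next
  assume *: "\<forall>ys\<in>U. \<exists>Us. (\<forall>A\<in>set Us. open A) \<and> list_all2 (\<in>) ys Us \<and> {zs. list_all2 (\<in>) zs Us} \<subseteq> U"
  show "open U"
    unfolding open_list_def openin_product_topology_alt
  proof (intro allI ballI)
    fix n v assume v: "v \<in> {v \<in> extensional {..<n}. list_of_vec n v \<in> U}"
    then obtain Us where Us: "\<forall>A\<in>set Us. open A" "list_all2 (\<in>) (list_of_vec n v) Us"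
      "{zs. list_all2 (\<in>) zs Us} \<subseteq> U"
      using * by blast
    have len: "length Us = n"
      using Us(2) by (auto simp: list_all2_conv_all_nth list_of_vec_def)
    show "\<exists>W. finite {i \<in> {..<n}. W i \<noteq> topspace euclidean} \<and> (\<forall>i\<in>{..<n}. openin euclidean (W i)) \<and>
              v \<in> Pi\<^sub>E {..<n} W \<and> Pi\<^sub>E {..<n} W \<subseteq> {v \<in> extensional {..<n}. list_of_vec n v \<in> U}"
    proof (intro exI conjI)
      show "v \<in> Pi\<^sub>E {..<n} ((!) Us)"
        using v Us(2) len by (auto simp: list_all2_conv_all_nth list_of_vec_def PiE_iff)
      show "Pi\<^sub>E {..<n} ((!) Us) \<subseteq> {v \<in> extensional {..<n}. list_of_vec n v \<in> U}"
        using Us(3) len by (auto simp: list_all2_conv_all_nth list_of_vec_def PiE_iff subset_iff)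
    qed (use Us len in auto)
  qed
qed

lemma open_list_box: "(\<forall>A\<in>set Us. open A) \<Longrightarrow> open {zs. list_all2 (\<in>) zs Us}"
  unfolding open_list_iff by blast

text \<open>The length of \<open>Us\<close> selects the component, so \<open>lists B\<close> indexes
  the boxes of all dimensions at once and permits induction on lists. It is countable when
  \<open>B\<close> is, which yields second countability.\<close>

lemma topological_basis_list:
  assumes B: "topological_basis B"
  shows "topological_basis ((\<lambda>Us. {zs. list_all2 (\<in>) zs Us}) ` lists B)"
proof (rule topological_basisI)
  fix U' :: "'a list set" assume "U' \<in> (\<lambda>Us. {zs. list_all2 (\<in>) zs Us}) ` lists B"
  thus "open U'"
    using topological_basis_open[OF B] by (auto intro!: open_list_box)
next
  fix O' :: "'a list set" and ys assume "open O'" "ys \<in> O'"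
  then obtain Us where Us: "\<forall>A\<in>set Us. open A" "list_all2 (\<in>) ys Us" "{zs. list_all2 (\<in>) zs Us} \<subseteq> O'"
    unfolding open_list_iff[of O'] by blast
  have "\<exists>Vs\<in>lists B. list_all2 (\<in>) ys Vs \<and> {zs. list_all2 (\<in>) zs Vs} \<subseteq> {zs. list_all2 (\<in>) zs Us}"
    using Us(2,1)
  proof (induction rule: list_all2_induct)
    case Nil
    show ?case by (auto intro!: bexI[of _ "[]"])
  next
    case (Cons y ys A Us)
    then obtain Vs where "Vs \<in> lists B" "list_all2 (\<in>) ys Vs" "{zs. list_all2 (\<in>) zs Vs} \<subseteq> {zs. list_all2 (\<in>) zs Us}"
      by auto
    moreover obtain V where "V \<in> B" "y \<in> V" "V \<subseteq> A"
      using Cons topological_basisE[OF B, of A y] by auto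
    ultimately show ?case
      by (intro bexI[of _ "V # Vs"]) (auto simp: list_all2_Cons2)
  qed
  thus "\<exists>B'\<in>(\<lambda>Us. {zs. list_all2 (\<in>) zs Us}) ` lists B. ys \<in> B' \<and> B' \<subseteq> O'"
    using Us(3) by fastforce
qed

instance list :: (second_countable_topology) second_countable_topology
proof
  obtain B :: "'a set set" where B: "countable B" "topological_basis B"
    using ex_countable_basis by blast
  show "\<exists>B::'a list set set. countable B \<and> open = generate_topology B"
    using B(1) topological_basis_imp_subbasis[OF topological_basis_list[OF B(2)]]
    by (intro exI[of _ "(\<lambda>Us. {zs. list_all2 (\<in>) zs Us}) ` lists B"]) auto
qed

lemma open_list_length: "open {ys :: 'a::topological_space list. length ys = n}"
proof -
  have "{ys :: 'a list. length ys = n} = {ys. list_all2 (\<in>) ys (replicate n UNIV)}"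
    by (auto simp: list_all2_conv_all_nth)
  thus ?thesis
    using open_list_box[of "replicate n UNIV"] by auto
qed

lemma open_list_nth:
  assumes "open A"
  shows "open {ys. i < length ys \<and> ys ! i \<in> A}"
proof -
  have "{ys. i < length ys \<and> ys ! i \<in> A} = (\<Union>n\<in>{i<..}. {ys. list_all2 (\<in>) ys (replicate i UNIV @ [A] @ replicate (n - Suc i) UNIV)})"
    by (auto simp: list_all2_conv_all_nth nth_append nth_Cons split: nat.splits)
  moreover have "open \<dots>"
    using assms by (intro open_UN ballI open_list_box) auto
  ultimately show ?thesis by simp
qed

text \<open>Lists of different lengths lie in disjoint open components; lists of equal length differ
  in some entry. The T0 axiom for marks feeds the separating sequence used for void events.\<close>

instance list :: (t0_space) t0_space
proof
  fix xs ys :: "'a list" assume ne: "xs \<noteq> ys"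
  show "\<exists>U. open U \<and> \<not> (xs \<in> U \<longleftrightarrow> ys \<in> U)"
  proof (cases "length xs = length ys")
    case False
    thus ?thesis
      using open_list_length[of "length xs"] by (intro exI[of _ "{zs. length zs = length xs}"]) auto
  next
    case True
    then obtain i where i: "i < length xs" "xs ! i \<noteq> ys ! i"
      using ne by (auto simp: list_eq_iff_nth_eq)
    then obtain A where "open A" "\<not> (xs ! i \<in> A \<longleftrightarrow> ys ! i \<in> A)"
      using i(2) by (auto simp: separation_t0)
    thus ?thesis
      using i True open_list_nth[of A i] by (intro exI[of _ "{zs. i < length zs \<and> zs ! i \<in> A}"]) auto
  qed
qed

text \<open>Continuity is joint in the list and a parameter, because \<open>shift\<close> and
  \<open>hat_map\<close> depend on the centre as well. The induction intersects one neighbourhood of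
  the parameter per entry, hence finitely many.\<close>

lemma continuous_on_map_list:
  fixes G :: "'a::topological_space \<Rightarrow> 'b::topological_space \<Rightarrow> 'c::topological_space"
  assumes "continuous_on UNIV (\<lambda>p. G (fst p) (snd p))"
  shows "continuous_on UNIV (\<lambda>p. map (G (fst p)) (snd p))"
  unfolding continuous_on_open_vimage[OF open_UNIV]
proof (intro allI impI)
  fix U :: "'c list set" assume U: "open U"
  have *: "\<exists>V W. open V \<and> open W \<and> a \<in> V \<and> ys \<in> W \<and> V \<times> W \<subseteq> (\<lambda>p. map (G (fst p)) (snd p)) -` U"
    if mem: "map (G a) ys \<in> U" for a ys
  proof -
    obtain Us where Us: "\<forall>A\<in>set Us. open A" "list_all2 (\<in>) (map (G a) ys) Us" "{zs. list_all2 (\<in>) zs Us} \<subseteq> U"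
      using U mem unfolding open_list_iff[of U] by blast
    have "list_all2 (\<lambda>y A. G a y \<in> A) ys Us"
      using Us(2) by (simp add: list_all2_conv_all_nth)
    hence "\<exists>V Ws. open V \<and> a \<in> V \<and> (\<forall>A\<in>set Ws. open A) \<and> list_all2 (\<in>) ys Ws \<and>
       (\<forall>b\<in>V. \<forall>zs. list_all2 (\<in>) zs Ws \<longrightarrow> list_all2 (\<in>) (map (G b) zs) Us)"
      using Us(1)
    proof (induction rule: list_all2_induct)
      case Nil
      show ?case by (intro exI[of _ UNIV] exI[of _ "[]"]) auto
    next
      case (Cons y ys A Us)
      then obtain V Ws where VW: "open V" "a \<in> V" "\<forall>A\<in>set Ws. open A" "list_all2 (\<in>) ys Ws"
       "\<And>b zs. b \<in> V \<Longrightarrow> list_all2 (\<in>) zs Ws \<Longrightarrow> list_all2 (\<in>) (map (G b) zs) Us"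
        by auto
      have "open ((\<lambda>p. G (fst p) (snd p)) -` A)"
        using Cons assms continuous_on_open_vimage[OF open_UNIV] by auto
      then obtain V' W where "open V'" "open W" "a \<in> V'" "y \<in> W" "V' \<times> W \<subseteq> (\<lambda>p. G (fst p) (snd p)) -` A"
        using Cons(1) by (auto elim!: open_prod_elim[of _ "(a, y)"])
      thus ?case
        using VW by (intro exI[of _ "V \<inter> V'"] exI[of _ "W # Ws"]) (auto simp: list_all2_Cons2)
    qed
    then obtain V Ws where VW: "open V" "a \<in> V" "\<forall>A\<in>set Ws. open A" "list_all2 (\<in>) ys Ws"
       "\<And>b zs. b \<in> V \<Longrightarrow> list_all2 (\<in>) zs Ws \<Longrightarrow> list_all2 (\<in>) (map (G b) zs) Us"
      by blast
    show ?thesis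
      using VW Us(3) open_list_box[OF VW(3)]
      by (intro exI[of _ V] exI[of _ "{zs. list_all2 (\<in>) zs Ws}"]) (simp add: subset_iff)
  qed
  show "open ((\<lambda>p. map (G (fst p)) (snd p)) -` U \<inter> UNIV)"
    unfolding Int_UNIV_right
  proof (intro open_prod_intro)
    fix p assume "p \<in> (\<lambda>p. map (G (fst p)) (snd p)) -` U"
    thus "\<exists>V W. open V \<and> open W \<and> p \<in> V \<times> W \<and> V \<times> W \<subseteq> (\<lambda>p. map (G (fst p)) (snd p)) -` U"
      using *[of "fst p" "snd p"] by (auto simp: mem_Times_iff)
  qed
qed

lemma continuous_on_Pair_const: "continuous_on UNIV (\<lambda>ys :: 'b::topological_space. (x :: 'a::topological_space, ys))"
  by (intro continuous_intros)

section \<open>Length and entries as Borel functions\<close>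

lemma measurable_length_list [measurable]:
  "length \<in> measurable borel (count_space UNIV)"
proof (rule measurable_count_space_eq2_countable[THEN iffD2])
qed (use open_list_length in \<open>auto simp: vimage_def intro!: borel_open\<close>)

lemma continuous_on_nth_list: "continuous_on {ys. i < length ys} (\<lambda>ys. ys ! i)"
  unfolding continuous_on_open_invariant
proof (intro allI impI)
  fix A :: "'a set" assume "open A"
  thus "\<exists>A'. open A' \<and> A' \<inter> {ys. i < length ys} = (\<lambda>ys. ys ! i) -` A \<inter> {ys. i < length ys}"
    using open_list_nth[of A i] by (intro exI[of _ "{ys. i < length ys \<and> ys ! i \<in> A}"]) auto
qed

text \<open>The default \<open>c\<close> on short lists makes the coordinate total. The lists that
  are long enough form an open set, on which the coordinate is continuous.\<close>

lemma measurable_nth_list [measurable]: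
  "(\<lambda>ys. if i < length ys then ys ! i else c) \<in> borel_measurable borel"
proof (rule measurable_If_restrict_space_iff[THEN iffD2])
  have "open {ys :: 'a list. i < length ys}"
    using open_list_nth[of UNIV i] by simp
  thus "{x \<in> space borel. i < length (x :: 'a list)} \<in> sets borel"
    by auto
qed (use borel_measurable_continuous_on_restrict[OF continuous_on_nth_list[of i]] in auto)

section \<open>Lebesgue measure on lists\<close>

text \<open>By second countability the Borel sets are generated by countably many boxes. The
  preimage of a box is a measurable rectangle if its length is \<open>n\<close> and empty
  otherwise.\<close>

lemma measurable_list_of_vec [measurable]:
  "list_of_vec n \<in> measurable (\<Pi>\<^sub>M i\<in>{..<n}. borel) (borel :: 'a::second_countable_topology list measure)"
proof -
  obtain B :: "'a set set" where B: "countable B" "topological_basis B"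
    using ex_countable_basis by blast
  have *: "borel = sigma UNIV ((\<lambda>Us. {zs :: 'a list. list_all2 (\<in>) zs Us}) ` lists B)"
    using B by (intro borel_eq_countable_basis topological_basis_list) auto
  show ?thesis
    unfolding *
  proof (rule measurable_measure_of)
    fix U :: "'a list set" assume "U \<in> (\<lambda>Us. {zs. list_all2 (\<in>) zs Us}) ` lists B"
    then obtain Us where Us: "Us \<in> lists B" "U = {zs. list_all2 (\<in>) zs Us}"
      by auto
    have "list_of_vec n -` U \<inter> space (\<Pi>\<^sub>M i\<in>{..<n}. borel) =
        (if length Us = n then Pi\<^sub>E {..<n} ((!) Us) else {})"
      unfolding Us(2) by (auto simp: list_all2_conv_all_nth list_of_vec_def space_PiM PiE_iff)
    moreover have "Pi\<^sub>E {..<n} ((!) Us) \<in> sets (\<Pi>\<^sub>M i\<in>{..<n}. borel)" if "length Us = n"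
      using Us(1) that topological_basis_open[OF B(2)] by (intro sets_PiM_I_finite) (auto simp: in_lists_conv_set)
    ultimately show "list_of_vec n -` U \<inter> space (\<Pi>\<^sub>M i\<in>{..<n}. borel) \<in> sets (\<Pi>\<^sub>M i\<in>{..<n}. borel)"
      by auto
  qed auto
qed

lemma sets_list_lborel [simp, measurable_cong]: "sets list_lborel = sets borel"
proof -
  have "sigma_sets UNIV (sets borel) = sets (borel :: 'a list measure)"
    using sets.sigma_sets_eq[of "borel :: 'a list measure"] by simp
  thus ?thesis
    unfolding list_lborel_def by (subst sets_measure_of) auto
qed

lemma space_list_lborel [simp]: "space list_lborel = UNIV"
  using sets_eq_imp_space_eq[OF sets_list_lborel] by simp

lemma ennreal_suminf_swap:
  fixes f :: "nat \<Rightarrow> nat \<Rightarrow> ennreal"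
  shows "(\<Sum>i. \<Sum>j. f i j) = (\<Sum>j. \<Sum>i. f i j)"
proof -
  have "(\<Sum>j. \<Sum>i. f i j) = (\<integral>\<^sup>+j. (\<Sum>i. f i j) \<partial>count_space UNIV)"
    by (rule nn_integral_count_space_nat[symmetric])
  also have "\<dots> = (\<Sum>i. \<integral>\<^sup>+j. f i j \<partial>count_space UNIV)"
    by (rule nn_integral_suminf) auto
  also have "\<dots> = (\<Sum>i. \<Sum>j. f i j)"
    by (simp add: nn_integral_count_space_nat)
  finally show ?thesis ..
qed

lemma emeasure_list_lborel:
  fixes B :: "'a::euclidean_space list set"
  assumes "B \<in> sets borel"
  shows "emeasure list_lborel B = (\<Sum>n. emeasure (distr (\<Pi>\<^sub>M i\<in>{..<n}. lborel) borel (list_of_vec n)) B)"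
proof (rule emeasure_measure_of[OF list_lborel_def])
  show "countably_additive (sets list_lborel)
     (\<lambda>B :: 'a list set. \<Sum>n. emeasure (distr (\<Pi>\<^sub>M i\<in>{..<n}. lborel) borel (list_of_vec n)) B)"
  proof (rule countably_additiveI)
    fix A :: "nat \<Rightarrow> 'a list set" assume "range A \<subseteq> sets list_lborel" "disjoint_family A"
    thus "(\<Sum>i. \<Sum>n. emeasure (distr (\<Pi>\<^sub>M i\<in>{..<n}. lborel) borel (list_of_vec n)) (A i)) =
        (\<Sum>n. emeasure (distr (\<Pi>\<^sub>M i\<in>{..<n}. lborel) borel (list_of_vec n)) (\<Union>i. A i))"
      by (subst ennreal_suminf_swap) (auto intro!: suminf_cong suminf_emeasure)
  qed
qed (use assms in \<open>auto simp: positive_def\<close>)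

lemma nn_integral_list_lborel:
  fixes f :: "'a::euclidean_space list \<Rightarrow> ennreal"
  assumes "f \<in> borel_measurable borel"
  shows "(\<integral>\<^sup>+ys. f ys \<partial>list_lborel) = (\<Sum>n. \<integral>\<^sup>+v. f (list_of_vec n v) \<partial>(\<Pi>\<^sub>M i\<in>{..<n}. lborel))"
  using assms
proof (induction rule: borel_measurable_induct)
  case (cong f g)
  hence "f = g" by auto
  thus ?case using cong by simp
next
  case (set A)
  have "(\<integral>\<^sup>+v. indicator A (list_of_vec n v) \<partial>(\<Pi>\<^sub>M i\<in>{..<n}. lborel)) =
     emeasure (distr (\<Pi>\<^sub>M i\<in>{..<n}. lborel) borel (list_of_vec n)) A" for n
    using set by (subst nn_integral_indicator[symmetric], simp, subst nn_integral_distr) auto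
  thus ?case using set by (simp add: emeasure_list_lborel)
next
  case (mult u c)
  thus ?case by (simp add: nn_integral_cmult)
next
  case (add u v)
  thus ?case by (simp add: nn_integral_add suminf_add)
next
  case (seq U)
  have [measurable]: "U i \<in> borel_measurable borel" for i
    using seq by simp
  have "(\<integral>\<^sup>+ys. (SUP i. U i) ys \<partial>list_lborel) = (SUP i. \<integral>\<^sup>+ys. U i ys \<partial>list_lborel)"
    unfolding SUP_apply using seq by (intro nn_integral_monotone_convergence_SUP) auto
  also have "\<dots> = (SUP i. \<integral>\<^sup>+n. (\<integral>\<^sup>+v. U i (list_of_vec n v) \<partial>(\<Pi>\<^sub>M i\<in>{..<n}. lborel)) \<partial>count_space UNIV)"
    by (simp add: seq.IH nn_integral_count_space_nat)
  also have "\<dots> = (\<integral>\<^sup>+n. (SUP i. \<integral>\<^sup>+v. U i (list_of_vec n v) \<partial>(\<Pi>\<^sub>M i\<in>{..<n}. lborel)) \<partial>count_space UNIV)"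
    using seq by (intro nn_integral_monotone_convergence_SUP[symmetric])
      (auto simp: incseq_def le_fun_def intro!: nn_integral_mono)
  also have "\<dots> = (\<integral>\<^sup>+n. (\<integral>\<^sup>+v. (SUP i. U i) (list_of_vec n v) \<partial>(\<Pi>\<^sub>M i\<in>{..<n}. lborel)) \<partial>count_space UNIV)"
    unfolding SUP_apply using seq by (intro nn_integral_cong nn_integral_monotone_convergence_SUP[symmetric])
      (auto simp: incseq_def le_fun_def)
  finally show ?case by (simp add: nn_integral_count_space_nat)
qed

text \<open>Reduces measurability on lists to measurability on each power: the length takes
  countably many values, and for a fixed length the list is rebuilt from its coordinates. The value
  \<open>undefined\<close> does not reach the result, because \<open>n\<close> is finally the actual
  length.\<close>

lemma measurable_fold_list:
  fixes c :: "'a::topological_space \<Rightarrow> 'b::topological_space"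
  assumes c: "c \<in> borel_measurable borel"
    and F: "\<And>n. (\<lambda>v. F (map v [0..<n])) \<in> measurable (\<Pi>\<^sub>M i\<in>{..<n}. borel) N"
  shows "(\<lambda>ys. F (map c ys)) \<in> measurable borel N"
proof -
  note [measurable] = c
  have "(\<lambda>ys. F (map (\<lambda>i\<in>{..<length ys}. c (if i < length ys then ys ! i else undefined)) [0..<length ys])) \<in> measurable borel N"
  proof (rule measurable_compose_countable'[where I = UNIV and f = "\<lambda>n ys. F (map (\<lambda>i\<in>{..<n}. c (if i < length ys then ys ! i else undefined)) [0..<n])"])
    fix n
    show "(\<lambda>ys. F (map (\<lambda>i\<in>{..<n}. c (if i < length ys then ys ! i else undefined)) [0..<n])) \<in> measurable borel N"
      by (rule measurable_compose[OF _ F]) measurable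
  qed auto
  moreover have "map (\<lambda>i\<in>{..<length ys}. c (if i < length ys then ys ! i else undefined)) [0..<length ys] = map c ys" for ys
    by (auto intro!: nth_equalityI)
  ultimately show ?thesis by simp
qed

lemma prod_list_map_upt: "prod_list (map v [0..<n]) = (\<Prod>i<n. v i :: 'a::comm_monoid_mult)"
  by (simp add: prod.list_conv_set_nth atLeast0LessThan)

lemma sum_list_map_upt: "sum_list (map v [0..<n]) = (\<Sum>i<n. v i :: 'a::comm_monoid_add)"
  by (simp add: interv_sum_list_conv_sum_set_nat atLeast0LessThan)

lemma measurable_prod_list [measurable]:
  fixes c :: "'a::topological_space \<Rightarrow> real"
  assumes [measurable]: "c \<in> borel_measurable borel"
  shows "(\<lambda>ys. prod_list (map c ys)) \<in> borel_measurable borel"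
  by (rule measurable_fold_list[OF assms]) (simp add: prod_list_map_upt)

lemma measurable_sum_list [measurable]:
  fixes c :: "'a::topological_space \<Rightarrow> ennreal"
  assumes [measurable]: "c \<in> borel_measurable borel"
  shows "(\<lambda>ys. sum_list (map c ys)) \<in> borel_measurable borel"
  by (rule measurable_fold_list[OF assms]) (simp add: sum_list_map_upt)

lemma continuous_on_shift:
  "continuous_on UNIV (\<lambda>p :: 'a::real_normed_vector \<times> 'a list. shift (snd p) (fst p))"
  unfolding shift_def by (intro continuous_on_map_list continuous_intros)

lemma measurable_shift [measurable]:
  "(\<lambda>p :: 'a::real_normed_vector \<times> 'a list. shift (snd p) (fst p)) \<in> borel_measurable borel"
  using continuous_on_shift by (rule borel_measurable_continuous_onI)

section \<open>Change of variables under diffeomorphisms\<close>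

text \<open>The change of variables theorems of the library require a well-ordered index type.\<close>

typedef 'a ordered = "UNIV :: 'a set"
  morphisms unordered ordered
  by auto

lemma bij_unordered: "bij unordered"
  by (metis UNIV_I bijI' ordered_inverse unordered_inject)

instance ordered :: (finite) finite
  by standard (metis bij_betw_finite bij_unordered finite)

text \<open>An arbitrary injection into \<open>nat\<close>; it serves to pull the order of
  \<open>nat\<close> back to the index type.\<close>

definition index_of :: "'a::finite \<Rightarrow> nat" where
  "index_of = (SOME f. inj f)"

lemma inj_index_of: "inj (index_of :: 'a::finite \<Rightarrow> nat)"
proof -
  have "\<exists>f :: 'a \<Rightarrow> nat. inj f"
    using finite_imp_inj_to_nat_seg[of "UNIV :: 'a set"] by auto
  thus ?thesis
    unfolding index_of_def by (rule someI_ex)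
qed

instantiation ordered :: (finite) linorder
begin

definition "x \<le> y \<longleftrightarrow> index_of (unordered x) \<le> index_of (unordered y)"
definition "x < y \<longleftrightarrow> index_of (unordered x) < index_of (unordered y)"

instance
  by standard
    (auto simp: less_eq_ordered_def less_ordered_def unordered_inject dest!: injD[OF inj_index_of])

end

instance ordered :: (finite) wellorder
proof -
  have "wf {(x :: 'a ordered, y). x < y}"
    by (auto simp: trancl_def tranclp_less intro!: finite_acyclic_wf acyclicI)
  thus "OFCLASS('a ordered, wellorder_class)"
    by (rule wf_wellorderI) intro_classes
qed

section \<open>Relabelling coordinates: determinant and Lebesgue measure\<close>

text \<open>In the Leibniz formula a permutation \<open>p\<close> is matched with its conjugate by
  \<open>f\<close>, which has the same sign and contributes the same product of entries.\<close>

lemma det_reindex: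
  fixes A :: "'c::comm_ring_1^'n^'n" and f :: "'m::finite \<Rightarrow> 'n::finite"
  assumes f: "bij f"
  shows "det (\<chi> i j. A $ f i $ f j) = det A"
  unfolding det_def
proof (rule sum.reindex_bij_witness[where
      i = "\<lambda>q. inv f \<circ> q \<circ> f" and j = "\<lambda>p. f \<circ> p \<circ> inv f"])
  have f': "f (inv f x) = x" "inv f (f y) = y" for x y
    using f by (simp_all add: bij_is_surj surj_f_inv_f bij_is_inj)
  have conj: "f \<circ> p \<circ> inv f permutes UNIV \<and> sign (f \<circ> p \<circ> inv f) = sign p" if "p permutes UNIV" for p
  proof -
    interpret permutes_bij_finite p UNIV UNIV f "inv f" "f \<circ> p \<circ> inv f"
      using f f' that by unfold_locales (auto simp: bij_betw_def fun_eq_iff intro!: eq_reflection)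
    show ?thesis using sign_p' permutes_p' by simp
  qed
  fix p :: "'m \<Rightarrow> 'm" assume p: "p \<in> {p. p permutes UNIV}"
  show "inv f \<circ> (f \<circ> p \<circ> inv f) \<circ> f = p"
    by (auto simp: fun_eq_iff f')
  show "f \<circ> p \<circ> inv f \<in> {p. p permutes UNIV}"
    using conj p by blast
  have "(\<Prod>i\<in>UNIV. A $ i $ (f \<circ> p \<circ> inv f) i) = (\<Prod>i\<in>UNIV. A $ f i $ (f \<circ> p \<circ> inv f) (f i))"
    using f by (intro prod.reindex_bij_betw[symmetric]) auto
  thus "of_int (sign (f \<circ> p \<circ> inv f)) * (\<Prod>i\<in>UNIV. A $ i $ (f \<circ> p \<circ> inv f) i) =
        of_int (sign p) * (\<Prod>i\<in>UNIV. (\<chi> i j. A $ f i $ f j) $ i $ p i)"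
    using conj p by (simp add: f')
next
  have f': "f (inv f x) = x" "inv f (f y) = y" for x y
    using f by (simp_all add: bij_is_surj surj_f_inv_f bij_is_inj)
  fix q :: "'n \<Rightarrow> 'n" assume q: "q \<in> {q. q permutes UNIV}"
  show "f \<circ> (inv f \<circ> q \<circ> f) \<circ> inv f = q"
    by (auto simp: fun_eq_iff f')
  show "inv f \<circ> q \<circ> f \<in> {p. p permutes UNIV}"
    using q f by (auto simp: permutes_altdef bij_imp_bij_inv intro!: bij_comp)
qed

definition reindex :: "('m \<Rightarrow> 'n) \<Rightarrow> real^'n \<Rightarrow> real^'m" where
  "reindex f v = (\<chi> i. v $ f i)"

lemma linear_reindex: "linear (reindex f)"
  by (rule linearI) (simp_all add: reindex_def vec_eq_iff)

text \<open>Lebesgue measure is determined by its values on boxes, and the preimage of a box is a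
  box with the same side lengths in another order.\<close>

lemma lborel_distr_reindex:
  fixes f :: "'m::finite \<Rightarrow> 'n::finite"
  assumes f: "bij f"
  shows "distr lborel borel (reindex f) = lborel"
proof (rule lborel_eqI[symmetric])
  fix l u :: "real^'m"
  assume le: "\<And>b. b \<in> Basis \<Longrightarrow> l \<bullet> b \<le> u \<bullet> b"
  have [measurable]: "reindex f \<in> borel_measurable borel"
    using linear_continuous_on[OF linear_conv_bounded_linear[THEN iffD1, OF linear_reindex[of f]], of UNIV]
    by (rule borel_measurable_continuous_onI)
  have f': "f (inv f x) = x" "inv f (f y) = y" for x y
    using f by (simp_all add: bij_is_surj surj_f_inv_f bij_is_inj)
  have le': "l $ i \<le> u $ i" for i
    using le[of "axis i 1"] by (auto simp: Basis_vec_def inner_axis)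
  have "reindex f -` box l u = box (reindex (inv f) l) (reindex (inv f) u)"
    unfolding box_def by (auto simp: reindex_def Basis_vec_def inner_axis f') (metis f')+
  hence "emeasure (distr lborel borel (reindex f)) (box l u) = emeasure lborel (box (reindex (inv f) l) (reindex (inv f) u))"
    by (subst emeasure_distr) auto
  also have "\<dots> = (\<Prod>b\<in>Basis. (reindex (inv f) u - reindex (inv f) l) \<bullet> b)"
    using le' by (subst emeasure_lborel_box) (auto simp: reindex_def Basis_vec_def inner_axis)
  also have "(\<Prod>b\<in>Basis. (reindex (inv f) u - reindex (inv f) l) \<bullet> b) = (\<Prod>i\<in>UNIV. (u - l) $ inv f i)"
    unfolding Basis_vec_def
    by (subst prod.UNION_disjoint) (auto simp: axis_eq_axis inner_axis reindex_def)
  also have "\<dots> = (\<Prod>i\<in>UNIV. (u - l) $ i)"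
    using f by (intro prod.reindex_bij_betw) (rule bij_imp_bij_inv)
  also have "\<dots> = (\<Prod>b\<in>Basis. (u - l) \<bullet> b)"
    unfolding Basis_vec_def
    by (subst prod.UNION_disjoint) (auto simp: axis_eq_axis inner_axis reindex_def)
  finally show "emeasure (distr lborel borel (reindex f)) (box l u) = (\<Prod>b\<in>Basis. (u - l) \<bullet> b)" .
qed auto

lemma matrix_reindex_conj:
  fixes L :: "real^'n \<Rightarrow> real^'n" and f :: "'m::finite \<Rightarrow> 'n::finite"
  assumes f: "bij f"
  shows "matrix (reindex f \<circ> L \<circ> reindex (inv f)) = (\<chi> i j. matrix L $ f i $ f j)"
proof -
  have "reindex (inv f) (axis j 1) = axis (f j) 1" for j
    using f by (auto simp: reindex_def axis_def vec_eq_iff bij_is_inj bij_is_surj surj_f_inv_f)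
  thus ?thesis
    by (simp add: matrix_def vec_eq_iff reindex_def)
qed


section \<open>Change of variables for continuously differentiable bijections\<close>

lemma continuous_on_det:
  fixes F :: "'a::topological_space \<Rightarrow> real^'n^'n"
  assumes "continuous_on S F"
  shows "continuous_on S (\<lambda>x. det (F x))"
  unfolding det_def by (intro continuous_intros assms continuous_on_component)

lemma C1_map_has_derivative:
  assumes "C1_map f"
  shows "(f has_derivative (frechet_derivative f (at x))) (at x)"
  using assms unfolding C1_map_def frechet_derivative_works by blast

lemma C1_map_continuous_on: "C1_map f \<Longrightarrow> continuous_on UNIV f"
  unfolding C1_map_def
  by (intro continuous_at_imp_continuous_on ballI differentiable_imp_continuous_within) auto

lemma C1_map_continuous_on_det:
  "C1_map f \<Longrightarrow> continuous_on UNIV (\<lambda>x. det (jacobian f x))"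
  unfolding C1_map_def by (intro continuous_on_det) auto

text \<open>The formula for the measure of a differentiable image concerns sets whose image has
  finite measure. It is therefore applied to bounded sets, whose preimages under
  \<open>\<phi>\<close> lie in a compact set, and balls exhaust the general case.\<close>

lemma lborel_vimage_wellorder:
  fixes \<phi> \<psi> :: "real^'m::{finite,wellorder} \<Rightarrow> real^'m::_"
  assumes inverse: "\<And>x. \<phi> (\<psi> x) = x" "\<And>x. \<psi> (\<phi> x) = x"
    and \<phi>: "continuous_on UNIV \<phi>"
    and \<psi>: "\<And>x. (\<psi> has_derivative \<psi>' x) (at x)"
    and cont: "continuous_on UNIV (\<lambda>x. det (matrix (\<psi>' x)))"
    and A: "A \<in> sets borel"
  shows "emeasure lborel (\<phi> -` A) = (\<integral>\<^sup>+x\<in>A. ennreal \<bar>det (matrix (\<psi>' x))\<bar> \<partial>lborel)"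
proof -
  have [measurable]: "\<phi> \<in> borel_measurable borel" "(\<lambda>x. det (matrix (\<psi>' x))) \<in> borel_measurable borel"
    using \<phi> cont by (auto intro: borel_measurable_continuous_onI)
  note [measurable] = A
  have \<psi>_cont: "continuous_on UNIV \<psi>"
    using \<psi> by (intro continuous_at_imp_continuous_on ballI has_derivative_continuous) auto
  have bounded_case: "emeasure lborel (\<phi> -` B) = (\<integral>\<^sup>+x\<in>B. ennreal \<bar>det (matrix (\<psi>' x))\<bar> \<partial>lborel)"
    if B[measurable]: "B \<in> sets borel" and bdd: "bounded B" for B
  proof -
    have image: "\<psi> ` B = \<phi> -` B"
      using inverse by (auto simp: image_iff) metis
    have meas: "\<phi> -` B \<in> sets borel"
      using measurable_sets[of \<phi> borel borel B] by simp
    have "compact (\<psi> ` closure B)"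
      using bdd \<psi>_cont by (intro compact_continuous_image) (auto intro: continuous_on_subset simp: compact_closure)
    hence "bounded (\<phi> -` B)"
      unfolding image[symmetric] using closure_subset[of B]
      by (meson bounded_subset compact_imp_bounded image_mono)
    hence fin: "emeasure lborel (\<phi> -` B) < \<infinity>"
      by (rule emeasure_bounded_finite)
    hence lm: "\<phi> -` B \<in> lmeasurable"
      using meas by (auto simp: fmeasurable_def)
    have "((\<lambda>x. \<bar>det (matrix (\<psi>' x))\<bar>) has_integral measure lebesgue (\<phi> -` B)) B"
    proof (subst has_measure_differentiable_image[symmetric])
      show "inj_on \<psi> B"
        using inverse by (intro inj_on_inverseI[of _ \<phi>])
    qed (use B lm \<psi> in \<open>auto simp: image intro: has_derivative_at_withinI\<close>)
    from nn_integral_has_integral_lebesgue[OF _ this]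
    have "(\<integral>\<^sup>+x. ennreal (indicator B x * \<bar>det (matrix (\<psi>' x))\<bar>) \<partial>lborel) = measure lebesgue (\<phi> -` B)"
      by simp
    also have "\<dots> = emeasure lborel (\<phi> -` B)"
      using fin meas by (simp add: emeasure_eq_ennreal_measure)
    finally show ?thesis
      by (simp add: ennreal_mult' ennreal_indicator mult.commute)
  qed
  define C where "C n = A \<inter> cball 0 (real n)" for n :: nat
  have [measurable]: "C n \<in> sets borel" for n
    unfolding C_def by measurable
  have C: "incseq C" "(\<Union>n. C n) = A"
    by (auto simp: incseq_def C_def real_arch_simple)
  have meas: "\<phi> -` C n \<in> sets lborel" for n
    using measurable_sets[of \<phi> borel borel "C n"] by simp
  have "emeasure lborel (\<phi> -` A) = emeasure lborel (\<Union>n. \<phi> -` C n)"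
    using C(2) by (simp add: vimage_UN[symmetric])
  also have "\<dots> = (SUP n. emeasure lborel (\<phi> -` C n))"
    using C(1) meas by (intro SUP_emeasure_incseq[symmetric]) (auto simp: incseq_def)
  also have "\<dots> = (SUP n. emeasure (density lborel (\<lambda>x. ennreal \<bar>det (matrix (\<psi>' x))\<bar>)) (C n))"
  proof (intro SUP_cong refl)
    fix n
    have "bounded (C n)"
      unfolding C_def by (rule bounded_subset[OF bounded_cball]) auto
    thus "emeasure lborel (\<phi> -` C n) = emeasure (density lborel (\<lambda>x. ennreal \<bar>det (matrix (\<psi>' x))\<bar>)) (C n)"
      by (subst bounded_case) (auto simp: emeasure_density)
  qed
  also have "\<dots> = emeasure (density lborel (\<lambda>x. ennreal \<bar>det (matrix (\<psi>' x))\<bar>)) A"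
    using C by (subst SUP_emeasure_incseq) auto
  finally show ?thesis by (simp add: emeasure_density)
qed

text \<open>Conjugation by the relabellings \<open>P\<close> and \<open>Q\<close> moves the claim to
  the well-ordered index type. Both Lebesgue measure and the Jacobian determinant are unchanged by
  it.\<close>

lemma lborel_vimage_C1:
  fixes \<phi> \<psi> :: "real^'n \<Rightarrow> real^'n"
  assumes inverse: "\<And>x. \<phi> (\<psi> x) = x" "\<And>x. \<psi> (\<phi> x) = x"
    and \<phi>: "C1_map \<phi>" and \<psi>: "C1_map \<psi>"
    and A: "A \<in> sets borel"
  shows "emeasure lborel (\<phi> -` A) = (\<integral>\<^sup>+x\<in>A. ennreal \<bar>det (jacobian \<psi> x)\<bar> \<partial>lborel)"
proof -
  define P :: "real^'n \<Rightarrow> real^'n ordered" where "P = reindex unordered"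
  define Q :: "real^'n ordered \<Rightarrow> real^'n" where "Q = reindex (inv unordered)"
  have PQ: "P (Q x) = x" "Q (P y) = y" for x y
    by (simp_all add: P_def Q_def reindex_def vec_eq_iff inv_f_f[OF bij_is_inj[OF bij_unordered]]
        surj_f_inv_f[OF bij_is_surj[OF bij_unordered]])
  have lin: "bounded_linear P" "bounded_linear Q"
    unfolding P_def Q_def using linear_reindex linear_conv_bounded_linear by blast+
  have cont: "continuous_on S P" "continuous_on T Q" for S T
    using lin by (auto intro: linear_continuous_on)
  have [measurable]: "P \<in> borel_measurable borel" "Q \<in> borel_measurable borel"
    using cont by (auto intro: borel_measurable_continuous_onI)
  have lborel_Q: "distr lborel borel Q = lborel"
    unfolding Q_def by (intro lborel_distr_reindex bij_imp_bij_inv bij_unordered)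
  have [measurable]: "\<phi> \<in> borel_measurable borel" "(\<lambda>x. det (jacobian \<psi> x)) \<in> borel_measurable borel"
    using C1_map_continuous_on[OF \<phi>] C1_map_continuous_on_det[OF \<psi>] by (auto intro: borel_measurable_continuous_onI)
  note [measurable] = A
  have jac: "det (matrix (P \<circ> frechet_derivative \<psi> (at (Q x)) \<circ> Q)) = det (jacobian \<psi> (Q x))" for x
    unfolding P_def Q_def
    by (simp add: matrix_reindex_conj[OF bij_unordered] det_reindex[OF bij_unordered] jacobian_def)
  have "emeasure lborel (\<phi> -` A) = emeasure (distr lborel borel Q) (\<phi> -` A)"
    by (simp add: lborel_Q)
  also have "\<dots> = emeasure lborel ((P \<circ> \<phi> \<circ> Q) -` (Q -` A))"
    using measurable_sets[of \<phi> borel borel A] by (subst emeasure_distr) (auto simp: vimage_def PQ)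
  also have "\<dots> = (\<integral>\<^sup>+x\<in>Q -` A. ennreal \<bar>det (matrix (P \<circ> frechet_derivative \<psi> (at (Q x)) \<circ> Q))\<bar> \<partial>lborel)"
  proof (rule lborel_vimage_wellorder)
    show "Q -` A \<in> sets borel"
      using measurable_sets[of Q borel borel A] by simp
    show "continuous_on UNIV (P \<circ> \<phi> \<circ> Q)"
      by (intro continuous_on_compose cont continuous_on_subset[OF C1_map_continuous_on[OF \<phi>]]) auto
    show "continuous_on UNIV (\<lambda>x. det (matrix (P \<circ> frechet_derivative \<psi> (at (Q x)) \<circ> Q)))"
      unfolding jac by (intro continuous_on_compose2[OF C1_map_continuous_on_det[OF \<psi>]] cont) auto
    show "((P \<circ> \<psi> \<circ> Q) has_derivative (P \<circ> frechet_derivative \<psi> (at (Q x)) \<circ> Q)) (at x)" for x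
      by (intro diff_chain_at C1_map_has_derivative[OF \<psi>] bounded_linear_imp_has_derivative lin)
  qed (simp_all add: PQ inverse)
  also have "\<dots> = (\<integral>\<^sup>+x. ennreal \<bar>det (jacobian \<psi> x)\<bar> * indicator A x \<partial>distr lborel borel Q)"
    unfolding jac by (subst nn_integral_distr) (auto simp: indicator_def)
  finally show ?thesis by (simp add: lborel_Q)
qed

text \<open>By the chain rule the Jacobians of \<open>\<phi>\<close> and \<open>\<psi>\<close> are
  inverse matrices. This is what keeps \<open>rho\<close> strictly positive.\<close>

lemma det_jacobian_nonzero:
  fixes \<phi> \<psi> :: "real^'n \<Rightarrow> real^'n"
  assumes inverse: "\<And>x. \<phi> (\<psi> x) = x" and \<phi>: "C1_map \<phi>" and \<psi>: "C1_map \<psi>"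
  shows "det (jacobian \<psi> x) \<noteq> 0"
proof -
  have "((\<phi> \<circ> \<psi>) has_derivative (frechet_derivative \<phi> (at (\<psi> x)) \<circ> frechet_derivative \<psi> (at x))) (at x)"
    by (intro diff_chain_at C1_map_has_derivative \<phi> \<psi>)
  moreover have "\<phi> \<circ> \<psi> = id"
    using inverse by auto
  ultimately have "frechet_derivative \<phi> (at (\<psi> x)) \<circ> frechet_derivative \<psi> (at x) = id"
    using has_derivative_unique has_derivative_id by metis
  hence "jacobian \<phi> (\<psi> x) ** jacobian \<psi> x = mat 1"
    unfolding jacobian_def
    using matrix_compose[of "frechet_derivative \<psi> (at x)" "frechet_derivative \<phi> (at (\<psi> x))"]
      C1_map_has_derivative[OF \<phi>] C1_map_has_derivative[OF \<psi>] has_derivative_linear matrix_id_mat_1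
    by metis
  hence "det (jacobian \<phi> (\<psi> x)) * det (jacobian \<psi> x) = 1"
    using det_mul[of "jacobian \<phi> (\<psi> x)" "jacobian \<psi> x"] by (simp add: det_I)
  thus ?thesis by auto
qed

section \<open>Quasi-invariance of the cluster distribution\<close>

lemma Diff0_inverse:
  assumes "\<phi> \<in> Diff0"
  shows "\<phi> (inv \<phi> x) = x" "inv \<phi> (\<phi> x) = x"
  using assms by (simp_all add: Diff0_def bij_is_surj surj_f_inv_f bij_is_inj)

lemma Diff0_inv:
  assumes "\<phi> \<in> Diff0"
  shows "inv \<phi> \<in> Diff0"
proof -
  obtain K where K: "compact K" "\<And>x. x \<notin> K \<Longrightarrow> \<phi> x = x"
    using assms by (auto simp: Diff0_def)
  have "inv \<phi> x = x" if "x \<notin> K" for x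
    using K(2)[OF that] Diff0_inverse(2)[OF assms, of x] by simp
  thus ?thesis
    using assms K(1) by (auto simp: Diff0_def bij_imp_bij_inv inv_inv_eq)
qed

lemma Diff0_continuous_on: "\<phi> \<in> Diff0 \<Longrightarrow> continuous_on UNIV \<phi>"
  by (auto simp: Diff0_def intro: C1_map_continuous_on)

lemma Diff0_measurable: "\<phi> \<in> Diff0 \<Longrightarrow> \<phi> \<in> borel_measurable borel"
  by (intro borel_measurable_continuous_onI Diff0_continuous_on)

lemma jacobian_measurable:
  "\<phi> \<in> Diff0 \<Longrightarrow> (\<lambda>y. \<bar>det (jacobian \<phi> y)\<bar>) \<in> borel_measurable borel"
  by (intro borel_measurable_continuous_onI continuous_on_rabs C1_map_continuous_on_det) (simp add: Diff0_def)

lemma nn_integral_lborel_Diff0: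
  assumes \<phi>: "\<phi> \<in> Diff0" and f[measurable]: "f \<in> borel_measurable borel"
  shows "(\<integral>\<^sup>+y. f (\<phi> y) \<partial>lborel) = (\<integral>\<^sup>+y. ennreal \<bar>det (jacobian (inv \<phi>) y)\<bar> * f y \<partial>lborel)"
proof -
  note [measurable] = Diff0_measurable[OF \<phi>] jacobian_measurable[OF Diff0_inv[OF \<phi>]]
  have "distr lborel borel \<phi> = density lborel (\<lambda>y. ennreal \<bar>det (jacobian (inv \<phi>) y)\<bar>)"
  proof (rule measure_eqI)
    fix A assume "A \<in> sets (distr lborel borel \<phi>)"
    thus "emeasure (distr lborel borel \<phi>) A = emeasure (density lborel (\<lambda>y. ennreal \<bar>det (jacobian (inv \<phi>) y)\<bar>)) A"
      using \<phi> Diff0_inverse[OF \<phi>] lborel_vimage_C1[of \<phi> "inv \<phi>" A]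
      by (simp add: emeasure_distr emeasure_density Diff0_def)
  qed simp
  hence "(\<integral>\<^sup>+y. f y \<partial>distr lborel borel \<phi>) = (\<integral>\<^sup>+y. f y \<partial>density lborel (\<lambda>y. ennreal \<bar>det (jacobian (inv \<phi>) y)\<bar>))"
    by simp
  thus ?thesis
    by (simp add: nn_integral_distr nn_integral_density)
qed

text \<open>The motion of one droplet relative to its centre is \<phi> conjugated by a translation.
  Translation invariance of Lebesgue measure is used once to reach \<phi> itself and once to
  return.\<close>

lemma distr_lborel_Diff0_shift:
  fixes \<phi> :: "real^'a \<Rightarrow> real^'a"
  assumes \<phi>: "\<phi> \<in> Diff0"
  shows "distr lborel borel (\<lambda>y. \<phi> (y + x) - x) = density lborel (\<lambda>y. ennreal \<bar>det (jacobian (inv \<phi>) (y + x))\<bar>)"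
proof (rule measure_eqI)
  note [measurable] = Diff0_measurable[OF \<phi>] jacobian_measurable[OF Diff0_inv[OF \<phi>]]
  have shift: "(\<integral>\<^sup>+y. f (x + y) \<partial>lborel) = (\<integral>\<^sup>+y. f y \<partial>lborel)" if [measurable]: "f \<in> borel_measurable borel" for f :: "real^'a \<Rightarrow> ennreal"
  proof -
    have "(\<integral>\<^sup>+y. f y \<partial>lborel) = (\<integral>\<^sup>+y. f y \<partial>distr lborel borel ((+) x))"
      by (simp add: lborel_distr_plus)
    thus ?thesis by (simp add: nn_integral_distr)
  qed
  fix A assume "A \<in> sets (distr lborel borel (\<lambda>y. \<phi> (y + x) - x))"
  hence [measurable]: "A \<in> sets borel" by simp
  have "emeasure (distr lborel borel (\<lambda>y. \<phi> (y + x) - x)) A = (\<integral>\<^sup>+y. indicator A (\<phi> (x + y) - x) \<partial>lborel)"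
    by (subst nn_integral_indicator[symmetric], simp, subst nn_integral_distr) (auto simp: add.commute)
  also have "\<dots> = (\<integral>\<^sup>+y. indicator A (\<phi> y - x) \<partial>lborel)"
    by (rule shift) measurable
  also have "\<dots> = (\<integral>\<^sup>+y. ennreal \<bar>det (jacobian (inv \<phi>) y)\<bar> * indicator A (y - x) \<partial>lborel)"
    by (subst nn_integral_lborel_Diff0[OF \<phi>]) auto
  also have "\<dots> = (\<integral>\<^sup>+y. ennreal \<bar>det (jacobian (inv \<phi>) (x + y))\<bar> * indicator A (x + y - x) \<partial>lborel)"
    by (rule shift[symmetric]) measurable
  also have "\<dots> = emeasure (density lborel (\<lambda>y. ennreal \<bar>det (jacobian (inv \<phi>) (y + x))\<bar>)) A"
    by (subst emeasure_density) (auto simp: add.commute)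
  finally show "emeasure (distr lborel borel (\<lambda>y. \<phi> (y + x) - x)) A =
     emeasure (density lborel (\<lambda>y. ennreal \<bar>det (jacobian (inv \<phi>) (y + x))\<bar>)) A" .
qed simp

text \<open>Both sides are recognised as the product of the transformed one-droplet measure, which
  is determined by its values on rectangles.\<close>

lemma distr_PiM_lborel:
  fixes T :: "'a::euclidean_space \<Rightarrow> 'a" and J :: "'a \<Rightarrow> real"
  assumes [measurable]: "T \<in> borel_measurable borel" "J \<in> borel_measurable borel"
    and TJ: "distr lborel borel T = density lborel (\<lambda>y. ennreal (J y))" and I: "finite I"
  shows "distr (\<Pi>\<^sub>M i\<in>I. lborel) (\<Pi>\<^sub>M i\<in>I. borel) (\<lambda>v. \<lambda>i\<in>I. T (v i)) =
    density (\<Pi>\<^sub>M i\<in>I. lborel) (\<lambda>v. \<Prod>i\<in>I. ennreal (J (v i)))"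
    (is "?L = ?R")
proof -
  \<comment> \<open>A density with real values is finite everywhere, so the weighted Lebesgue
    measure is again sigma-finite.\<close>
  have sf: "sigma_finite_measure (density lborel (\<lambda>y. ennreal (J y)))"
    by (subst sigma_finite_measure.sigma_finite_iff_density_finite[OF lborel.sigma_finite_measure_axioms]) auto
  interpret D: product_sigma_finite "\<lambda>_. density lborel (\<lambda>y. ennreal (J y))"
    using sf by unfold_locales (simp add: sigma_finite_measure_def)
  interpret L: product_sigma_finite "\<lambda>_. lborel :: 'a measure" ..
  have "?L = (\<Pi>\<^sub>M i\<in>I. density lborel (\<lambda>y. ennreal (J y)))"
  proof (rule D.PiM_eqI[OF I])
    fix A assume A: "\<And>i. i \<in> I \<Longrightarrow> A i \<in> sets (density lborel (\<lambda>y. ennreal (J y)))"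
    have "emeasure ?L (Pi\<^sub>E I A) = emeasure (\<Pi>\<^sub>M i\<in>I. lborel) (Pi\<^sub>E I (\<lambda>i. T -` A i))"
      using A I by (subst emeasure_distr) (auto intro!: arg_cong2[where f = emeasure] sets_PiM_I_finite simp: space_PiM PiE_iff extensional_def)
    also have "\<dots> = (\<Prod>i\<in>I. emeasure lborel (T -` A i))"
      using A I measurable_sets[of T borel borel] by (subst L.emeasure_PiM) auto
    also have "\<dots> = (\<Prod>i\<in>I. emeasure (distr lborel borel T) (A i))"
      using A by (intro prod.cong refl) (auto simp: emeasure_distr)
    finally show "emeasure ?L (Pi\<^sub>E I A) = (\<Prod>i\<in>I. emeasure (density lborel (\<lambda>y. ennreal (J y))) (A i))"
      by (simp add: TJ)
  qed (auto intro!: sets_PiM_cong)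
  also have "\<dots> = ?R"
  proof (rule D.PiM_eqI[OF I, symmetric])
    fix A assume A: "\<And>i. i \<in> I \<Longrightarrow> A i \<in> sets (density lborel (\<lambda>y. ennreal (J y)))"
    have ind: "indicator (Pi\<^sub>E I A) v = (\<Prod>i\<in>I. indicator (A i) (v i) :: ennreal)" if "v \<in> space (\<Pi>\<^sub>M i\<in>I. lborel)" for v
      using that I by (auto simp: indicator_def space_PiM PiE_iff prod_zero_iff)
    have "emeasure ?R (Pi\<^sub>E I A) = (\<integral>\<^sup>+v. (\<Prod>i\<in>I. ennreal (J (v i)) * indicator (A i) (v i)) \<partial>(\<Pi>\<^sub>M i\<in>I. lborel))"
      using A I by (subst emeasure_density) (auto intro!: nn_integral_cong sets_PiM_I_finite simp: ind prod.distrib)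
    also have "\<dots> = (\<Prod>i\<in>I. \<integral>\<^sup>+y. ennreal (J y) * indicator (A i) y \<partial>lborel)"
      using A I by (intro L.product_nn_integral_prod) auto
    also have "\<dots> = (\<Prod>i\<in>I. emeasure (density lborel (\<lambda>y. ennreal (J y))) (A i))"
      using A by (intro prod.cong refl) (auto simp: emeasure_density)
    finally show "emeasure ?R (Pi\<^sub>E I A) = (\<Prod>i\<in>I. emeasure (density lborel (\<lambda>y. ennreal (J y))) (A i))" .
  qed (auto intro!: sets_PiM_cong)
  finally show ?thesis .
qed

lemma prod_list_pos: "(\<And>x. x \<in> set xs \<Longrightarrow> 0 < x) \<Longrightarrow> 0 < prod_list (xs :: real list)"
  by (induction xs) auto

lemma measurable_map_list [measurable]:
  assumes [measurable]: "(T :: 'a::second_countable_topology \<Rightarrow> 'b::second_countable_topology) \<in> borel_measurable borel"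
  shows "map T \<in> borel_measurable borel"
proof -
  have "(\<lambda>ys. id (map T ys)) \<in> borel_measurable borel"
  proof (rule measurable_fold_list[OF assms])
    fix n
    show "(\<lambda>v :: nat \<Rightarrow> 'b. id (map v [0..<n])) \<in> borel_measurable (\<Pi>\<^sub>M i\<in>{..<n}. borel)"
      using measurable_list_of_vec[of n] by (simp add: list_of_vec_def[abs_def])
  qed
  thus ?thesis by simp
qed

lemma nn_integral_list_lborel_map:
  fixes T :: "'a::euclidean_space \<Rightarrow> 'a" and J :: "'a \<Rightarrow> real"
  assumes T[measurable]: "T \<in> borel_measurable borel" and J[measurable]: "J \<in> borel_measurable borel"
    and J_nonneg: "\<And>y. 0 \<le> J y"
    and TJ: "distr lborel borel T = density lborel (\<lambda>y. ennreal (J y))"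
    and f[measurable]: "f \<in> borel_measurable borel"
  shows "(\<integral>\<^sup>+ys. f (map T ys) \<partial>list_lborel) = (\<integral>\<^sup>+ys. ennreal (prod_list (map J ys)) * f ys \<partial>list_lborel)"
proof -
  have "(\<integral>\<^sup>+v. f (map T (list_of_vec n v)) \<partial>(\<Pi>\<^sub>M i\<in>{..<n}. lborel)) =
     (\<integral>\<^sup>+v. ennreal (prod_list (map J (list_of_vec n v))) * f (list_of_vec n v) \<partial>(\<Pi>\<^sub>M i\<in>{..<n}. lborel))" for n
  proof -
    have eq: "map T (list_of_vec n v) = list_of_vec n (\<lambda>i\<in>{..<n}. T (v i))" for v
      by (simp add: list_of_vec_def)
    have "(\<integral>\<^sup>+v. f (map T (list_of_vec n v)) \<partial>(\<Pi>\<^sub>M i\<in>{..<n}. lborel)) =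
      (\<integral>\<^sup>+v. f (list_of_vec n v) \<partial>distr (\<Pi>\<^sub>M i\<in>{..<n}. lborel) (\<Pi>\<^sub>M i\<in>{..<n}. borel) (\<lambda>v. \<lambda>i\<in>{..<n}. T (v i)))"
      unfolding eq by (subst nn_integral_distr) auto
    also have "\<dots> = (\<integral>\<^sup>+v. (\<Prod>i<n. ennreal (J (v i))) * f (list_of_vec n v) \<partial>(\<Pi>\<^sub>M i\<in>{..<n}. lborel))"
      by (subst distr_PiM_lborel[OF T J TJ]) (auto simp: nn_integral_density)
    also have "(\<lambda>v. \<Prod>i<n. ennreal (J (v i))) = (\<lambda>v. ennreal (prod_list (map J (list_of_vec n v))))"
      using J_nonneg by (simp add: list_of_vec_def prod_ennreal prod_list_map_upt o_def)
    finally show ?thesis by simp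
  qed
  thus ?thesis
    by (subst (1 2) nn_integral_list_lborel) auto
qed

lemma hat_map_eq: "hat_map \<phi> p = (fst p, map (\<lambda>y. \<phi> (y + fst p) - fst p) (snd p))"
  by (simp add: hat_map_def shift_def case_prod_beta)

lemma continuous_on_hat_map:
  fixes \<phi> :: "'a::real_normed_vector \<Rightarrow> 'a"
  assumes "continuous_on UNIV \<phi>"
  shows "continuous_on UNIV (hat_map \<phi>)"
proof -
  have "continuous_on UNIV (\<lambda>p :: 'a \<times> 'a. \<phi> (snd p + fst p) - fst p)"
    by (intro continuous_intros continuous_on_compose2[OF assms]) auto
  thus ?thesis
    unfolding hat_map_eq[abs_def]
    by (intro continuous_on_Pair continuous_on_map_list continuous_on_fst continuous_on_id)
qed

lemma hat_map_inverse:
  assumes "\<phi> \<in> Diff0"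
  shows "hat_map \<phi> (hat_map (inv \<phi>) p) = p" "hat_map (inv \<phi>) (hat_map \<phi> p) = p"
  using Diff0_inverse[OF assms] by (simp_all add: hat_map_eq o_def)

lemma measurable_hat_map:
  assumes "\<phi> \<in> Diff0"
  shows "hat_map \<phi> \<in> borel_measurable borel"
  by (intro borel_measurable_continuous_onI continuous_on_hat_map Diff0_continuous_on assms)

lemma rho_eq:
  "rho h \<phi> p = (if h (snd p) = 0 \<or> h (snd (hat_map (inv \<phi>) p)) = 0 then 1
     else h (snd (hat_map (inv \<phi>) p)) / h (snd p) * prod_list (map (\<lambda>y. \<bar>det (jacobian (inv \<phi>) y)\<bar>) (shift (snd p) (fst p))))"
  by (cases p) (simp add: rho_def hat_map_def Let_def shift_def o_def)

lemma measurable_rho: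
  assumes \<phi>: "\<phi> \<in> Diff0" and [measurable]: "h \<in> borel_measurable borel"
  shows "rho h \<phi> \<in> borel_measurable borel"
proof -
  note [measurable] = jacobian_measurable[OF Diff0_inv[OF \<phi>]] measurable_hat_map[OF Diff0_inv[OF \<phi>]]
  have [measurable]: "snd \<in> borel_measurable (borel :: ((real^'n) \<times> (real^'n) list) measure)"
    by (intro borel_measurable_continuous_onI continuous_on_snd continuous_on_id)
  show ?thesis
    unfolding rho_eq[abs_def] by measurable
qed

lemma rho_pos:
  assumes \<phi>: "\<phi> \<in> Diff0" and h: "\<And>ys. 0 \<le> h ys"
  shows "0 < rho h \<phi> p"
proof -
  have "0 < prod_list (map (\<lambda>y. \<bar>det (jacobian (inv \<phi>) y)\<bar>) (shift (snd p) (fst p)))"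
    using det_jacobian_nonzero[of \<phi> "inv \<phi>"] Diff0_inverse[OF \<phi>] \<phi>
    by (intro prod_list_pos) (auto simp: Diff0_def)
  thus ?thesis
    using h by (auto simp: rho_eq less_le)
qed

text \<open>The density formula for a single mark: \<open>h\<close> is carried along by the change
  of variables and then divided out again, which is legitimate because \<open>h\<close> is positive
  almost everywhere.\<close>

lemma nn_integral_eta_hat_map:
  assumes \<phi>: "\<phi> \<in> Diff0" and h_meas[measurable]: "h \<in> borel_measurable borel"
    and h_nonneg: "\<And>ys. 0 \<le> h ys"
    and h_pos: "AE ys in list_lborel. h ys > 0"
    and \<eta>: "\<eta> = density list_lborel (\<lambda>ys. ennreal (h ys))"
    and f[measurable]: "f \<in> borel_measurable borel"
  shows "(\<integral>\<^sup>+ys. f (snd (hat_map \<phi> (x, ys))) \<partial>\<eta>) = (\<integral>\<^sup>+ys. ennreal (rho h \<phi> (x, ys)) * f ys \<partial>\<eta>)"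
proof -
  define T where "T y = \<phi> (y + x) - x" for y
  define S where "S y = inv \<phi> (y + x) - x" for y
  define J where "J y = \<bar>det (jacobian (inv \<phi>) (y + x))\<bar>" for y
  note [measurable] = Diff0_measurable[OF \<phi>] jacobian_measurable[OF Diff0_inv[OF \<phi>]]
    Diff0_measurable[OF Diff0_inv[OF \<phi>]]
  have [measurable]: "T \<in> borel_measurable borel" "S \<in> borel_measurable borel" "J \<in> borel_measurable borel"
    unfolding T_def[abs_def] S_def[abs_def] J_def[abs_def] by measurable
  have J_pos: "0 < J y" for y
    using det_jacobian_nonzero[of \<phi> "inv \<phi>"] Diff0_inverse[OF \<phi>] \<phi> by (auto simp: Diff0_def J_def)
  have ST: "map S (map T ys) = ys" for ys
    using Diff0_inverse[OF \<phi>] by (simp add: S_def T_def o_def)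
  have change: "(\<integral>\<^sup>+ys. F (map T ys) \<partial>list_lborel) = (\<integral>\<^sup>+ys. ennreal (prod_list (map J ys)) * F ys \<partial>list_lborel)"
    if [measurable]: "F \<in> borel_measurable borel" for F
    using distr_lborel_Diff0_shift[OF \<phi>, of x]
    by (intro nn_integral_list_lborel_map) (auto simp: T_def[abs_def, symmetric] J_def[symmetric] J_pos less_imp_le)
  have Jprod: "0 < prod_list (map J ys)" for ys
    using J_pos by (intro prod_list_pos) auto
  \<comment> \<open>The change of variables is first applied to the indicator of
    \<open>h = 0\<close>. Since the product of Jacobians is positive, this set pulled back along
    \<open>map S\<close> is null as well, and both default branches of \<open>rho\<close> become
    negligible.\<close>
  have "(\<integral>\<^sup>+ys. ennreal (prod_list (map J ys)) * indicator {ys. h ys = 0} (map S ys) \<partial>list_lborel) =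
     (\<integral>\<^sup>+ys. indicator {ys. h ys = 0} (map S (map T ys)) \<partial>list_lborel)"
    by (rule change[symmetric]) measurable
  also have "\<dots> = 0"
    unfolding ST using h_pos by (subst nn_integral_0_iff_AE) (auto elim!: eventually_mono)
  finally have "AE ys in list_lborel. ennreal (prod_list (map J ys)) * indicator {ys. h ys = 0} (map S ys) = 0"
    by (subst (asm) nn_integral_0_iff_AE) auto
  hence h_pos': "AE ys in list_lborel. h (map S ys) \<noteq> 0"
  proof eventually_elim
    case (elim ys)
    thus ?case
      using Jprod[of ys] by (auto simp: indicator_def ennreal_eq_0_iff not_le split: if_splits)
  qed
  have rho: "rho h \<phi> (x, ys) = (if h ys = 0 \<or> h (map S ys) = 0 then 1 else h (map S ys) / h ys * prod_list (map J ys))" for ys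
    unfolding rho_eq S_def J_def hat_map_eq by (simp add: shift_def o_def)
  have "(\<integral>\<^sup>+ys. f (snd (hat_map \<phi> (x, ys))) \<partial>\<eta>) = (\<integral>\<^sup>+ys. ennreal (h ys) * f (map T ys) \<partial>list_lborel)"
  proof -
    have "snd (hat_map \<phi> (x, ys)) = map T ys" for ys
      by (simp add: hat_map_eq T_def)
    thus ?thesis
      unfolding \<eta> by (simp add: nn_integral_density)
  qed
  \<comment> \<open>Inserting \<open>S\<close> after \<open>T\<close> makes the integrand a function
    of \<open>map T ys\<close>, the form that \<open>change\<close> requires.\<close>
  also have "\<dots> = (\<integral>\<^sup>+ys. ennreal (h (map S (map T ys))) * f (map T ys) \<partial>list_lborel)"
    by (simp only: ST)
  also have "\<dots> = (\<integral>\<^sup>+ys. ennreal (prod_list (map J ys)) * (ennreal (h (map S ys)) * f ys) \<partial>list_lborel)"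
    by (rule change) measurable
  also have "\<dots> = (\<integral>\<^sup>+ys. ennreal (h ys) * (ennreal (rho h \<phi> (x, ys)) * f ys) \<partial>list_lborel)"
  proof (rule nn_integral_cong_AE, use h_pos h_pos' in eventually_elim)
    fix ys assume "0 < h ys" "h (map S ys) \<noteq> 0"
    hence "prod_list (map J ys) * h (map S ys) = h ys * rho h \<phi> (x, ys)"
      by (simp add: rho)
    thus "ennreal (prod_list (map J ys)) * (ennreal (h (map S ys)) * f ys) = ennreal (h ys) * (ennreal (rho h \<phi> (x, ys)) * f ys)"
      using h_nonneg Jprod[of ys] rho_pos[where p = "(x, ys)" and h = h, OF \<phi>]
      by (simp add: mult.assoc[symmetric] ennreal_mult[symmetric] less_imp_le)
  qed
  also have "\<dots> = (\<integral>\<^sup>+ys. ennreal (rho h \<phi> (x, ys)) * f ys \<partial>\<eta>)"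
    unfolding \<eta>
  proof (subst nn_integral_density)
    have "Pair x \<in> borel_measurable borel"
      by (intro borel_measurable_continuous_onI continuous_on_Pair_const)
    from measurable_compose[OF this measurable_rho[OF \<phi> h_meas]]
    have [measurable]: "(\<lambda>ys. rho h \<phi> (x, ys)) \<in> borel_measurable borel" .
    show "(\<lambda>ys. ennreal (rho h \<phi> (x, ys)) * f ys) \<in> borel_measurable list_lborel"
      by measurable
  qed auto
  finally show ?thesis .
qed

section \<open>Configuration spaces\<close>

text \<open>Counting in \<open>ennreal\<close> admits Borel sets with infinitely many points of
  \<gamma> and turns counts into integrals against counting measure.\<close>

definition num_points :: "'a set \<Rightarrow> 'a set \<Rightarrow> ennreal" where
  "num_points B \<gamma> = emeasure (count_space UNIV) (\<gamma> \<inter> B)"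

lemma space_config_space [simp]: "space config_space = configs"
  unfolding config_space_def by (rule space_measure_of) auto

lemma num_points_eq_iff: "num_points B \<gamma> = of_nat n \<longleftrightarrow> finite (\<gamma> \<inter> B) \<and> card (\<gamma> \<inter> B) = n"
  by (auto simp: num_points_def emeasure_count_space)

lemma num_points_finite_iff: "num_points B \<gamma> < \<infinity> \<longleftrightarrow> finite (\<gamma> \<inter> B)"
  by (auto simp: num_points_def emeasure_count_space less_top[symmetric] ennreal_of_nat_neq_top)

lemma sets_config_space:
  "sets config_space = sigma_sets configs {{\<gamma> \<in> configs. num_points B \<gamma> = of_nat n} | B n. B \<in> sets borel}"
  unfolding config_space_def num_points_eq_iff by (rule sets_measure_of) auto

lemma measurable_num_points [measurable]:
  assumes B: "B \<in> sets borel"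
  shows "num_points B \<in> borel_measurable config_space"
proof -
  \<comment> \<open>\<open>None\<close> stands for an infinite count. The generators describe finite
    counts, so the infinite one is reached as the complement of all of these.\<close>
  define c where "c \<gamma> = (if finite (\<gamma> \<inter> B) then Some (card (\<gamma> \<inter> B)) else None)" for \<gamma>
  have S: "c -` {Some n} \<inter> configs \<in> sets config_space" for n
  proof -
    have "c -` {Some n} \<inter> configs = {\<gamma> \<in> configs. num_points B \<gamma> = of_nat n}"
      unfolding num_points_eq_iff by (auto simp: c_def split: if_splits)
    thus ?thesis
      unfolding sets_config_space using B by (auto intro!: sigma_sets.Basic)
  qed
  have "c -` {None} \<inter> configs = configs - (\<Union>n. c -` {Some n} \<inter> configs)"
    by auto
  also have "\<dots> \<in> sets config_space"
    using S sets.top[of config_space] by (intro sets.Diff sets.countable_UN) auto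
  finally have "c \<in> measurable config_space (count_space UNIV)"
    using S by (intro measurable_count_space_eq2_countable[THEN iffD2]) (auto simp: not_None_eq[symmetric] split: option.splits; metis option.exhaust)
  hence "(\<lambda>\<gamma>. case c \<gamma> of None \<Rightarrow> \<infinity> | Some n \<Rightarrow> (of_nat n :: ennreal)) \<in> borel_measurable config_space"
    by (rule measurable_compose) simp
  moreover have "(case c \<gamma> of None \<Rightarrow> \<infinity> | Some n \<Rightarrow> of_nat n) = num_points B \<gamma>" for \<gamma>
    by (auto simp: c_def num_points_def emeasure_count_space)
  ultimately show ?thesis by (simp cong: measurable_cong)
qed

lemma configs_void_sets:
  assumes "B \<in> sets borel"
  shows "{\<gamma> \<in> configs. \<gamma> \<inter> B = {}} \<in> sets config_space"
proof -
  note [measurable] = measurable_num_points[OF assms]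
  have "{\<gamma> \<in> space config_space. num_points B \<gamma> = of_nat 0} \<in> sets config_space"
    by measurable
  thus ?thesis
    unfolding num_points_eq_iff
    by (rule back_subst[of "\<lambda>A. A \<in> sets config_space"]) (auto simp: card_eq_0_iff)
qed

lemma measurable_config_spaceI:
  fixes F :: "'b \<Rightarrow> 'a::topological_space set"
  assumes "\<And>x. x \<in> space M \<Longrightarrow> F x \<in> configs"
    and "\<And>B. B \<in> sets borel \<Longrightarrow> (\<lambda>x. num_points B (F x)) \<in> borel_measurable M"
  shows "F \<in> measurable M config_space"
proof (rule measurable_sigma_sets[OF sets_config_space])
  fix A :: "'a set set" assume "A \<in> {{\<gamma> \<in> configs. num_points B \<gamma> = of_nat n} | B n. B \<in> sets borel}"
  then obtain B n where B: "B \<in> sets borel" "A = {\<gamma> \<in> configs. num_points B \<gamma> = of_nat n}"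
    by auto
  have "F -` A \<inter> space M = {x \<in> space M. num_points B (F x) = of_nat n}"
    using assms(1) B(2) by auto
  also have "\<dots> \<in> sets M"
    using assms(2)[OF B(1)] by simp
  finally show "F -` A \<inter> space M \<in> sets M" .
qed (use assms(1) in auto)

lemma nn_integral_count_space_indicator_num_points:
  "(\<integral>\<^sup>+z. indicator B z \<partial>count_space \<gamma>) = num_points B \<gamma>"
  by (simp add: nn_integral_count_space_indicator num_points_def nn_integral_indicator[symmetric] indicator_inter_arith mult.commute del: nn_integral_indicator)

lemma measurable_nn_integral_config [measurable]:
  assumes "f \<in> borel_measurable borel"
  shows "(\<lambda>\<gamma>. \<integral>\<^sup>+z. f z \<partial>count_space \<gamma>) \<in> borel_measurable config_space"
  using assms
proof (induction rule: borel_measurable_induct)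
  case (cong f g)
  hence "f = g" by auto
  thus ?case using cong by simp
next
  case (set A)
  thus ?case
    by (simp add: nn_integral_count_space_indicator_num_points cong: measurable_cong)
next
  case (mult u c)
  thus ?case by (simp add: nn_integral_cmult)
next
  case (add u v)
  thus ?case by (simp add: nn_integral_add)
next
  case (seq U)
  have "(\<integral>\<^sup>+z. (SUP i. U i) z \<partial>count_space \<gamma>) = (SUP i. \<integral>\<^sup>+z. U i z \<partial>count_space \<gamma>)" for \<gamma>
    unfolding SUP_apply using seq by (intro nn_integral_monotone_convergence_SUP) auto
  thus ?case using seq.IH by simp
qed

text \<open>Sums of non-negative functions over \<gamma> are measurable, so the product is expressed
  through two of them, the positive and the negative parts of the logarithms. A vanishing factor is
  treated apart, and infinitely many factors different from 1 give the value 1 of an infinite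
  \<open>prod\<close>.\<close>

lemma measurable_prod_config:
  fixes f :: "'a::topological_space \<Rightarrow> real"
  assumes [measurable]: "f \<in> borel_measurable borel" and nonneg: "\<And>z. 0 \<le> f z"
  shows "(\<lambda>\<gamma>. \<Prod>z\<in>{z \<in> \<gamma>. f z \<noteq> 1}. f z) \<in> borel_measurable config_space"
proof -
  have sets: "{z. f z \<noteq> 1} \<in> sets borel" "{z. f z = 0} \<in> sets borel"
    by measurable
  have eq: "(\<Prod>z\<in>{z \<in> \<gamma>. f z \<noteq> 1}. f z) =
     (if num_points {z. f z \<noteq> 1} \<gamma> = \<infinity> then 1 else if num_points {z. f z = 0} \<gamma> \<noteq> 0 then 0
      else exp (enn2real (\<integral>\<^sup>+z. ennreal (ln (f z)) \<partial>count_space \<gamma>) - enn2real (\<integral>\<^sup>+z. ennreal (- ln (f z)) \<partial>count_space \<gamma>)))"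
    for \<gamma>
  proof -
    have N0: "num_points {z. f z = 0} \<gamma> = 0 \<longleftrightarrow> (\<forall>z\<in>\<gamma>. f z \<noteq> 0)"
    proof -
      have "\<gamma> \<inter> {z. f z = 0} = {} \<longleftrightarrow> (\<forall>z\<in>\<gamma>. f z \<noteq> 0)"
        by auto
      thus ?thesis
        using num_points_eq_iff[of "{z. f z = 0}" \<gamma> 0] by (auto simp: card_eq_0_iff)
    qed
    define S where "S = {z \<in> \<gamma>. f z \<noteq> 1}"
    have S: "\<gamma> \<inter> {z. f z \<noteq> 1} = S"
      by (auto simp: S_def)
    consider "infinite S" | "finite S" "\<exists>z\<in>S. f z = 0" | "finite S" "\<forall>z\<in>S. 0 < f z"
      using nonneg by (metis less_le)
    thus ?thesis
    proof cases
      case 1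
      thus ?thesis using num_points_finite_iff[of "{z. f z \<noteq> 1}" \<gamma>] S by (auto simp: S_def less_top[symmetric])
    next
      case 2
      hence "prod f S = 0" by (meson prod_zero)
      moreover have "num_points {z. f z = 0} \<gamma> \<noteq> 0"
        using 2 unfolding N0 by (auto simp: S_def)
      moreover have "num_points {z. f z \<noteq> 1} \<gamma> \<noteq> \<infinity>"
        using 2 num_points_finite_iff[of "{z. f z \<noteq> 1}" \<gamma>] S by auto
      ultimately show ?thesis by (simp add: S_def)
    next
      case 3
      \<comment> \<open>\<open>ennreal\<close> cuts negative reals off at 0, hence \<open>ln\<close>
        and its negative produce the positive and the negative part; \<open>g 1 = 0\<close> removes
        the points outside \<open>S\<close>.\<close>
      have int: "(\<integral>\<^sup>+z. ennreal (g (f z)) \<partial>count_space \<gamma>) = ennreal (\<Sum>z\<in>S. max 0 (g (f z)))" if "g 1 = 0" for g :: "real \<Rightarrow> real"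
      proof -
        have "(\<integral>\<^sup>+z. ennreal (g (f z)) \<partial>count_space \<gamma>) = (\<Sum>z\<in>S. ennreal (g (f z)))"
          using 3 that by (intro nn_integral_count_space') (auto simp: S_def)
        also have "\<dots> = (\<Sum>z\<in>S. ennreal (max 0 (g (f z))))"
          by (intro sum.cong refl) (auto simp: max_def ennreal_neg)
        also have "\<dots> = ennreal (\<Sum>z\<in>S. max 0 (g (f z)))"
          by (rule sum_ennreal) simp
        finally show ?thesis .
      qed
      have "exp ((\<Sum>z\<in>S. max 0 (ln (f z))) - (\<Sum>z\<in>S. max 0 (- ln (f z)))) = exp (\<Sum>z\<in>S. ln (f z))"
        unfolding sum_subtractf[symmetric] by (intro arg_cong[where f = exp] sum.cong) auto
      also have "\<dots> = (\<Prod>z\<in>S. f z)"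
        using 3 by (simp add: exp_sum)
      finally have "exp (enn2real (\<integral>\<^sup>+z. ennreal (ln (f z)) \<partial>count_space \<gamma>) - enn2real (\<integral>\<^sup>+z. ennreal (- ln (f z)) \<partial>count_space \<gamma>)) = prod f S"
        by (simp add: int[of ln] int[of "\<lambda>x. - ln x"] sum_nonneg)
      moreover have "num_points {z. f z = 0} \<gamma> = 0"
        using 3 unfolding N0 by (force simp: S_def)
      moreover have "num_points {z. f z \<noteq> 1} \<gamma> \<noteq> \<infinity>"
        using 3 num_points_finite_iff[of "{z. f z \<noteq> 1}" \<gamma>] S by auto
      ultimately show ?thesis by (simp add: S_def)
    qed
  qed
  note [measurable] = measurable_num_points[OF sets(1)] measurable_num_points[OF sets(2)]
  show ?thesis
    unfolding eq by measurable
qed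

section \<open>Partitions by separating sets and void events\<close>

text \<open>Two points have equal codes iff they lie in the same atom of the partition generated by
  the first \<open>l\<close> sets \<open>b i\<close>.\<close>

definition atom_code :: "(nat \<Rightarrow> 'a set) \<Rightarrow> nat \<Rightarrow> 'a \<Rightarrow> nat set" where
  "atom_code b l z = {i. i < l \<and> z \<in> b i}"

lemma atom_code_sets:
  assumes "\<And>i. open (b i)"
  shows "{z. atom_code b l z = s} \<in> sets borel"
proof -
  have "{z. atom_code b l z = s} = (if s \<subseteq> {..<l} then (\<Inter>i\<in>s. b i) \<inter> (\<Inter>i\<in>{..<l} - s. - b i) else {})"
    by (auto simp: atom_code_def)
  moreover have "(\<Inter>i\<in>s. b i) \<in> sets borel" "(\<Inter>i\<in>{..<l} - s. - b i) \<in> sets borel"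
    using assms by (auto intro!: sets.countable_INT'')
  ultimately show ?thesis by auto
qed

lemma ex_separating_sequence:
  "\<exists>b :: nat \<Rightarrow> 'a::{second_countable_topology,t0_space} set.
     (\<forall>i. open (b i)) \<and> (\<forall>z w. z \<noteq> w \<longrightarrow> (\<exists>i. (z \<in> b i) \<noteq> (w \<in> b i)))"
proof -
  obtain B :: "'a set set" where B: "countable B" "topological_basis B"
    using ex_countable_basis by blast
  have ne: "B \<noteq> {}"
    using topological_basisE[OF B(2) open_UNIV UNIV_I] by blast
  show ?thesis
  proof (intro exI[of _ "from_nat_into B"] conjI allI impI)
    show "open (from_nat_into B i)" for i
      using topological_basis_open[OF B(2)] from_nat_into[OF ne] by blast
    fix z w :: 'a assume "z \<noteq> w"
    then obtain U where U: "open U" "(z \<in> U) \<noteq> (w \<in> U)"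
      by (auto simp: separation_t0)
    obtain V where "V \<in> B" "(z \<in> V) \<noteq> (w \<in> V)"
    proof (cases "z \<in> U")
      case True
      thus ?thesis using that U topological_basisE[OF B(2) U(1) True] by blast
    next
      case False
      hence "w \<in> U" using U by auto
      thus ?thesis using that U False topological_basisE[OF B(2) U(1) \<open>w \<in> U\<close>] by blast
    qed
    thus "\<exists>i. (z \<in> from_nat_into B i) \<noteq> (w \<in> from_nat_into B i)"
      using from_nat_into_surj[OF B(1)] by metis
  qed
qed

lemma atom_code_inj_on:
  assumes b: "\<And>z w. z \<noteq> w \<Longrightarrow> \<exists>i. (z \<in> b i) \<noteq> (w \<in> b i)" and T: "finite T"
  shows "\<exists>l. inj_on (atom_code b l) T"
proof -
  obtain i where i: "\<And>z w. z \<noteq> w \<Longrightarrow> (z \<in> b (i z w)) \<noteq> (w \<in> b (i z w))"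
    using b by metis
  \<comment> \<open>One separating index per pair suffices. \<open>Suc\<close> is there because
    codes read indices strictly below \<open>l\<close>; if \<open>T\<close> is empty the value of
    \<open>Max\<close> is immaterial.\<close>
  define l where "l = Suc (Max ((\<lambda>(z, w). i z w) ` (T \<times> T)))"
  have "i z w < l" if "z \<in> T" "w \<in> T" for z w
    using that T unfolding l_def less_Suc_eq_le by (intro Max_ge) auto
  hence "inj_on (atom_code b l) T"
    using i by (auto simp: inj_on_def atom_code_def set_eq_iff) metis
  thus ?thesis ..
qed

text \<open>Occupied atoms bound the number of points from below and separate any finite selection
  of them eventually. Lower bounds are used rather than exact counts because they also cover
  infinite \<open>A\<close>.\<close>

lemma card_atom_code:
  assumes b: "\<And>z w. z \<noteq> w \<Longrightarrow> \<exists>i. (z \<in> b i) \<noteq> (w \<in> b i)"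
  shows "(\<exists>l. n \<le> card (atom_code b l ` A)) \<longleftrightarrow> infinite A \<or> n \<le> card A"
proof
  assume "\<exists>l. n \<le> card (atom_code b l ` A)"
  thus "infinite A \<or> n \<le> card A"
    by (meson card_image_le order_trans)
next
  assume "infinite A \<or> n \<le> card A"
  then obtain T where T: "T \<subseteq> A" "finite T" "card T = n"
    by (metis infinite_arbitrarily_large obtain_subset_with_card_n)
  obtain l where "inj_on (atom_code b l) T"
    using atom_code_inj_on[OF b T(2)] by blast
  hence "n = card (atom_code b l ` T)"
    using T by (simp add: card_image)
  also have "\<dots> \<le> card (atom_code b l ` A)"
  proof (rule card_mono)
    show "finite (atom_code b l ` A)"
      by (rule finite_subset[of _ "Pow {..<l}"]) (auto simp: atom_code_def)
  qed (use T in auto)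
  finally show "\<exists>l. n \<le> card (atom_code b l ` A)" ..
qed

text \<open>Renyi's theorem: void events generate, since finitely many distinct points fall into distinct atoms
  of the partition by the first \<open>l\<close> separating sets once \<open>l\<close> is large.\<close>

lemma sets_config_space_void:
  "sets (config_space :: 'a::{second_countable_topology,t0_space} set measure) =
     sigma_sets configs {{\<gamma> \<in> configs. \<gamma> \<inter> B = {}} | B. B \<in> sets borel}" (is "_ = sigma_sets configs ?V")
proof (rule antisym)
  define M where "M = sigma (configs :: 'a set set) ?V"
  have spM[simp]: "space M = configs" and setsM: "sets M = sigma_sets configs ?V"
    unfolding M_def by (auto intro!: space_measure_of sets_measure_of)
  obtain b :: "nat \<Rightarrow> 'a set" where b: "\<And>i. open (b i)" "\<And>z w. z \<noteq> w \<Longrightarrow> \<exists>i. (z \<in> b i) \<noteq> (w \<in> b i)"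
    using ex_separating_sequence by blast
  have code_sets: "{z. atom_code b l z = s} \<in> sets borel" for l s
    by (rule atom_code_sets) (rule b(1))
  have ge: "{\<gamma> \<in> configs. n \<le> card (atom_code b l ` (\<gamma> \<inter> B))} \<in> sets M" if B: "B \<in> sets borel" for B n l
  proof -
    \<comment> \<open>The number of occupied atoms is a finite sum of indicators, each of the
      complement of a void event.\<close>
    have "(\<lambda>\<gamma>. \<Sum>s\<in>Pow {..<l}. if \<gamma> \<inter> (B \<inter> {z. atom_code b l z = s}) = {} then 0 else 1 :: nat) \<in> measurable M (count_space UNIV)"
    proof (intro measurable_sum_nat measurable_If)
      fix s
      have "{\<gamma> \<in> configs. \<gamma> \<inter> (B \<inter> {z. atom_code b l z = s}) = {}} \<in> sets M"
        unfolding setsM using B code_sets by (auto intro!: sigma_sets.Basic)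
      thus "{\<gamma> \<in> space M. \<gamma> \<inter> (B \<inter> {z. atom_code b l z = s}) = {}} \<in> sets M"
        by simp
    qed auto
    moreover have "(\<Sum>s\<in>Pow {..<l}. if \<gamma> \<inter> (B \<inter> {z. atom_code b l z = s}) = {} then 0 else 1 :: nat) = card (atom_code b l ` (\<gamma> \<inter> B))" for \<gamma>
    proof -
      have "atom_code b l ` (\<gamma> \<inter> B) = Pow {..<l} \<inter> - {s. \<gamma> \<inter> (B \<inter> {z. atom_code b l z = s}) = {}}"
        by (auto simp: atom_code_def)
      thus ?thesis by (simp add: sum.If_cases)
    qed
    ultimately have "(\<lambda>\<gamma>. card (atom_code b l ` (\<gamma> \<inter> B))) \<in> measurable M (count_space UNIV)"
      by simp
    from measurable_sets[OF this, of "{n..}"] show ?thesis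
      by (simp add: vimage_def Int_def conj_commute)
  qed
  have "{\<gamma> \<in> configs. num_points B \<gamma> = of_nat n} \<in> sets M" if B: "B \<in> sets borel" for B n
  proof -
    have ge': "{\<gamma> \<in> configs. infinite (\<gamma> \<inter> B) \<or> k \<le> card (\<gamma> \<inter> B)} \<in> sets M" for k
    proof -
      have "{\<gamma> \<in> configs. infinite (\<gamma> \<inter> B) \<or> k \<le> card (\<gamma> \<inter> B)} = (\<Union>l. {\<gamma> \<in> configs. k \<le> card (atom_code b l ` (\<gamma> \<inter> B))})"
        using card_atom_code[OF b(2)] by auto
      thus ?thesis using ge[OF B] by auto
    qed
    \<comment> \<open>Exactly \<open>n\<close> points means at least \<open>n\<close> but not at
      least \<open>n + 1\<close>; infinite counts belong to both sets and cancel.\<close>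
    have "{\<gamma> \<in> configs. num_points B \<gamma> = of_nat n} =
        {\<gamma> \<in> configs. infinite (\<gamma> \<inter> B) \<or> n \<le> card (\<gamma> \<inter> B)} - {\<gamma> \<in> configs. infinite (\<gamma> \<inter> B) \<or> Suc n \<le> card (\<gamma> \<inter> B)}"
      unfolding num_points_eq_iff by auto
    thus ?thesis using ge' by auto
  qed
  hence "sigma_sets (space M) {{\<gamma> \<in> configs. num_points B \<gamma> = of_nat n} | B n. B \<in> sets borel} \<subseteq> sets M"
    by (intro sets.sigma_sets_subset) auto
  thus "sets config_space \<subseteq> sigma_sets configs ?V"
    unfolding sets_config_space setsM[symmetric] by simp
next
  show "sigma_sets configs ?V \<subseteq> sets (config_space :: 'a set measure)"
    unfolding space_config_space[symmetric]
    by (rule sets.sigma_sets_subset) (auto intro: configs_void_sets)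
qed

section \<open>Independent marking\<close>

lemma measurable_nn_integral_countable:
  assumes "countable A" and "\<And>x. x \<in> A \<Longrightarrow> F x \<in> borel_measurable M"
  shows "(\<lambda>y. \<integral>\<^sup>+x. F x y \<partial>count_space A) \<in> borel_measurable M"
proof (rule sigma_finite_measure.borel_measurable_nn_integral)
  show "sigma_finite_measure (count_space A)"
    by (rule sigma_finite_measure_count_space_countable[OF assms(1)])
  have "(\<lambda>p. F (fst p) (snd p)) \<in> borel_measurable (count_space A \<Otimes>\<^sub>M M)"
    using assms by (intro measurable_pair_measure_countable1) auto
  from measurable_pair_swap[OF this] show "(\<lambda>(y, x). F x y) \<in> borel_measurable (M \<Otimes>\<^sub>M count_space A)"
    by (simp add: case_prod_beta)
qed

lemma measurable_Pair_const_borel [measurable]: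
  "(\<lambda>y. (x :: 'a::topological_space, y :: 'b::topological_space)) \<in> borel_measurable borel"
  by (intro borel_measurable_continuous_onI continuous_on_Pair_const)

abbreviation graph_config :: "'a set \<Rightarrow> ('a \<Rightarrow> 'b) \<Rightarrow> ('a \<times> 'b) set" where
  "graph_config \<gamma> f \<equiv> (\<lambda>x. (x, f x)) ` \<gamma>"

text \<open>The projection of a compact set to the centres is compact, so local finiteness of the
  centres carries over to every choice of marks.\<close>

lemma graph_config_in_configs:
  fixes \<gamma> :: "'a::topological_space set" and f :: "'a \<Rightarrow> 'b::topological_space"
  assumes "\<gamma> \<in> configs"
  shows "graph_config \<gamma> f \<in> configs"
  unfolding configs_def
proof safe
  fix K :: "('a \<times> 'b) set" assume "compact K"
  hence "compact (fst ` K)"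
    by (intro compact_continuous_image continuous_on_fst continuous_on_id)
  hence "finite (\<gamma> \<inter> fst ` K)"
    using assms by (auto simp: configs_def)
  thus "finite (graph_config \<gamma> f \<inter> K)"
    by (rule finite_surj[where f = "\<lambda>x. (x, f x)"]) force
qed

lemma nn_integral_graph_config:
  "(\<integral>\<^sup>+z. F z \<partial>count_space (graph_config \<gamma> f)) = (\<integral>\<^sup>+x. F (x, f x) \<partial>count_space \<gamma>)"
  by (rule nn_integral_bij_count_space[symmetric]) (auto simp: bij_betw_def inj_on_def)

lemma countable_configs:
  fixes \<gamma> :: "'a::euclidean_space set"
  assumes "\<gamma> \<in> configs"
  shows "countable \<gamma>"
proof -
  have "\<gamma> = (\<Union>m::nat. \<gamma> \<inter> cball 0 (real m))"
    by (auto simp: real_arch_simple)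
  also have "countable \<dots>"
    using assms by (intro countable_UN) (auto intro!: countable_finite simp: configs_def)
  finally show ?thesis .
qed

definition mark_law :: "'b::topological_space measure \<Rightarrow> 'a::topological_space set \<Rightarrow> ('a \<times> 'b) set measure" where
  "mark_law \<eta> \<gamma> = distr (\<Pi>\<^sub>M x\<in>\<gamma>. \<eta>) config_space (graph_config \<gamma>)"

lemma marked_measure_eq: "marked_measure g \<eta> = g \<bind> mark_law \<eta>"
  by (simp add: marked_measure_def mark_law_def[abs_def])

lemma sets_mark_law [simp, measurable_cong]: "sets (mark_law \<eta> \<gamma>) = sets config_space"
  by (simp add: mark_law_def)

lemma space_mark_law [simp]: "space (mark_law \<eta> \<gamma>) = configs"
  by (simp add: mark_law_def)

lemma measurable_graph_config:
  fixes \<gamma> :: "'a::euclidean_space set" and \<eta> :: "'b::topological_space measure"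
  assumes \<gamma>: "\<gamma> \<in> configs" and \<eta>: "sets \<eta> = sets borel"
  shows "graph_config \<gamma> \<in> measurable (\<Pi>\<^sub>M x\<in>\<gamma>. \<eta>) config_space"
proof (rule measurable_config_spaceI)
  show "graph_config \<gamma> f \<in> configs" for f :: "'a \<Rightarrow> 'b"
    by (rule graph_config_in_configs[OF \<gamma>])
  fix B :: "('a \<times> 'b) set" assume [measurable]: "B \<in> sets borel"
  note [measurable_cong] = \<eta>
  have "(\<lambda>f. \<integral>\<^sup>+x. indicator B (x, f x) \<partial>count_space \<gamma>) \<in> borel_measurable (\<Pi>\<^sub>M x\<in>\<gamma>. \<eta>)"
  proof (rule measurable_nn_integral_countable[OF countable_configs[OF \<gamma>]])
    fix x assume "x \<in> \<gamma>"
    hence "(\<lambda>f. f x) \<in> measurable (\<Pi>\<^sub>M x\<in>\<gamma>. \<eta>) borel"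
      using measurable_component_singleton[of x \<gamma> "\<lambda>_. \<eta>"] measurable_cong_sets[OF refl \<eta>] by blast
    thus "(\<lambda>f. indicator B (x, f x) :: ennreal) \<in> borel_measurable (\<Pi>\<^sub>M x\<in>\<gamma>. \<eta>)"
      by measurable
  qed
  thus "(\<lambda>f. num_points B (graph_config \<gamma> f)) \<in> borel_measurable (\<Pi>\<^sub>M x\<in>\<gamma>. \<eta>)"
    by (simp add: nn_integral_count_space_indicator_num_points[symmetric] nn_integral_graph_config)
qed

lemma prob_space_mark_law:
  fixes \<gamma> :: "'a::euclidean_space set"
  assumes "\<gamma> \<in> configs" "sets \<eta> = sets borel" "prob_space \<eta>"
  shows "prob_space (mark_law \<eta> \<gamma>)"
  unfolding mark_law_def using assms
  by (intro prob_space.prob_space_distr prob_space_PiM measurable_graph_config) auto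

lemma nn_integral_mark_law:
  fixes \<gamma> :: "'a::euclidean_space set"
  assumes "\<gamma> \<in> configs" "sets \<eta> = sets borel" "F \<in> borel_measurable config_space"
  shows "(\<integral>\<^sup>+\<gamma>'. F \<gamma>' \<partial>mark_law \<eta> \<gamma>) = (\<integral>\<^sup>+f. F (graph_config \<gamma> f) \<partial>(\<Pi>\<^sub>M x\<in>\<gamma>. \<eta>))"
  unfolding mark_law_def using assms by (intro nn_integral_distr measurable_graph_config) auto

text \<open>A kernel of probability measures may be tested on an intersection-stable generator, here
  the void events. The void probability of \<open>B\<close> is the product over the centres of the
  probability that the marked point avoids \<open>B\<close>, a decreasing limit of finite products
  over balls.\<close>

lemma measurable_mark_law:
  fixes \<eta> :: "'b::{second_countable_topology,t0_space} measure"
  assumes \<eta>: "sets \<eta> = sets borel" "prob_space \<eta>"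
  shows "mark_law \<eta> \<in> measurable (config_space :: 'a::euclidean_space set measure) (subprob_algebra config_space)"
proof (rule measurable_subprob_algebra_generated[OF sets_config_space_void])
  interpret \<eta>: prob_space \<eta> by fact
  note [measurable_cong] = \<eta>(1)
  let ?V = "{{\<gamma> \<in> configs. \<gamma> \<inter> B = {}} | B. B \<in> sets borel} :: ('a \<times> 'b) set set set"
  show "Int_stable ?V"
  proof (rule Int_stableI, safe)
    fix B C :: "('a \<times> 'b) set" assume "B \<in> sets borel" "C \<in> sets borel"
    thus "\<exists>D. {\<gamma> \<in> configs. \<gamma> \<inter> B = {}} \<inter> {\<gamma> \<in> configs. \<gamma> \<inter> C = {}} = {\<gamma> \<in> configs. \<gamma> \<inter> D = {}} \<and> D \<in> sets borel"
      by (intro exI[of _ "B \<union> C"]) auto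
  qed
  show "?V \<subseteq> Pow configs" by auto
  fix \<gamma> :: "'a set" assume "\<gamma> \<in> space config_space"
  hence \<gamma>: "\<gamma> \<in> configs" by simp
  show "subprob_space (mark_law \<eta> \<gamma> :: ('a \<times> 'b) set measure)"
    by (intro prob_space_imp_subprob_space prob_space_mark_law \<gamma> \<eta>)
next
  interpret \<eta>: prob_space \<eta> by fact
  note [measurable_cong] = \<eta>(1)
  have "emeasure (mark_law \<eta> \<gamma>) (configs :: ('a \<times> 'b) set set) = 1" if "\<gamma> \<in> configs" for \<gamma> :: "'a set"
    using prob_space.emeasure_space_1[OF prob_space_mark_law[OF that \<eta>]] by simp
  thus "(\<lambda>\<gamma> :: 'a set. emeasure (mark_law \<eta> \<gamma>) (configs :: ('a \<times> 'b) set set)) \<in> borel_measurable config_space"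
    by (subst measurable_cong[where g = "\<lambda>_. 1"]) auto
  fix A :: "('a \<times> 'b) set set" assume "A \<in> {{\<gamma> \<in> configs. \<gamma> \<inter> B = {}} | B. B \<in> sets borel}"
  then obtain B where B[measurable]: "B \<in> sets borel" and A: "A = {\<gamma> \<in> configs. \<gamma> \<inter> B = {}}"
    by auto
  have sets_Z: "sets (borel :: ('a \<times> 'b) measure) = sets (borel \<Otimes>\<^sub>M \<eta>)"
    using \<eta>(1) by (simp add: borel_prod[symmetric] cong: sets_pair_measure_cong)
  \<comment> \<open>Centres outside the ball receive the factor 1, so that by local finiteness only
    finitely many factors differ from 1 and \<open>measurable_prod_config\<close> applies.\<close>
  define v where "v m x = (if x \<in> cball 0 (real m) then measure \<eta> (Pair x -` (- B)) else 1)" for m :: nat and x :: 'a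
  have [measurable]: "v m \<in> borel_measurable borel" for m
  proof -
    have "- B \<in> sets (borel \<Otimes>\<^sub>M \<eta>)"
      unfolding sets_Z[symmetric] by measurable
    hence "(\<lambda>x. measure \<eta> (Pair x -` (- B))) \<in> borel_measurable borel"
      unfolding measure_def by (intro measurable_compose[OF \<eta>.measurable_emeasure_Pair]) auto
    thus ?thesis unfolding v_def[abs_def] mem_cball by measurable
  qed
  have sec: "Pair x -` (- B) \<in> sets \<eta>" for x
    using measurable_sets[OF measurable_Pair_const_borel[of x], of "- B"] \<eta>(1) by auto
  have void: "emeasure (mark_law \<eta> \<gamma>) A = (INF m. ennreal (\<Prod>x\<in>{x \<in> \<gamma>. v m x \<noteq> 1}. v m x))"
    if \<gamma>: "\<gamma> \<in> configs" for \<gamma>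
  proof -
    let ?P = "\<Pi>\<^sub>M x\<in>\<gamma>. \<eta>"
    interpret P: product_prob_space "\<lambda>_. \<eta>" \<gamma>
      by unfold_locales
    define C where "C m = prod_emb \<gamma> (\<lambda>_. \<eta>) (\<gamma> \<inter> cball 0 (real m)) (Pi\<^sub>E (\<gamma> \<inter> cball 0 (real m)) (\<lambda>x. Pair x -` (- B)))" for m :: nat
    have fin: "finite (\<gamma> \<inter> cball 0 (real m))" for m
      using \<gamma> by (auto simp: configs_def)
    have C_eq: "C m = {f \<in> space ?P. \<forall>x\<in>\<gamma> \<inter> cball 0 (real m). (x, f x) \<notin> B}" for m
      by (auto simp: C_def prod_emb_iff space_PiM PiE_iff)
    have C_sets: "C m \<in> sets ?P" for m
      unfolding C_def using fin sec by (intro sets_PiM_I) auto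
    have "emeasure (mark_law \<eta> \<gamma>) A = emeasure ?P (graph_config \<gamma> -` A \<inter> space ?P)"
      unfolding mark_law_def A
      by (intro emeasure_distr measurable_graph_config \<gamma> \<eta>(1) configs_void_sets B)
    also have "graph_config \<gamma> -` A \<inter> space ?P = (\<Inter>m. C m)"
    proof -
      have "\<exists>m::nat. x \<in> cball 0 (real m)" for x :: 'a
        by (simp add: real_arch_simple)
      hence "(\<forall>m::nat. \<forall>x\<in>\<gamma> \<inter> cball 0 (real m). (x, f x) \<notin> B) \<longleftrightarrow> (\<forall>x\<in>\<gamma>. (x, f x) \<notin> B)" for f
        by blast
      thus ?thesis
        unfolding C_eq A using graph_config_in_configs[OF \<gamma>] by auto
    qed
    also have "emeasure ?P \<dots> = (INF m. emeasure ?P (C m))"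
    proof (rule INF_emeasure_decseq[symmetric])
      show "decseq C"
        unfolding decseq_def C_eq by (auto simp: order_trans)
    qed (use C_sets P.emeasure_finite in auto)
    also have "(\<lambda>m. emeasure ?P (C m)) = (\<lambda>m. ennreal (\<Prod>x\<in>{x \<in> \<gamma>. v m x \<noteq> 1}. v m x))"
    proof (rule ext)
      fix m
      have "emeasure ?P (C m) = (\<Prod>x\<in>\<gamma> \<inter> cball 0 (real m). emeasure \<eta> (Pair x -` (- B)))"
        unfolding C_def using fin sec by (intro P.emeasure_PiM_emb) auto
      also have "\<dots> = (\<Prod>x\<in>\<gamma> \<inter> cball 0 (real m). ennreal (v m x))"
        by (intro prod.cong refl) (auto simp: v_def \<eta>.emeasure_eq_measure)
      also have "\<dots> = ennreal (\<Prod>x\<in>\<gamma> \<inter> cball 0 (real m). v m x)"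
        by (intro prod_ennreal) (auto simp: v_def)
      also have "(\<Prod>x\<in>\<gamma> \<inter> cball 0 (real m). v m x) = (\<Prod>x\<in>{x \<in> \<gamma>. v m x \<noteq> 1}. v m x)"
        using fin by (intro prod.mono_neutral_right) (auto simp: v_def split: if_splits)
      finally show "emeasure ?P (C m) = ennreal (\<Prod>x\<in>{x \<in> \<gamma>. v m x \<noteq> 1}. v m x)" .
    qed
    finally show ?thesis .
  qed
  have [measurable]: "(\<lambda>\<gamma>. \<Prod>x\<in>{x \<in> \<gamma>. v m x \<noteq> 1}. v m x) \<in> borel_measurable config_space" for m
  proof (rule measurable_prod_config)
    show "v m \<in> borel_measurable borel" by measurable
  qed (simp add: v_def)
  have "(\<lambda>\<gamma>. INF m. ennreal (\<Prod>x\<in>{x \<in> \<gamma>. v m x \<noteq> 1}. v m x)) \<in> borel_measurable config_space"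
    by measurable
  thus "(\<lambda>\<gamma>. emeasure (mark_law \<eta> \<gamma>) A) \<in> borel_measurable config_space"
    using void by (subst measurable_cong) auto
qed simp_all

section \<open>Quasi-invariance of independent marking\<close>

text \<open>Both measures are compared on cylinders. A cylinder over \<open>J'\<close> is regarded
  as one over \<open>J \<union> J'\<close>, after which each side is a product of one-coordinate
  integrals over the same finite index set.\<close>

lemma distr_PiM_change_finite:
  fixes T :: "'i \<Rightarrow> 'b \<Rightarrow> 'b" and r :: "'i \<Rightarrow> 'b \<Rightarrow> ennreal"
  assumes \<eta>: "prob_space \<eta>" and J: "finite J" "J \<subseteq> I"
    and T: "\<And>x. x \<in> J \<Longrightarrow> T x \<in> measurable \<eta> \<eta>"
    and r: "\<And>x. x \<in> J \<Longrightarrow> r x \<in> borel_measurable \<eta>"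
    and change: "\<And>x. x \<in> J \<Longrightarrow> distr \<eta> \<eta> (T x) = density \<eta> (r x)"
  shows "distr (\<Pi>\<^sub>M x\<in>I. \<eta>) (\<Pi>\<^sub>M x\<in>I. \<eta>) (\<lambda>f. \<lambda>x\<in>I. if x \<in> J then T x (f x) else f x) =
    density (\<Pi>\<^sub>M x\<in>I. \<eta>) (\<lambda>f. \<Prod>x\<in>J. r x (f x))" (is "distr ?P ?P ?U = density ?P ?R")
proof (rule measure_eqI_PiM_infinite)
  interpret \<eta>: prob_space \<eta> by fact
  interpret P: product_prob_space "\<lambda>_. \<eta>" I
    by unfold_locales
  define T' where "T' x = (if x \<in> J then T x else id)" for x
  have T': "T' x \<in> measurable \<eta> \<eta>" for x
    using T by (auto simp: T'_def)
  have comp: "(\<lambda>f. f x) \<in> measurable ?P \<eta>" if "x \<in> I" for x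
    using that by measurable
  have U_eq: "?U f = (\<lambda>x\<in>I. T' x (f x))" for f
    by (auto simp: T'_def restrict_def)
  have U: "?U \<in> measurable ?P ?P"
    unfolding U_eq by (intro measurable_restrict measurable_compose[OF comp T'])
  have R: "?R \<in> borel_measurable ?P"
    using J by (intro borel_measurable_prod_ennreal measurable_compose[OF comp r]) auto
  show "finite_measure (distr ?P ?P ?U)"
    by (intro prob_space.finite_measure P.prob_space_distr U)
  fix A J' assume J': "finite J'" "J' \<subseteq> I" "\<And>i. i \<in> J' \<Longrightarrow> A i \<in> sets \<eta>"
  \<comment> \<open>Coordinates of \<open>J\<close> outside \<open>J'\<close> are moved but
    unconstrained, hence the whole space there.\<close>
  define A' where "A' x = (if x \<in> J' then A x else space \<eta>)" for x
  have A': "A' x \<in> sets \<eta>" for x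
    using J' by (auto simp: A'_def)
  let ?J = "J \<union> J'"
  have J2: "finite ?J" "?J \<subseteq> I"
    using J J' by auto
  \<comment> \<open>The weight of one coordinate: its density, or 1 if it is not moved, times its
    constraint. By \<open>change\<close> its integral is the mass of the preimage of the
    constraint.\<close>
  define w where "w x y = (if x \<in> J then r x y else 1) * indicator (A' x) y" for x y
  have w: "w x \<in> borel_measurable \<eta>" for x
    unfolding w_def[abs_def] using r A' by (cases "x \<in> J") auto
  have T'_w: "emeasure \<eta> (T' x -` A' x \<inter> space \<eta>) = (\<integral>\<^sup>+y. w x y \<partial>\<eta>)" if "x \<in> ?J" for x
  proof (cases "x \<in> J")
    case True
    have "emeasure \<eta> (T' x -` A' x \<inter> space \<eta>) = emeasure (distr \<eta> \<eta> (T x)) (A' x)"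
      using True A' T by (simp add: T'_def emeasure_distr)
    also have "\<dots> = (\<integral>\<^sup>+y. w x y \<partial>\<eta>)"
      unfolding change[OF True] w_def using True A' r by (simp add: emeasure_density)
    finally show ?thesis .
  next
    case False
    have "A' x \<inter> space \<eta> = A' x"
      using sets.sets_into_space[OF A'] by blast
    thus ?thesis
      using False A' by (simp add: w_def T'_def)
  qed
  have emb: "prod_emb I (\<lambda>_. \<eta>) J' (Pi\<^sub>E J' A) = {f \<in> space ?P. \<forall>x\<in>?J. f x \<in> A' x}"
    using J2(2) by (auto simp: prod_emb_iff space_PiM PiE_iff A'_def)
  have emb_sets: "prod_emb I (\<lambda>_. \<eta>) J' (Pi\<^sub>E J' A) \<in> sets ?P"
    using J' by (intro sets_PiM_I) auto
  have "emeasure (distr ?P ?P ?U) (prod_emb I (\<lambda>_. \<eta>) J' (Pi\<^sub>E J' A)) =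
      emeasure ?P (?U -` prod_emb I (\<lambda>_. \<eta>) J' (Pi\<^sub>E J' A) \<inter> space ?P)"
    using U emb_sets by (rule emeasure_distr)
  also have "?U -` prod_emb I (\<lambda>_. \<eta>) J' (Pi\<^sub>E J' A) \<inter> space ?P =
      prod_emb I (\<lambda>_. \<eta>) ?J (Pi\<^sub>E ?J (\<lambda>x. T' x -` A' x \<inter> space \<eta>))"
  proof -
    have "?U f \<in> space ?P" if "f \<in> space ?P" for f
      using measurable_space[OF U that] .
    thus ?thesis
      unfolding emb U_eq using J2(2)
      by (auto simp: prod_emb_iff space_PiM PiE_iff subset_iff intro: extensional_arb)
  qed
  also have "emeasure ?P \<dots> = (\<Prod>x\<in>?J. emeasure \<eta> (T' x -` A' x \<inter> space \<eta>))"
    using J2 A' T' by (intro P.emeasure_PiM_emb) (auto intro: measurable_sets)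
  also have "\<dots> = (\<Prod>x\<in>?J. \<integral>\<^sup>+y. w x y \<partial>\<eta>)"
    using T'_w by (rule prod.cong[OF refl])
  also have "\<dots> = (\<integral>\<^sup>+v. (\<Prod>x\<in>?J. w x (v x)) \<partial>(\<Pi>\<^sub>M x\<in>?J. \<eta>))"
    using J2 w by (intro P.product_nn_integral_prod[symmetric]) auto
  also have "\<dots> = (\<integral>\<^sup>+v. (\<Prod>x\<in>?J. w x (v x)) \<partial>distr ?P (\<Pi>\<^sub>M x\<in>?J. \<eta>) (\<lambda>f. restrict f ?J))"
    using P.distr_PiM_restrict_finite[OF J2] by simp
  also have "\<dots> = (\<integral>\<^sup>+f. (\<Prod>x\<in>?J. w x (restrict f ?J x)) \<partial>?P)"
  proof -
    have "(\<lambda>f. restrict f ?J) \<in> measurable ?P (\<Pi>\<^sub>M x\<in>?J. \<eta>)"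
      using J2 by (intro measurable_restrict_subset) auto
    moreover have "(\<lambda>v. \<Prod>x\<in>?J. w x (v x)) \<in> borel_measurable (\<Pi>\<^sub>M x\<in>?J. \<eta>)"
      by (intro borel_measurable_prod_ennreal measurable_compose[OF measurable_component_singleton[where M = "\<lambda>_. \<eta>"] w])
    ultimately show ?thesis
      by (intro nn_integral_distr) auto
  qed
  also have "\<dots> = (\<integral>\<^sup>+f. ?R f * indicator (prod_emb I (\<lambda>_. \<eta>) J' (Pi\<^sub>E J' A)) f \<partial>?P)"
  proof (rule nn_integral_cong)
    fix f assume f: "f \<in> space ?P"
    have "(\<Prod>x\<in>?J. w x (restrict f ?J x)) = (\<Prod>x\<in>?J. if x \<in> J then r x (f x) else 1) * (\<Prod>x\<in>?J. indicator (A' x) (f x))"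
      unfolding prod.distrib[symmetric] by (intro prod.cong) (auto simp: w_def)
    also have "(\<Prod>x\<in>?J. if x \<in> J then r x (f x) else 1) = ?R f"
      using J2 by (subst prod.inter_restrict[symmetric]) (auto intro!: prod.cong)
    also have "(\<Prod>x\<in>?J. indicator (A' x) (f x) :: ennreal) = indicator (prod_emb I (\<lambda>_. \<eta>) J' (Pi\<^sub>E J' A)) f"
      unfolding emb using f J2 by (auto simp: indicator_def prod_zero_iff)
    finally show "(\<Prod>x\<in>?J. w x (restrict f ?J x)) = ?R f * indicator (prod_emb I (\<lambda>_. \<eta>) J' (Pi\<^sub>E J' A)) f" .
  qed
  also have "\<dots> = emeasure (density ?P ?R) (prod_emb I (\<lambda>_. \<eta>) J' (Pi\<^sub>E J' A))"
    using R emb_sets by (rule emeasure_density[symmetric])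
  finally show "emeasure (distr ?P ?P ?U) (prod_emb I (\<lambda>_. \<eta>) J' (Pi\<^sub>E J' A)) =
      emeasure (density ?P ?R) (prod_emb I (\<lambda>_. \<eta>) J' (Pi\<^sub>E J' A))" .
qed auto

text \<open>The continuous left inverse \<open>G\<close> takes a compact \<open>K\<close> to a
  compact set, and every point of the image in \<open>K\<close> comes from a point of \<gamma> in
  \<open>G\<close> of \<open>K\<close>.\<close>

lemma image_in_configs:
  fixes F :: "'a::topological_space \<Rightarrow> 'b::topological_space"
  assumes "\<gamma> \<in> configs" and G: "continuous_on UNIV G" "\<And>x. G (F x) = x"
  shows "F ` \<gamma> \<in> configs"
  unfolding configs_def
proof safe
  fix K :: "'b set" assume "compact K"
  hence "compact (G ` K)"
    using G by (intro compact_continuous_image) (auto intro: continuous_on_subset)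
  hence "finite (\<gamma> \<inter> G ` K)"
    using assms by (auto simp: configs_def)
  thus "finite (F ` \<gamma> \<inter> K)"
    by (rule finite_surj[where f = F]) (use G(2) in \<open>safe, metis IntI imageI\<close>)
qed

lemma num_points_image:
  assumes "inj F"
  shows "num_points B (F ` \<gamma>) = num_points (F -` B) \<gamma>"
proof -
  have "num_points B (F ` \<gamma>) = (\<integral>\<^sup>+z. indicator B (F z) \<partial>count_space \<gamma>)"
    unfolding nn_integral_count_space_indicator_num_points[symmetric] using assms
    by (intro nn_integral_bij_count_space[symmetric]) (auto simp: bij_betw_def intro: inj_on_subset)
  also have "\<dots> = num_points (F -` B) \<gamma>"
    unfolding nn_integral_count_space_indicator_num_points[symmetric]
    by (intro nn_integral_cong) (auto simp: indicator_def)
  finally show ?thesis .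
qed

lemma measurable_image_config:
  fixes F :: "'a::topological_space \<Rightarrow> 'b::topological_space"
  assumes F: "continuous_on UNIV F" and G: "continuous_on UNIV G" "\<And>x. G (F x) = x"
  shows "image F \<in> measurable config_space config_space"
proof (rule measurable_config_spaceI)
  show "F ` \<gamma> \<in> configs" if "\<gamma> \<in> space config_space" for \<gamma>
    using that by (intro image_in_configs[OF _ G]) auto
  fix B :: "'b set" assume "B \<in> sets borel"
  hence "F -` B \<in> sets borel"
    using measurable_sets[OF borel_measurable_continuous_onI[OF F], of B] by simp
  moreover have "inj F"
    using G(2) by (rule inj_on_inverseI)
  ultimately show "(\<lambda>\<gamma>. num_points B (F ` \<gamma>)) \<in> borel_measurable config_space"
    by (simp add: num_points_image measurable_num_points)
qed

section \<open>Clusters with a droplet in a given set\<close>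

definition hits :: "'a::plus set \<Rightarrow> ('a \<times> 'a list) set" where
  "hits K = {p. set (shift (snd p) (fst p)) \<inter> K \<noteq> {}}"

lemma hits_iff: "p \<in> hits K \<longleftrightarrow> (\<exists>y\<in>set (snd p). y + fst p \<in> K)"
  by (auto simp: hits_def shift_def)

text \<open>A first-moment bound: a cluster that hits \<open>K\<close> has at least one droplet
  there. It lets the mean cluster size control the number of such clusters.\<close>

lemma indicator_hits_le:
  "indicator (hits K) p \<le> (sum_list (map (indicator K) (shift (snd p) (fst p))) :: ennreal)"
proof (cases "p \<in> hits K")
  case True
  then obtain y where "y \<in> set (shift (snd p) (fst p))" "y \<in> K"
    by (auto simp: hits_def)
  hence "(1 :: ennreal) \<in> set (map (indicator K) (shift (snd p) (fst p)))"
    by (force simp: indicator_def)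
  hence "(1 :: ennreal) \<le> sum_list (map (indicator K) (shift (snd p) (fst p)))"
    by (rule member_le_sum_list) simp
  thus ?thesis using True by simp
qed auto

lemma hits_iff_sum_list:
  "p \<in> hits K \<longleftrightarrow> (sum_list (map (indicator K) (shift (snd p) (fst p))) :: ennreal) \<noteq> 0"
proof -
  have "(sum_list (map (indicator K) ys) :: ennreal) = 0 \<longleftrightarrow> set ys \<inter> K = {}" for ys
    by (induction ys) auto
  thus ?thesis by (simp add: hits_def)
qed

lemma measurable_sum_list_shift [measurable]:
  assumes [measurable]: "c \<in> borel_measurable borel"
  shows "(\<lambda>p :: 'a::euclidean_space \<times> 'a list. sum_list (map c (shift (snd p) (fst p))) :: ennreal) \<in> borel_measurable borel"
  by (rule measurable_compose[OF measurable_shift measurable_sum_list[OF assms]])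

lemma hits_sets [measurable]:
  fixes K :: "'a::euclidean_space set"
  assumes [measurable]: "K \<in> sets borel"
  shows "hits K \<in> sets borel"
proof -
  have "hits K = {p \<in> space borel. (sum_list (map (indicator K) (shift (snd p) (fst p))) :: ennreal) \<noteq> 0}"
    using hits_iff_sum_list by auto
  also have "\<dots> \<in> sets borel"
    by measurable
  finally show ?thesis .
qed

lemma jacobian_identity:
  assumes "open S" "x \<in> S" "\<And>y. y \<in> S \<Longrightarrow> f y = y"
  shows "jacobian f x = mat 1"
proof -
  have "(f has_derivative id) (at x)"
    by (rule has_derivative_transform_within_open[OF has_derivative_id assms(1,2)]) (simp add: assms(3))
  hence "frechet_derivative f (at x) = id"
    by (simp add: frechet_derivative_at[symmetric])
  thus ?thesis
    by (simp add: jacobian_def matrix_id_mat_1)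
qed

text \<open>A bijection that fixes the complement of \<open>K\<close> pointwise also preserves
  \<open>K\<close>. This last property is what makes \<open>hits K\<close> invariant under
  \<open>hat_map \<phi>\<close>.\<close>

lemma Diff0_support:
  assumes "\<phi> \<in> Diff0"
  obtains K where "compact K" "\<And>x. x \<notin> K \<Longrightarrow> \<phi> x = x" "\<And>x. x \<notin> K \<Longrightarrow> inv \<phi> x = x"
    "\<And>x. \<phi> x \<in> K \<longleftrightarrow> x \<in> K"
proof -
  obtain K where K: "compact K" "\<And>x. x \<notin> K \<Longrightarrow> \<phi> x = x"
    using assms by (auto simp: Diff0_def)
  have "inv \<phi> x = x" if "x \<notin> K" for x
    using K(2)[OF that] Diff0_inverse(2)[OF assms, of x] by simp
  moreover have "\<phi> x \<in> K \<longleftrightarrow> x \<in> K" for x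
    using K(2) Diff0_inverse(2)[OF assms] by metis
  ultimately show ?thesis using that K by blast
qed

lemma hat_map_outside_hits:
  fixes p :: "'a::group_add \<times> 'a list"
  assumes "\<And>x. x \<notin> K \<Longrightarrow> \<phi> x = x" "p \<notin> hits K"
  shows "hat_map \<phi> p = p"
proof -
  have "map (\<lambda>y. \<phi> (y + fst p) - fst p) (snd p) = snd p"
    using assms by (intro map_idI) (auto simp: hits_iff)
  thus ?thesis by (simp add: hat_map_eq prod_eq_iff)
qed

lemma hat_map_hits:
  fixes p :: "'a::group_add \<times> 'a list"
  assumes "\<And>x. \<phi> x \<in> K \<longleftrightarrow> x \<in> K"
  shows "hat_map \<phi> p \<in> hits K \<longleftrightarrow> p \<in> hits K"
  using assms by (simp add: hits_iff hat_map_eq)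

text \<open>The complement of \<open>K\<close> is open, so the inverse is the identity near each
  droplet. All Jacobian determinants are then 1 and the quotient of the values of \<open>h\<close>
  cancels.\<close>

lemma rho_outside_hits:
  assumes K: "compact K" "\<And>x. x \<notin> K \<Longrightarrow> inv \<phi> x = x" and p: "p \<notin> hits K"
  shows "rho h \<phi> p = 1"
proof -
  have "\<bar>det (jacobian (inv \<phi>) y)\<bar> = 1" if "y \<notin> K" for y
    using jacobian_identity[of "- K" y "inv \<phi>"] K that by (auto simp: compact_imp_closed open_Compl)
  hence "prod_list (map (\<lambda>y. \<bar>det (jacobian (inv \<phi>) y)\<bar>) (shift (snd p) (fst p))) = prod_list (map (\<lambda>_. 1) (shift (snd p) (fst p)))"
    using p by (intro arg_cong[where f = prod_list] map_cong) (auto simp: hits_def)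
  also have "\<dots> = 1"
    by (simp add: map_replicate_const)
  finally show ?thesis
    by (simp add: rho_eq hat_map_outside_hits[OF K(2) p])
qed

section \<open>The marked Gibbs measure\<close>

text \<open>Campbell's formula; the definition of the correlation function is the case of
  indicators.\<close>

lemma first_correlation_nn_integral:
  assumes corr: "first_correlation \<theta> g \<kappa>" and g: "sets g = sets config_space" and \<theta>: "sets \<theta> = sets borel"
    and u: "u \<in> borel_measurable borel"
  shows "(\<integral>\<^sup>+\<gamma>. (\<integral>\<^sup>+x. u x \<partial>count_space \<gamma>) \<partial>g) = (\<integral>\<^sup>+x. ennreal (\<kappa> x) * u x \<partial>\<theta>)"
  using u
proof (induction rule: borel_measurable_induct)
  case (cong f g')
  hence "f = g'" by auto
  thus ?case using cong by simp
next
  note [measurable_cong] = g \<theta>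
  case (set A)
  thus ?case
    using corr by (simp add: first_correlation_def nn_integral_count_space_indicator_num_points num_points_def)
next
  note [measurable_cong] = g \<theta>
  have [measurable]: "\<kappa> \<in> borel_measurable borel"
    using corr by (simp add: first_correlation_def)
  case (mult u c)
  note [measurable] = mult(2)
  thus ?case
    using mult by (simp add: nn_integral_cmult measurable_nn_integral_config mult.left_commute)
next
  note [measurable_cong] = g \<theta>
  have [measurable]: "\<kappa> \<in> borel_measurable borel"
    using corr by (simp add: first_correlation_def)
  case (add u v)
  note [measurable] = add(1,3)
  thus ?case
    using add by (simp add: nn_integral_add measurable_nn_integral_config distrib_left)
next
  note [measurable_cong] = g \<theta>
  have [measurable]: "\<kappa> \<in> borel_measurable borel"
    using corr by (simp add: first_correlation_def)
  case (seq U)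
  note [measurable] = seq(1)
  have "(\<integral>\<^sup>+\<gamma>. (\<integral>\<^sup>+x. (SUP i. U i) x \<partial>count_space \<gamma>) \<partial>g) = (\<integral>\<^sup>+\<gamma>. (SUP i. \<integral>\<^sup>+x. U i x \<partial>count_space \<gamma>) \<partial>g)"
    unfolding SUP_apply using seq by (intro nn_integral_cong nn_integral_monotone_convergence_SUP) auto
  also have "\<dots> = (SUP i. \<integral>\<^sup>+\<gamma>. (\<integral>\<^sup>+x. U i x \<partial>count_space \<gamma>) \<partial>g)"
    using seq by (intro nn_integral_monotone_convergence_SUP)
      (auto simp: incseq_def le_fun_def intro!: nn_integral_mono)
  also have "\<dots> = (SUP i. \<integral>\<^sup>+x. ennreal (\<kappa> x) * U i x \<partial>\<theta>)"
    using seq.IH by simp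
  also have "\<dots> = (\<integral>\<^sup>+x. (SUP i. ennreal (\<kappa> x) * U i x) \<partial>\<theta>)"
    using seq by (intro nn_integral_monotone_convergence_SUP[symmetric])
      (auto simp: incseq_def le_fun_def intro!: mult_left_mono)
  also have "\<dots> = (\<integral>\<^sup>+x. ennreal (\<kappa> x) * (SUP i. U i) x \<partial>\<theta>)"
    unfolding SUP_apply SUP_mult_left_ennreal ..
  finally show ?case .
qed

locale cluster_model =
  fixes \<theta> :: "(real^'n) measure"
    and g :: "(real^'n) set measure"
    and \<kappa> :: "real^'n \<Rightarrow> real"
    and \<eta> :: "(real^'n) list measure"
    and h :: "(real^'n) list \<Rightarrow> real"
  assumes sets_theta [measurable_cong]: "sets \<theta> = sets borel"
    and sets_g [measurable_cong]: "sets g = sets config_space"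
    and prob_g: "prob_space g"
    and theta_bound: "\<And>B. compact B \<Longrightarrow> (SUP x. emeasure \<theta> ((\<lambda>y. y + x) ` B)) < \<infinity>"
    and corr: "first_correlation \<theta> g \<kappa>"
    and corr_bdd: "bounded (range \<kappa>)"
    and eta_prob: "prob_space \<eta>"
    and h_meas [measurable]: "h \<in> borel_measurable borel"
    and h_nonneg: "\<And>ys. 0 \<le> h ys"
    and eta_density: "\<eta> = density list_lborel (\<lambda>ys. ennreal (h ys))"
    and mean_size: "(\<integral>\<^sup>+ys. of_nat (length ys) \<partial>\<eta>) < \<infinity>"
    and h_pos: "AE ys in list_lborel. h ys > 0"
begin

lemma sets_eta [measurable_cong]: "sets \<eta> = sets borel"
  by (simp add: eta_density)

lemma space_g [simp]: "space g = configs"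
  using sets_eq_imp_space_eq[OF sets_g] by simp

abbreviation "ghat \<equiv> marked_measure g \<eta>"

lemma measurable_mark_law_g:
  "mark_law \<eta> \<in> measurable g (subprob_algebra config_space)"
  using measurable_mark_law[OF sets_eta eta_prob] measurable_cong_sets[OF sets_g refl] by blast

lemma space_g_nonempty: "space g \<noteq> {}"
  using prob_space.not_empty[OF prob_g] .

lemma sets_ghat [simp, measurable_cong]: "sets ghat = sets config_space"
  unfolding marked_measure_eq by (rule sets_bind_measurable[OF measurable_mark_law_g space_g_nonempty])

lemma space_ghat [simp]: "space ghat = configs"
  using sets_eq_imp_space_eq[OF sets_ghat] by simp

lemma prob_ghat: "prob_space ghat"
  unfolding marked_measure_eq
  using prob_space_mark_law[OF _ sets_eta eta_prob]
  by (intro prob_space.prob_space_bind[OF prob_g _ measurable_mark_law_g] AE_I2) simp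

lemma nn_integral_ghat:
  assumes "F \<in> borel_measurable config_space"
  shows "(\<integral>\<^sup>+\<gamma>. F \<gamma> \<partial>ghat) = (\<integral>\<^sup>+\<gamma>. (\<integral>\<^sup>+\<gamma>'. F \<gamma>' \<partial>mark_law \<eta> \<gamma>) \<partial>g)"
  unfolding marked_measure_eq by (rule nn_integral_bind[OF assms measurable_mark_law_g])

lemma emeasure_ghat:
  assumes "A \<in> sets config_space"
  shows "emeasure ghat A = (\<integral>\<^sup>+\<gamma>. emeasure (mark_law \<eta> \<gamma>) A \<partial>g)"
  unfolding marked_measure_eq by (rule emeasure_bind[OF space_g_nonempty measurable_mark_law_g assms])

text \<open>The translate by 0 in the uniform bound shows that balls have finite measure.
  Sigma-finiteness is required for exchanging centres and marks below.\<close>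

lemma sigma_finite_theta: "sigma_finite_measure \<theta>"
proof (rule sigma_finite_measure.intro, intro exI conjI)
  let ?A = "range (\<lambda>n::nat. cball (0 :: real^'n) (real n))"
  show "countable ?A" by simp
  show "?A \<subseteq> sets \<theta>" by (auto simp: sets_theta)
  show "\<Union>?A = space \<theta>"
    using sets_eq_imp_space_eq[OF sets_theta] by (auto simp: real_arch_simple)
  show "\<forall>a\<in>?A. emeasure \<theta> a \<noteq> \<infinity>"
  proof safe
    fix n :: nat assume inf: "emeasure \<theta> (cball (0 :: real^'n) (real n)) = \<infinity>"
    have "emeasure \<theta> ((\<lambda>y. y + 0) ` cball (0 :: real^'n) (real n)) \<le> (SUP x. emeasure \<theta> ((\<lambda>y. y + x) ` cball 0 (real n)))"
      by (rule SUP_upper) simp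
    also have "\<dots> < \<infinity>"
      by (intro theta_bound compact_cball)
    finally show False using inf by simp
  qed
qed

text \<open>For a droplet at relative position \<open>y\<close> the centres \<open>x\<close> with
  \<open>y + x\<close> in \<open>K\<close> form a translate of \<open>K\<close>, of measure at most
  \<open>C\<close>. After exchanging the integrals, summation over the droplets gives
  \<open>C\<close> times the mean cluster size.\<close>

lemma integral_hits_theta:
  assumes K: "compact K"
  shows "(\<integral>\<^sup>+x. emeasure \<eta> (Pair x -` hits K) \<partial>\<theta>) < \<infinity>"
proof -
  interpret \<theta>: sigma_finite_measure \<theta> by (rule sigma_finite_theta)
  interpret \<eta>: prob_space \<eta> by (rule eta_prob)
  interpret pair_sigma_finite \<theta> \<eta> ..
  define C where "C = (SUP x. emeasure \<theta> ((\<lambda>y. y + x) ` K))"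
  have C: "C < \<infinity>"
    unfolding C_def by (rule theta_bound[OF K])
  have [measurable]: "K \<in> sets borel"
    using K by (simp add: compact_imp_closed)
  have bound: "(\<integral>\<^sup>+x. indicator K (y + x) \<partial>\<theta>) \<le> C" for y
  proof -
    have "(\<integral>\<^sup>+x. indicator K (y + x) \<partial>\<theta>) = (\<integral>\<^sup>+x. indicator ((\<lambda>z. z + (- y)) ` K) x \<partial>\<theta>)"
      by (intro nn_integral_cong) (auto simp: indicator_def image_iff)
    also have "\<dots> = emeasure \<theta> ((\<lambda>z. z + (- y)) ` K)"
    proof (rule nn_integral_indicator)
      have "compact ((\<lambda>z. z + (- y)) ` K)"
        by (intro compact_continuous_image continuous_intros K)
      thus "(\<lambda>z. z + (- y)) ` K \<in> sets \<theta>"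
        by (simp add: sets_theta compact_imp_closed)
    qed
    also have "\<dots> \<le> C"
      unfolding C_def by (rule SUP_upper) simp
    finally show ?thesis .
  qed
  have sets_Z: "sets (borel :: ((real^'n) \<times> (real^'n) list) measure) = sets (\<theta> \<Otimes>\<^sub>M \<eta>)"
    by (simp add: borel_prod[symmetric] sets_theta sets_eta cong: sets_pair_measure_cong)
  have meas: "(\<lambda>(x, ys). sum_list (map (indicator K) (shift ys x)) :: ennreal) \<in> borel_measurable (\<theta> \<Otimes>\<^sub>M \<eta>)"
  proof -
    have "(\<lambda>p. sum_list (map (indicator K) (shift (snd p) (fst p))) :: ennreal) \<in> borel_measurable borel"
      by measurable
    thus ?thesis
      unfolding measurable_cong_sets[OF sets_Z refl] split_beta' .
  qed
  have "(\<integral>\<^sup>+x. emeasure \<eta> (Pair x -` hits K) \<partial>\<theta>) = (\<integral>\<^sup>+x. (\<integral>\<^sup>+ys. indicator (hits K) (x, ys) \<partial>\<eta>) \<partial>\<theta>)"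
  proof (intro nn_integral_cong)
    fix x
    have "Pair x -` hits K \<in> sets \<eta>"
      using measurable_sets[OF measurable_Pair_const_borel[of x], of "hits K"] by (simp add: sets_eta)
    moreover have "(\<integral>\<^sup>+ys. indicator (hits K) (x, ys) \<partial>\<eta>) = (\<integral>\<^sup>+ys. indicator (Pair x -` hits K) ys \<partial>\<eta>)"
      by (intro nn_integral_cong) (simp add: indicator_def)
    ultimately show "emeasure \<eta> (Pair x -` hits K) = (\<integral>\<^sup>+ys. indicator (hits K) (x, ys) \<partial>\<eta>)"
      by simp
  qed
  also have "\<dots> \<le> (\<integral>\<^sup>+x. (\<integral>\<^sup>+ys. sum_list (map (indicator K) (shift ys x)) \<partial>\<eta>) \<partial>\<theta>)"
    using indicator_hits_le[of K] by (intro nn_integral_mono) (metis fst_conv snd_conv)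
  also have "\<dots> = (\<integral>\<^sup>+ys. (\<integral>\<^sup>+x. sum_list (map (indicator K) (shift ys x)) \<partial>\<theta>) \<partial>\<eta>)"
    using meas by (rule Fubini'[symmetric])
  also have "\<dots> \<le> (\<integral>\<^sup>+ys. C * of_nat (length ys) \<partial>\<eta>)"
  proof (rule nn_integral_mono)
    fix ys
    show "(\<integral>\<^sup>+x. sum_list (map (indicator K) (shift ys x)) \<partial>\<theta>) \<le> C * of_nat (length ys)"
    proof (induction ys)
      case (Cons y ys)
      have "(\<lambda>x. sum_list (map (indicator K) (shift ys x)) :: ennreal) \<in> borel_measurable \<theta>"
        using measurable_Pair1[OF meas, of ys] by (simp add: sets_eq_imp_space_eq[OF sets_eta])
      hence "(\<integral>\<^sup>+x. sum_list (map (indicator K) (shift (y # ys) x)) \<partial>\<theta>) =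
          (\<integral>\<^sup>+x. indicator K (y + x) \<partial>\<theta>) + (\<integral>\<^sup>+x. sum_list (map (indicator K) (shift ys x)) \<partial>\<theta>)"
        by (simp add: shift_def nn_integral_add)
      also have "\<dots> \<le> C + C * of_nat (length ys)"
        by (intro add_mono bound Cons.IH)
      finally show ?case by (simp add: distrib_left)
    qed (simp add: shift_def)
  qed
  also have "\<dots> = C * (\<integral>\<^sup>+ys. of_nat (length ys) \<partial>\<eta>)"
    by (intro nn_integral_cmult) measurable
  also have "\<dots> < \<infinity>"
    using C mean_size by (simp add: ennreal_mult_less_top)
  finally show ?thesis .
qed

text \<open>The number of clusters hitting \<open>K\<close> has finite expectation: integrating out
  the marks leaves a sum of hitting probabilities over the centres, which Campbell's formula and the
  bound on \<open>\<kappa>\<close> reduce to the previous lemma.\<close>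

lemma AE_finite_hits:
  assumes K: "compact K"
  shows "AE \<gamma> in ghat. finite (\<gamma> \<inter> hits K)"
proof -
  interpret \<eta>: prob_space \<eta> by (rule eta_prob)
  have [measurable]: "K \<in> sets borel"
    using K by (simp add: compact_imp_closed)
  have hits: "hits K \<in> sets borel"
    by measurable
  note [measurable] = measurable_num_points[OF hits]
  have sec: "Pair x -` hits K \<in> sets \<eta>" for x
    using measurable_sets[OF measurable_Pair_const_borel[of x] hits] by (simp add: sets_eta)
  have "sets (borel :: ((real^'n) \<times> (real^'n) list) measure) = sets (borel \<Otimes>\<^sub>M \<eta>)"
    by (simp add: borel_prod[symmetric] sets_eta cong: sets_pair_measure_cong)
  hence sec_meas: "(\<lambda>x. emeasure \<eta> (Pair x -` hits K)) \<in> borel_measurable borel"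
    using hits by (intro \<eta>.measurable_emeasure_Pair) auto
  obtain b where b: "\<And>x. \<bar>\<kappa> x\<bar> \<le> b"
    using corr_bdd by (auto simp: bounded_iff)
  have "(\<integral>\<^sup>+\<gamma>. num_points (hits K) \<gamma> \<partial>ghat) = (\<integral>\<^sup>+\<gamma>. (\<integral>\<^sup>+x. emeasure \<eta> (Pair x -` hits K) \<partial>count_space \<gamma>) \<partial>g)"
    unfolding nn_integral_ghat[OF measurable_num_points[OF hits]]
  proof (intro nn_integral_cong)
    fix \<gamma> assume "\<gamma> \<in> space g"
    hence \<gamma>: "\<gamma> \<in> configs" by simp
    interpret P: product_prob_space "\<lambda>_. \<eta>" \<gamma> by unfold_locales
    have comp: "(\<lambda>f. f x) \<in> measurable (\<Pi>\<^sub>M x\<in>\<gamma>. \<eta>) \<eta>" if "x \<in> \<gamma>" for x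
      using that by measurable
    have "(\<integral>\<^sup>+\<gamma>'. num_points (hits K) \<gamma>' \<partial>mark_law \<eta> \<gamma>) =
        (\<integral>\<^sup>+f. (\<integral>\<^sup>+x. indicator (hits K) (x, f x) \<partial>count_space \<gamma>) \<partial>(\<Pi>\<^sub>M x\<in>\<gamma>. \<eta>))"
      unfolding nn_integral_mark_law[OF \<gamma> sets_eta measurable_num_points[OF hits]]
      by (simp add: nn_integral_count_space_indicator_num_points[symmetric] nn_integral_graph_config)
    also have "\<dots> = (\<integral>\<^sup>+x. (\<integral>\<^sup>+f. indicator (hits K) (x, f x) \<partial>(\<Pi>\<^sub>M x\<in>\<gamma>. \<eta>)) \<partial>count_space \<gamma>)"
    proof (rule nn_integral_count_space_nn_integral[OF countable_configs[OF \<gamma>]])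
      fix x assume "x \<in> \<gamma>"
      from measurable_compose[OF comp[OF this], of "\<lambda>ys. indicator (hits K) (x, ys) :: ennreal" borel]
      show "(\<lambda>f. indicator (hits K) (x, f x) :: ennreal) \<in> borel_measurable (\<Pi>\<^sub>M x\<in>\<gamma>. \<eta>)"
        using hits by simp
    qed
    also have "\<dots> = (\<integral>\<^sup>+x. emeasure \<eta> (Pair x -` hits K) \<partial>count_space \<gamma>)"
    proof (intro nn_integral_cong)
      fix x assume "x \<in> space (count_space \<gamma>)"
      hence x: "x \<in> \<gamma>" by simp
      have "emeasure \<eta> (Pair x -` hits K) = emeasure (distr (\<Pi>\<^sub>M x\<in>\<gamma>. \<eta>) \<eta> (\<lambda>f. f x)) (Pair x -` hits K)"
        using P.PiM_component[OF x] by simp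
      also have "\<dots> = (\<integral>\<^sup>+ys. indicator (Pair x -` hits K) ys \<partial>distr (\<Pi>\<^sub>M x\<in>\<gamma>. \<eta>) \<eta> (\<lambda>f. f x))"
        using sec by (subst nn_integral_indicator) auto
      also have "\<dots> = (\<integral>\<^sup>+f. indicator (Pair x -` hits K) (f x) \<partial>(\<Pi>\<^sub>M x\<in>\<gamma>. \<eta>))"
        using sec by (intro nn_integral_distr comp x) auto
      finally show "(\<integral>\<^sup>+f. indicator (hits K) (x, f x) \<partial>(\<Pi>\<^sub>M x\<in>\<gamma>. \<eta>)) = emeasure \<eta> (Pair x -` hits K)"
        by (simp add: indicator_def)
    qed
    finally show "(\<integral>\<^sup>+\<gamma>'. num_points (hits K) \<gamma>' \<partial>mark_law \<eta> \<gamma>) = (\<integral>\<^sup>+x. emeasure \<eta> (Pair x -` hits K) \<partial>count_space \<gamma>)" .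
  qed
  also have "\<dots> = (\<integral>\<^sup>+x. ennreal (\<kappa> x) * emeasure \<eta> (Pair x -` hits K) \<partial>\<theta>)"
    by (rule first_correlation_nn_integral[OF corr sets_g sets_theta sec_meas])
  also have "\<dots> \<le> (\<integral>\<^sup>+x. ennreal b * emeasure \<eta> (Pair x -` hits K) \<partial>\<theta>)"
    using b by (intro nn_integral_mono mult_right_mono ennreal_leI) (auto simp: abs_le_iff)
  also have "\<dots> = ennreal b * (\<integral>\<^sup>+x. emeasure \<eta> (Pair x -` hits K) \<partial>\<theta>)"
    using sec_meas by (intro nn_integral_cmult) (simp add: measurable_cong_sets[OF sets_theta refl])
  also have "\<dots> < \<infinity>"
    using integral_hits_theta[OF K] by (simp add: ennreal_mult_less_top)
  finally have "AE \<gamma> in ghat. num_points (hits K) \<gamma> \<noteq> \<infinity>"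
    by (intro nn_integral_PInf_AE) auto
  thus ?thesis
  proof eventually_elim
    case (elim \<gamma>)
    thus ?case
      using num_points_finite_iff[of "hits K" \<gamma>] by (simp add: less_top[symmetric])
  qed
qed

end

section \<open>Localisation and the density of the marked measure\<close>

text \<open>Phrased as a void event, hence measurable. The restriction concerns the centres of the
  clusters hitting \<open>K\<close>, because \<open>hat_map\<close> leaves centres in place.\<close>

definition localized :: "'a::real_normed_vector set \<Rightarrow> nat \<Rightarrow> ('a \<times> 'a list) set set" where
  "localized K m = {\<gamma> \<in> configs. \<gamma> \<inter> (hits K - cball 0 (real m) \<times> UNIV) = {}}"

lemma localized_sets:
  fixes K :: "'a::euclidean_space set"
  assumes "K \<in> sets borel"
  shows "localized K m \<in> sets config_space"
  unfolding localized_def using hits_sets[OF assms]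
  by (intro configs_void_sets sets.Diff borel_Times) auto

lemma incseq_localized: "incseq (localized K)"
  by (rule incseq_SucI) (auto simp: localized_def)

lemma Union_localized:
  fixes K :: "'a::euclidean_space set"
  assumes "\<gamma> \<in> configs" "finite (\<gamma> \<inter> hits K)"
  shows "\<exists>m. \<gamma> \<in> localized K m"
proof -
  have "finite (fst ` (\<gamma> \<inter> hits K))"
    using assms(2) by simp
  hence "bounded (fst ` (\<gamma> \<inter> hits K))"
    by (rule finite_imp_bounded)
  then obtain r where "\<And>p. p \<in> \<gamma> \<inter> hits K \<Longrightarrow> norm (fst p) \<le> r"
    by (auto simp: bounded_iff)
  moreover obtain m :: nat where "r \<le> real m"
    using real_arch_simple by blast
  ultimately show ?thesis
    using assms(1) by (intro exI[of _ m]) (auto simp: localized_def, force)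
qed

lemma measurable_image_hat_map:
  assumes "\<phi> \<in> Diff0"
  shows "image (hat_map \<phi>) \<in> measurable config_space config_space"
  by (rule measurable_image_config[where G = "hat_map (inv \<phi>)"])
    (auto intro!: continuous_on_hat_map Diff0_continuous_on Diff0_inv assms simp: hat_map_inverse[OF assms])

lemma measurable_hat_density:
  assumes "\<phi> \<in> Diff0" "h \<in> borel_measurable borel" "\<And>ys. 0 \<le> h ys"
  shows "hat_density h \<phi> \<in> borel_measurable config_space"
proof -
  have "(\<lambda>\<gamma>. \<Prod>z\<in>{z \<in> \<gamma>. rho h \<phi> z \<noteq> 1}. rho h \<phi> z) \<in> borel_measurable config_space"
    using assms by (intro measurable_prod_config measurable_rho less_imp_le[OF rho_pos])
  thus ?thesis by (simp add: hat_density_def[abs_def])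
qed

lemma hat_density_pos:
  assumes "\<phi> \<in> Diff0" "\<And>ys. 0 \<le> h ys"
  shows "0 < hat_density h \<phi> \<gamma>"
  unfolding hat_density_def using assms by (intro prod_pos rho_pos)

text \<open>Centres do not move and \<open>K\<close> is invariant, so no marked point enters or
  leaves the forbidden set.\<close>

lemma hat_map_localized_iff:
  assumes \<phi>: "\<phi> \<in> Diff0" and K: "\<And>x. \<phi> x \<in> K \<longleftrightarrow> x \<in> K" and \<gamma>: "\<gamma> \<in> configs"
  shows "hat_map \<phi> ` \<gamma> \<in> localized K m \<longleftrightarrow> \<gamma> \<in> localized K m"
proof -
  have "hat_map \<phi> ` \<gamma> \<in> configs"
    using measurable_space[OF measurable_image_hat_map[OF \<phi>]] \<gamma> by simp
  moreover have "hat_map \<phi> p \<in> hits K - cball 0 (real m) \<times> UNIV \<longleftrightarrow> p \<in> hits K - cball 0 (real m) \<times> UNIV" for p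
    using hat_map_hits[OF K, of p] by (simp add: hat_map_eq mem_Times_iff)
  hence "hat_map \<phi> ` \<gamma> \<inter> (hits K - cball 0 (real m) \<times> UNIV) = {} \<longleftrightarrow> \<gamma> \<inter> (hits K - cball 0 (real m) \<times> UNIV) = {}"
    by blast
  ultimately show ?thesis
    using \<gamma> by (simp add: localized_def)
qed

context cluster_model
begin

lemma distr_eta_hat_map:
  assumes \<phi>: "\<phi> \<in> Diff0"
  shows "(\<lambda>ys. snd (hat_map \<phi> (x, ys))) \<in> measurable \<eta> \<eta>"
    and "(\<lambda>ys. ennreal (rho h \<phi> (x, ys))) \<in> borel_measurable \<eta>"
    and "distr \<eta> \<eta> (\<lambda>ys. snd (hat_map \<phi> (x, ys))) = density \<eta> (\<lambda>ys. ennreal (rho h \<phi> (x, ys)))"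
proof -
  have "snd \<in> borel_measurable (borel :: ((real^'n) \<times> (real^'n) list) measure)"
    by (intro borel_measurable_continuous_onI continuous_on_snd continuous_on_id)
  from measurable_compose[OF measurable_compose[OF measurable_Pair_const_borel[of x] measurable_hat_map[OF \<phi>]] this]
  have T: "(\<lambda>ys. snd (hat_map \<phi> (x, ys))) \<in> borel_measurable borel" .
  show T': "(\<lambda>ys. snd (hat_map \<phi> (x, ys))) \<in> measurable \<eta> \<eta>"
    using T by (simp add: measurable_cong_sets[OF sets_eta sets_eta])
  show r: "(\<lambda>ys. ennreal (rho h \<phi> (x, ys))) \<in> borel_measurable \<eta>"
    using measurable_compose[OF measurable_Pair_const_borel[of x] measurable_rho[OF \<phi> h_meas]]
    by (simp add: measurable_cong_sets[OF sets_eta refl])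
  show "distr \<eta> \<eta> (\<lambda>ys. snd (hat_map \<phi> (x, ys))) = density \<eta> (\<lambda>ys. ennreal (rho h \<phi> (x, ys)))"
  proof (rule measure_eqI)
    fix A assume "A \<in> sets (distr \<eta> \<eta> (\<lambda>ys. snd (hat_map \<phi> (x, ys))))"
    hence A: "A \<in> sets \<eta>" by simp
    hence ind: "indicator A \<in> borel_measurable borel"
      by (simp add: sets_eta)
    have "emeasure (distr \<eta> \<eta> (\<lambda>ys. snd (hat_map \<phi> (x, ys)))) A =
        (\<integral>\<^sup>+ys. indicator A ys \<partial>distr \<eta> \<eta> (\<lambda>ys. snd (hat_map \<phi> (x, ys))))"
      using A by simp
    also have "\<dots> = (\<integral>\<^sup>+ys. indicator A (snd (hat_map \<phi> (x, ys))) \<partial>\<eta>)"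
      using A by (intro nn_integral_distr T') auto
    also have "\<dots> = (\<integral>\<^sup>+ys. ennreal (rho h \<phi> (x, ys)) * indicator A ys \<partial>\<eta>)"
      by (rule nn_integral_eta_hat_map[OF \<phi> h_meas h_nonneg h_pos eta_density ind])
    also have "\<dots> = emeasure (density \<eta> (\<lambda>ys. ennreal (rho h \<phi> (x, ys)))) A"
      using A r by (simp add: emeasure_density)
    finally show "emeasure (distr \<eta> \<eta> (\<lambda>ys. snd (hat_map \<phi> (x, ys)))) A =
      emeasure (density \<eta> (\<lambda>ys. ennreal (rho h \<phi> (x, ys)))) A" .
  qed simp
qed

text \<open>On the localised event \<open>hat_map \<phi>\<close> agrees with the map
  \<open>U\<close> of the product space, which moves only the marks of the finitely many centres in
  the ball. The density for finitely many changed coordinates then applies.\<close>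

lemma mark_law_hat_map_localized:
  assumes \<phi>: "\<phi> \<in> Diff0" and K: "compact K" "\<And>x. x \<notin> K \<Longrightarrow> \<phi> x = x" "\<And>x. x \<notin> K \<Longrightarrow> inv \<phi> x = x"
      "\<And>x. \<phi> x \<in> K \<longleftrightarrow> x \<in> K"
    and \<gamma>: "\<gamma> \<in> configs" and A: "A \<in> sets config_space" "A \<subseteq> localized K m"
  shows "emeasure (mark_law \<eta> \<gamma>) (image (hat_map \<phi>) -` A \<inter> configs) =
    (\<integral>\<^sup>+\<gamma>'. ennreal (hat_density h \<phi> \<gamma>') * indicator A \<gamma>' \<partial>mark_law \<eta> \<gamma>)"
proof -
  interpret \<eta>: prob_space \<eta> by (rule eta_prob)
  let ?P = "\<Pi>\<^sub>M x\<in>\<gamma>. \<eta>"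
  define J where "J = \<gamma> \<inter> cball 0 (real m)"
  have J: "finite J" "J \<subseteq> \<gamma>"
    using \<gamma> by (auto simp: J_def configs_def)
  define T where "T x ys = snd (hat_map \<phi> (x, ys))" for x ys
  define U where "U f = (\<lambda>x\<in>\<gamma>. if x \<in> J then T x (f x) else f x)" for f
  define R where "R f = (\<Prod>x\<in>J. ennreal (rho h \<phi> (x, f x)))" for f :: "real^'n \<Rightarrow> (real^'n) list"
  note graph = graph_config_in_configs[OF \<gamma>]
  have loc_iff: "graph_config \<gamma> f \<in> localized K m \<longleftrightarrow> (\<forall>x\<in>\<gamma> - J. (x, f x) \<notin> hits K)" for f
    using graph[of f] by (auto simp: localized_def J_def)
  have change: "distr ?P ?P U = density ?P R"
    unfolding U_def R_def T_def using distr_eta_hat_map[OF \<phi>]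
    by (intro distr_PiM_change_finite eta_prob J) auto
  have U: "U \<in> measurable ?P ?P"
  proof -
    have comp: "(\<lambda>f. f x) \<in> measurable ?P \<eta>" if "x \<in> \<gamma>" for x
      using that by measurable
    have "(\<lambda>f. if x \<in> J then T x (f x) else f x) \<in> measurable ?P \<eta>" if "x \<in> \<gamma>" for x
      using measurable_compose[OF comp[OF that] distr_eta_hat_map(1)[OF \<phi>, of x]] comp[OF that]
      by (cases "x \<in> J") (auto simp: T_def)
    thus ?thesis
      unfolding U_def by (intro measurable_restrict)
  qed
  have R: "R \<in> borel_measurable ?P"
  proof -
    have comp: "(\<lambda>f. f x) \<in> measurable ?P \<eta>" if "x \<in> J" for x
      using that J(2) by (intro measurable_component_singleton) auto
    show ?thesis
      unfolding R_def
      by (intro borel_measurable_prod_ennreal measurable_compose[OF comp distr_eta_hat_map(2)[OF \<phi>]])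
  qed
  have hat_graph: "hat_map \<phi> ` graph_config \<gamma> f = graph_config \<gamma> (\<lambda>x. T x (f x))" for f
    by (auto simp: T_def hat_map_eq image_image)
  have image_U: "hat_map \<phi> ` graph_config \<gamma> f \<in> A \<longleftrightarrow> graph_config \<gamma> (U f) \<in> A" for f
  proof (cases "graph_config \<gamma> f \<in> localized K m")
    case True
    have "T x (f x) = U f x" if "x \<in> \<gamma>" for x
    proof (cases "x \<in> J")
      case False
      hence "(x, f x) \<notin> hits K"
        using True that loc_iff by auto
      thus ?thesis
        using that False hat_map_outside_hits[OF K(2)] by (simp add: T_def U_def)
    qed (use that in \<open>simp add: U_def\<close>)
    hence "hat_map \<phi> ` graph_config \<gamma> f = graph_config \<gamma> (U f)"
      unfolding hat_graph by (intro image_cong) auto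
    thus ?thesis by simp
  next
    case False
    hence "hat_map \<phi> ` graph_config \<gamma> f \<notin> localized K m"
      using hat_map_localized_iff[OF \<phi> K(4) graph] by simp
    \<comment> \<open>A centre outside the ball whose cluster hits \<open>K\<close> keeps its mark
      under \<open>U\<close>, so the event still fails.\<close>
    moreover have "graph_config \<gamma> (U f) \<notin> localized K m"
      using False unfolding loc_iff by (auto simp: U_def)
    ultimately show ?thesis using A(2) by blast
  qed
  have dens: "ennreal (hat_density h \<phi> (graph_config \<gamma> f)) = R f" if "graph_config \<gamma> f \<in> localized K m" for f
  proof -
    have "rho h \<phi> (x, f x) = 1" if "x \<in> \<gamma> - J" for x
      using that \<open>graph_config \<gamma> f \<in> localized K m\<close> by (intro rho_outside_hits[OF K(1,3)]) (auto simp: loc_iff)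
    \<comment> \<open>Centres outside \<open>J\<close> contribute the factor 1, and extending the
      product to all of \<open>J\<close> adds only further factors 1.\<close>
    hence "hat_density h \<phi> (graph_config \<gamma> f) = (\<Prod>z\<in>graph_config J f. rho h \<phi> z)"
      unfolding hat_density_def using J by (intro prod.mono_neutral_left) auto
    also have "\<dots> = (\<Prod>x\<in>J. rho h \<phi> (x, f x))"
      by (subst prod.reindex) (auto simp: inj_on_def)
    finally show ?thesis
      unfolding R_def using rho_pos[where h = h, OF \<phi>] h_nonneg by (subst prod_ennreal) (auto intro: less_imp_le)
  qed
  have G: "graph_config \<gamma> \<in> measurable ?P config_space"
    by (rule measurable_graph_config[OF \<gamma> sets_eta])
  have A': "graph_config \<gamma> -` A \<inter> space ?P \<in> sets ?P"
    using G A(1) by (rule measurable_sets)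
  have "emeasure (mark_law \<eta> \<gamma>) (image (hat_map \<phi>) -` A \<inter> configs) =
      emeasure ?P (graph_config \<gamma> -` (image (hat_map \<phi>) -` A \<inter> configs) \<inter> space ?P)"
    unfolding mark_law_def
    using measurable_sets[OF measurable_image_hat_map[OF \<phi>] A(1)] by (intro emeasure_distr G) simp
  also have "graph_config \<gamma> -` (image (hat_map \<phi>) -` A \<inter> configs) \<inter> space ?P = U -` (graph_config \<gamma> -` A \<inter> space ?P) \<inter> space ?P"
    using graph image_U measurable_space[OF U] by auto
  also have "emeasure ?P \<dots> = emeasure (distr ?P ?P U) (graph_config \<gamma> -` A \<inter> space ?P)"
    by (rule emeasure_distr[OF U A', symmetric])
  also have "\<dots> = (\<integral>\<^sup>+f. R f * indicator (graph_config \<gamma> -` A \<inter> space ?P) f \<partial>?P)"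
    unfolding change using R A' by (rule emeasure_density)
  also have "\<dots> = (\<integral>\<^sup>+f. ennreal (hat_density h \<phi> (graph_config \<gamma> f)) * indicator A (graph_config \<gamma> f) \<partial>?P)"
    using dens A(2) by (intro nn_integral_cong) (auto simp: indicator_def)
  also have "\<dots> = (\<integral>\<^sup>+\<gamma>'. ennreal (hat_density h \<phi> \<gamma>') * indicator A \<gamma>' \<partial>mark_law \<eta> \<gamma>)"
  proof (rule nn_integral_mark_law[OF \<gamma> sets_eta, symmetric])
    note [measurable] = measurable_hat_density[OF \<phi> h_meas h_nonneg] A(1)
    show "(\<lambda>\<gamma>'. ennreal (hat_density h \<phi> \<gamma>') * indicator A \<gamma>') \<in> borel_measurable config_space"
      by measurable
  qed
  finally show ?thesis .
qed

theorem distr_ghat_hat_map: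
  assumes \<phi>: "\<phi> \<in> Diff0"
  shows "distr ghat config_space (\<lambda>\<gamma>. hat_map \<phi> ` \<gamma>) = density ghat (\<lambda>\<gamma>. ennreal (hat_density h \<phi> \<gamma>))"
proof (rule measure_eqI)
  note [measurable] = measurable_hat_density[OF \<phi> h_meas h_nonneg]
  obtain K where K: "compact K" "\<And>x. x \<notin> K \<Longrightarrow> \<phi> x = x" "\<And>x. x \<notin> K \<Longrightarrow> inv \<phi> x = x" "\<And>x. \<phi> x \<in> K \<longleftrightarrow> x \<in> K"
    using Diff0_support[OF \<phi>] by blast
  have loc: "localized K m \<in> sets config_space" for m
    using K(1) by (intro localized_sets) (simp add: compact_imp_closed)
  let ?\<mu> = "distr ghat config_space (\<lambda>\<gamma>. hat_map \<phi> ` \<gamma>)"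
  let ?\<nu> = "density ghat (\<lambda>\<gamma>. ennreal (hat_density h \<phi> \<gamma>))"
  have hat: "(\<lambda>\<gamma>. hat_map \<phi> ` \<gamma>) \<in> measurable ghat config_space"
    using measurable_image_hat_map[OF \<phi>] by (simp add: measurable_cong_sets[OF sets_ghat refl])
  have local_eq: "emeasure ?\<mu> A = emeasure ?\<nu> A" if A: "A \<in> sets config_space" "A \<subseteq> localized K m" for A m
  proof -
    note [measurable] = A(1)
    have "emeasure ?\<mu> A = (\<integral>\<^sup>+\<gamma>. emeasure (mark_law \<eta> \<gamma>) (image (hat_map \<phi>) -` A \<inter> configs) \<partial>g)"
      using emeasure_ghat[OF measurable_sets[OF measurable_image_hat_map[OF \<phi>] A(1)]]
      by (simp add: emeasure_distr[OF hat A(1)])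
    also have "\<dots> = (\<integral>\<^sup>+\<gamma>. (\<integral>\<^sup>+\<gamma>'. ennreal (hat_density h \<phi> \<gamma>') * indicator A \<gamma>' \<partial>mark_law \<eta> \<gamma>) \<partial>g)"
      using mark_law_hat_map_localized[OF \<phi> K _ A] by (intro nn_integral_cong) simp
    also have "\<dots> = (\<integral>\<^sup>+\<gamma>. ennreal (hat_density h \<phi> \<gamma>) * indicator A \<gamma> \<partial>ghat)"
      by (rule nn_integral_ghat[symmetric]) measurable
    also have "\<dots> = emeasure ?\<nu> A"
      by (subst emeasure_density) (simp_all add: A)
    finally show ?thesis .
  qed
  have AE_loc: "AE \<gamma> in ghat. \<gamma> \<in> (\<Union>m. localized K m)"
    using AE_finite_hits[OF K(1)] AE_space by eventually_elim (use Union_localized in auto)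
  have AE_\<mu>: "AE \<gamma> in ?\<mu>. \<gamma> \<in> (\<Union>m. localized K m)"
  proof (subst AE_distr_iff[OF hat])
    have "{\<gamma> \<in> space config_space. \<gamma> \<in> (\<Union>m. localized K m)} = (\<Union>m. localized K m)"
      by (auto simp: localized_def)
    thus "{\<gamma> \<in> space config_space. \<gamma> \<in> (\<Union>m. localized K m)} \<in> sets config_space"
      using loc by auto
    show "AE \<gamma> in ghat. hat_map \<phi> ` \<gamma> \<in> (\<Union>m. localized K m)"
      \<comment> \<open>Invariance of each localised event carries the almost sure statement over to
        the image measure.\<close>
      using AE_loc AE_space by eventually_elim (use hat_map_localized_iff[OF \<phi> K(4)] in auto)
  qed
  have AE_\<nu>: "AE \<gamma> in ?\<nu>. \<gamma> \<in> (\<Union>m. localized K m)"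
    using AE_loc by (subst AE_density) (auto elim: eventually_mono)
  \<comment> \<open>Both measures are carried by the increasing union of the localised events, hence
    are determined by their values on subsets of these.\<close>
  have exhaust: "emeasure N A = (SUP m. emeasure N (A \<inter> localized K m))"
    if N: "sets N = sets config_space" "AE \<gamma> in N. \<gamma> \<in> (\<Union>m. localized K m)" and A: "A \<in> sets config_space" for N A
  proof -
    have "emeasure N A = emeasure N (\<Union>m. A \<inter> localized K m)"
      using N A loc by (intro emeasure_eq_AE) (auto elim!: eventually_mono)
    also have "\<dots> = (SUP m. emeasure N (A \<inter> localized K m))"
      using incseq_localized[of K] A loc N(1)
      by (intro SUP_emeasure_incseq[symmetric]) (auto simp: incseq_def)
    finally show ?thesis .
  qed
  fix A assume "A \<in> sets ?\<mu>"
  hence A: "A \<in> sets config_space" by simp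
  show "emeasure ?\<mu> A = emeasure ?\<nu> A"
    using exhaust[of ?\<mu> A, OF _ AE_\<mu> A] exhaust[of ?\<nu> A, OF _ AE_\<nu> A]
      local_eq[OF sets.Int[OF A loc] Int_lower2] by simp
qed simp

end

section \<open>The projection of marked configurations to droplet configurations\<close>

text \<open>The counterpart of \<open>q_mult\<close> as an integral against counting measure, where
  Tonelli's theorem is available.\<close>

definition droplet_mult :: "('a \<times> 'a list) set \<Rightarrow> 'a::plus \<Rightarrow> ennreal" where
  "droplet_mult \<gamma> p = (\<integral>\<^sup>+z. of_nat (count_list (shift (snd z) (fst z)) p) \<partial>count_space \<gamma>)"

text \<open>If finitely many clusters have a droplet at \<open>p\<close>, both values are the same
  finite sum. Otherwise infinitely many terms are at least 1 and both are infinite.\<close>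

lemma ennreal_of_enat_q_mult: "ennreal_of_enat (q_mult \<gamma> p) = droplet_mult \<gamma> p"
proof -
  define c where "c z = count_list (shift (snd z) (fst z)) p" for z :: "'a \<times> 'a list"
  define T where "T = {z \<in> \<gamma>. c z \<noteq> 0}"
  have q: "q_mult \<gamma> p = (\<Sum>\<^sub>\<infinity>z\<in>T. of_nat (c z))"
    unfolding q_mult_def by (intro infsum_cong_neutral) (auto simp: T_def c_def)
  have M: "droplet_mult \<gamma> p = (\<integral>\<^sup>+z. of_nat (c z) \<partial>count_space \<gamma>)"
    by (simp add: droplet_mult_def c_def)
  show ?thesis
  proof (cases "finite T")
    case True
    have "droplet_mult \<gamma> p = (\<Sum>z\<in>T. of_nat (c z))"
      unfolding M using True by (intro nn_integral_count_space') (auto simp: T_def)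
    moreover have "q_mult \<gamma> p = of_nat (\<Sum>z\<in>T. c z)"
      unfolding q using True by simp
    ultimately show ?thesis
      by (simp add: of_nat_eq_enat)
  next
    case False
    have "q_mult \<gamma> p = \<infinity>"
      unfolding q
    proof (rule infsum_superconst_infinite_enat[where b = 1])
      show "1 \<le> (of_nat (c z) :: enat)" if "z \<in> T" for z
        using that by (simp add: T_def of_nat_eq_enat one_enat_def)
    qed (use False in auto)
    moreover have "emeasure (count_space \<gamma>) T \<le> droplet_mult \<gamma> p"
    proof -
      have "emeasure (count_space \<gamma>) T = (\<integral>\<^sup>+z. indicator T z \<partial>count_space \<gamma>)"
        by (rule nn_integral_indicator[symmetric]) (auto simp: T_def)
      also have "\<dots> \<le> droplet_mult \<gamma> p"
        unfolding M by (intro nn_integral_mono) (auto simp: T_def indicator_def)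
      finally show ?thesis .
    qed
    moreover have "emeasure (count_space \<gamma>) T = \<infinity>"
      using False by (intro emeasure_count_space_infinite) (auto simp: T_def)
    ultimately show ?thesis
      by (simp add: top_unique)
  qed
qed

lemma q_mult_le_1_iff: "q_mult \<gamma> p \<le> 1 \<longleftrightarrow> droplet_mult \<gamma> p \<le> 1"
  using ennreal_of_enat_le_iff[of "q_mult \<gamma> p" 1] by (simp add: ennreal_of_enat_q_mult)

section \<open>Counting droplets and measurability of the droplet map\<close>

text \<open>Droplets are counted with multiplicity, so that this is a sum over clusters and
  measurable on all configurations, simple or not.\<close>

definition num_droplets :: "'a::plus set \<Rightarrow> ('a \<times> 'a list) set \<Rightarrow> ennreal" where
  "num_droplets C \<gamma> = (\<integral>\<^sup>+z. sum_list (map (indicator C) (shift (snd z) (fst z))) \<partial>count_space \<gamma>)"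

lemma sum_list_indicator_eq:
  "sum_list (map (indicator C) ys) = (\<integral>\<^sup>+p. of_nat (count_list ys p) \<partial>count_space C)"
proof (induction ys)
  case (Cons y ys)
  have "(\<integral>\<^sup>+p. of_nat (count_list (y # ys) p) \<partial>count_space C) = (\<integral>\<^sup>+p. indicator {y} p + of_nat (count_list ys p) \<partial>count_space C)"
    by (intro nn_integral_cong) (auto simp: indicator_def)
  also have "\<dots> = (\<integral>\<^sup>+p. indicator {y} p \<partial>count_space C) + (\<integral>\<^sup>+p. of_nat (count_list ys p) \<partial>count_space C)"
    by (rule nn_integral_add) auto
  also have "(\<integral>\<^sup>+p. indicator {y} p \<partial>count_space C) = indicator C y"
    using nn_integral_indicator_singleton[of y "count_space UNIV" "indicator C"]
    by (simp add: nn_integral_count_space_indicator mult.commute)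
  finally show ?case using Cons.IH by simp
qed simp

text \<open>Tonelli's theorem for counting measures: droplets are counted by position instead of by
  cluster. The restrictions to \<open>C\<close> and \<gamma> become indicators, since the exchange
  is made on the full types.\<close>

lemma num_droplets_eq: "num_droplets C \<gamma> = (\<integral>\<^sup>+p. droplet_mult \<gamma> p \<partial>count_space C)"
proof -
  define f where "f = (\<lambda>(z, p). of_nat (count_list (shift (snd z) (fst z)) p) * indicator C p * indicator \<gamma> z :: ennreal)"
  have "num_droplets C \<gamma> = (\<integral>\<^sup>+z. (\<integral>\<^sup>+p. f (z, p) \<partial>count_space UNIV) \<partial>count_space UNIV)"
    unfolding num_droplets_def sum_list_indicator_eq
    by (simp add: nn_integral_count_space_indicator
        nn_integral_multc[symmetric] f_def)
  also have "\<dots> = (\<integral>\<^sup>+p. (\<integral>\<^sup>+z. f (z, p) \<partial>count_space UNIV) \<partial>count_space UNIV)"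
    by (simp only: nn_integral_fst_count_space nn_integral_snd_count_space)
  also have "\<dots> = (\<integral>\<^sup>+p. droplet_mult \<gamma> p \<partial>count_space C)"
    unfolding droplet_mult_def
    by (simp add: nn_integral_count_space_indicator
        nn_integral_cmult[symmetric] f_def mult_ac)
  finally show ?thesis .
qed

lemma measurable_num_droplets [measurable]:
  fixes C :: "'a::euclidean_space set"
  assumes [measurable]: "C \<in> sets borel"
  shows "num_droplets C \<in> borel_measurable config_space"
  unfolding num_droplets_def[abs_def] by (intro measurable_nn_integral_config) measurable

text \<open>With values 0 and 1 the multiplicity function is the indicator of its support, and its
  integral over \<open>C\<close> is the number of points there.\<close>

lemma num_droplets_simple:
  assumes "\<And>p. q_mult \<gamma> p \<le> 1"
  shows "num_droplets C \<gamma> = num_points C (q_config \<gamma>)"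
proof -
  have "droplet_mult \<gamma> p = indicator (q_config \<gamma>) p" for p
  proof -
    have "q_mult \<gamma> p = 0 \<or> q_mult \<gamma> p = 1"
      using assms[of p] by (cases "q_mult \<gamma> p") (auto simp: one_enat_def zero_enat_def le_Suc_eq)
    thus ?thesis
      unfolding ennreal_of_enat_q_mult[symmetric] by (auto simp: q_config_def)
  qed
  hence "num_droplets C \<gamma> = (\<integral>\<^sup>+p. indicator (q_config \<gamma>) p \<partial>count_space C)"
    by (simp add: num_droplets_eq)
  thus ?thesis
    unfolding nn_integral_count_space_indicator_num_points by (simp add: num_points_def Int_commute)
qed

text \<open>Having no double point is a condition on uncountably many positions. It is replaced by
  countably many: the finitely many droplets in each ball lie in distinct atoms for some
  \<open>l\<close>, and conversely an atom with at most one droplet contains no double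
  point.\<close>

lemma simple_config_iff:
  fixes \<gamma> :: "('a::euclidean_space \<times> 'a list) set"
  assumes b: "\<And>z w. z \<noteq> w \<Longrightarrow> \<exists>i. (z \<in> b i) \<noteq> (w \<in> (b i :: 'a set))"
  shows "simple_config \<gamma> \<longleftrightarrow> (\<forall>m::nat. num_droplets (cball 0 (real m)) \<gamma> < \<infinity> \<and>
     (\<exists>l. \<forall>s\<in>Pow {..<l}. num_droplets (cball 0 (real m) \<inter> {z. atom_code b l z = s}) \<gamma> \<le> 1))" (is "_ \<longleftrightarrow> ?R")
proof
  assume simple: "simple_config \<gamma>"
  hence N: "num_droplets C \<gamma> = num_points C (q_config \<gamma>)" for C
    by (intro num_droplets_simple) (auto simp: simple_config_def)
  show ?R
  proof (intro allI conjI)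
    fix m :: nat
    let ?T = "q_config \<gamma> \<inter> cball 0 (real m)"
    have fin: "finite ?T"
      using simple by (auto simp: simple_config_def configs_def)
    thus "num_droplets (cball 0 (real m)) \<gamma> < \<infinity>"
      unfolding N num_points_finite_iff .
    obtain l where l: "inj_on (atom_code b l) ?T"
      using atom_code_inj_on[OF b fin] by blast
    show "\<exists>l. \<forall>s\<in>Pow {..<l}. num_droplets (cball 0 (real m) \<inter> {z. atom_code b l z = s}) \<gamma> \<le> 1"
    proof (intro exI ballI)
      fix s
      let ?S = "q_config \<gamma> \<inter> (cball 0 (real m) \<inter> {z. atom_code b l z = s})"
      have "finite ?S"
        using fin by (rule rev_finite_subset) auto
      moreover have "card ?S \<le> Suc 0"
        using l \<open>finite ?S\<close> by (auto simp: card_le_Suc0_iff_eq inj_on_def)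
      ultimately show "num_droplets (cball 0 (real m) \<inter> {z. atom_code b l z = s}) \<gamma> \<le> 1"
        unfolding N num_points_def by (auto simp: emeasure_count_space)
    qed
  qed
next
  assume R: ?R
  have le1: "q_mult \<gamma> p \<le> 1" for p
  proof -
    obtain m :: nat where m: "norm p \<le> real m"
      using real_arch_simple by blast
    obtain l where l: "\<forall>s\<in>Pow {..<l}. num_droplets (cball 0 (real m) \<inter> {z. atom_code b l z = s}) \<gamma> \<le> 1"
      using R by blast
    let ?C = "cball 0 (real m) \<inter> {z. atom_code b l z = atom_code b l p}"
    \<comment> \<open>The multiplicity at \<open>p\<close> is bounded by the count in the atom of
      \<open>p\<close>, intersected with a ball containing \<open>p\<close>.\<close>
    have "droplet_mult \<gamma> p = (\<integral>\<^sup>+p'. droplet_mult \<gamma> p' * indicator {p} p' \<partial>count_space ?C)"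
      using m by (subst nn_integral_indicator_singleton) auto
    also have "\<dots> \<le> num_droplets ?C \<gamma>"
      unfolding num_droplets_eq by (intro nn_integral_mono) (auto simp: indicator_def)
    also have "\<dots> \<le> 1"
      using l by (auto simp: atom_code_def)
    finally show ?thesis by (simp add: q_mult_le_1_iff)
  qed
  have "q_config \<gamma> \<in> configs"
    unfolding configs_def
  proof safe
    fix K :: "'a set" assume "compact K"
    hence "bounded K" by (rule compact_imp_bounded)
    then obtain r where r: "\<And>x. x \<in> K \<Longrightarrow> norm x \<le> r"
      by (auto simp: bounded_iff)
    obtain m :: nat where "r \<le> real m"
      using real_arch_simple by blast
    hence sub: "K \<subseteq> cball 0 (real m)"
      using r by force
    have "finite (q_config \<gamma> \<inter> cball 0 (real m))"
      using R by (simp add: num_points_finite_iff[symmetric] num_droplets_simple[OF le1, symmetric])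
    thus "finite (q_config \<gamma> \<inter> K)"
      by (rule rev_finite_subset) (use sub in auto)
  qed
  thus "simple_config \<gamma>"
    using le1 by (simp add: simple_config_def)
qed

lemma simple_config_sets: "{\<gamma> \<in> configs. simple_config \<gamma>} \<in> sets (config_space :: ('a::euclidean_space \<times> 'a list) set measure)"
proof -
  obtain b :: "nat \<Rightarrow> 'a set" where b: "\<And>i. open (b i)" "\<And>z w. z \<noteq> w \<Longrightarrow> \<exists>i. (z \<in> b i) \<noteq> (w \<in> b i)"
    using ex_separating_sequence by blast
  have [measurable]: "cball 0 (real m) \<inter> {z. atom_code b l z = s} \<in> sets borel" for m l s
    using atom_code_sets[where l = l and s = s, OF b(1)] by (intro sets.Int) auto
  have [measurable]: "Measurable.pred (config_space :: ('a \<times> 'a list) set measure)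
     (\<lambda>\<gamma>. \<forall>s\<in>Pow {..<l}. num_droplets (cball 0 (real m) \<inter> {z. atom_code b l z = s}) \<gamma> \<le> 1)" for m l
    by (intro pred_intros_finite) measurable
  have "{\<gamma> \<in> space (config_space :: ('a \<times> 'a list) set measure). \<forall>m::nat. num_droplets (cball 0 (real m)) \<gamma> < \<infinity> \<and>
     (\<exists>l. \<forall>s\<in>Pow {..<l}. num_droplets (cball 0 (real m) \<inter> {z. atom_code b l z = s}) \<gamma> \<le> 1)} \<in> sets config_space"
    by measurable
  moreover have "simple_config \<gamma> \<longleftrightarrow> (\<forall>m::nat. num_droplets (cball 0 (real m)) \<gamma> < \<infinity> \<and>
     (\<exists>l. \<forall>s\<in>Pow {..<l}. num_droplets (cball 0 (real m) \<inter> {z. atom_code b l z = s}) \<gamma> \<le> 1))" for \<gamma>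
    by (rule simple_config_iff) (rule b(2))
  ultimately show ?thesis by simp
qed

text \<open>On simple configurations the points of \<open>q_config\<close> in \<open>B\<close> are
  counted by \<open>num_droplets B\<close>, which is measurable.\<close>

lemma measurable_q_config:
  fixes M :: "('a::euclidean_space \<times> 'a list) set measure"
  assumes M: "sets M = sets config_space"
  shows "q_config \<in> measurable (restrict_space M {\<gamma>. simple_config \<gamma>}) config_space"
proof (rule measurable_config_spaceI)
  show "q_config \<gamma> \<in> configs" if "\<gamma> \<in> space (restrict_space M {\<gamma>. simple_config \<gamma>})" for \<gamma>
    using that by (simp add: space_restrict_space simple_config_def)
  fix B :: "'a set" assume B: "B \<in> sets borel"
  have "num_droplets B \<in> borel_measurable M"
    using measurable_num_droplets[OF B] by (simp add: measurable_cong_sets[OF M refl])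
  hence "num_droplets B \<in> borel_measurable (restrict_space M {\<gamma>. simple_config \<gamma>})"
    by (rule measurable_restrict_space1)
  thus "(\<lambda>\<gamma>. num_points B (q_config \<gamma>)) \<in> borel_measurable (restrict_space M {\<gamma>. simple_config \<gamma>})"
    by (rule measurable_cong[THEN iffD1, rotated])
      (simp add: space_restrict_space simple_config_def num_droplets_simple)
qed

lemma simple_config_Int_space:
  fixes M :: "('a::euclidean_space \<times> 'a list) set measure"
  assumes M: "sets M = sets config_space"
  shows "{\<gamma>. simple_config \<gamma>} \<inter> space M \<in> sets M"
  using simple_config_sets sets_eq_imp_space_eq[OF M] M by (simp add: Int_def conj_commute)

lemma sets_q_image [simp, measurable_cong]: "sets (q_image M) = sets config_space"
  by (simp add: q_image_def)

lemma q_preimage_sets: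
  assumes A: "A \<in> sets (config_space :: 'a::euclidean_space set measure)"
  shows "{\<gamma> \<in> configs. simple_config \<gamma> \<and> q_config \<gamma> \<in> A} \<in> sets config_space"
proof -
  have "q_config -` A \<inter> space (restrict_space config_space {\<gamma> :: ('a \<times> 'a list) set. simple_config \<gamma>}) \<in>
      sets (restrict_space config_space {\<gamma>. simple_config \<gamma>})"
    by (rule measurable_sets[OF measurable_q_config[OF refl] A])
  hence "q_config -` A \<inter> space (restrict_space config_space {\<gamma> :: ('a \<times> 'a list) set. simple_config \<gamma>}) \<in> sets config_space"
    by (simp add: sets_restrict_space_iff[OF simple_config_Int_space[OF refl]])
  thus ?thesis
    by (rule back_subst[of "\<lambda>S. S \<in> sets config_space"]) (auto simp: space_restrict_space)
qed

lemma emeasure_q_image: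
  fixes M :: "('a::euclidean_space \<times> 'a list) set measure"
  assumes M: "sets M = sets config_space" and A: "A \<in> sets config_space"
  shows "emeasure (q_image M) A = emeasure M {\<gamma> \<in> configs. simple_config \<gamma> \<and> q_config \<gamma> \<in> A}"
proof -
  have sp: "space M = configs"
    using sets_eq_imp_space_eq[OF M] by simp
  have "emeasure (q_image M) A = emeasure (restrict_space M {\<gamma>. simple_config \<gamma>})
      (q_config -` A \<inter> space (restrict_space M {\<gamma>. simple_config \<gamma>}))"
    unfolding q_image_def by (rule emeasure_distr[OF measurable_q_config[OF M] A])
  also have "\<dots> = emeasure M (q_config -` A \<inter> space (restrict_space M {\<gamma>. simple_config \<gamma>}))"
    by (rule emeasure_restrict_space[OF simple_config_Int_space[OF M]]) (auto simp: space_restrict_space)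
  also have "q_config -` A \<inter> space (restrict_space M {\<gamma>. simple_config \<gamma>}) = {\<gamma> \<in> configs. simple_config \<gamma> \<and> q_config \<gamma> \<in> A}"
    by (auto simp: space_restrict_space sp)
  finally show ?thesis .
qed

lemma integral_q_image:
  fixes M :: "('a::euclidean_space \<times> 'a list) set measure"
  assumes M: "sets M = sets config_space" and F: "F \<in> borel_measurable config_space"
  shows "(LINT \<gamma>|q_image M. F \<gamma>) = (LINT \<gamma>|M. q_pullback F \<gamma>)"
proof -
  have "(LINT \<gamma>|q_image M. F \<gamma>) = (LINT \<gamma>|restrict_space M {\<gamma>. simple_config \<gamma>}. F (q_config \<gamma>))"
    unfolding q_image_def by (rule integral_distr[OF measurable_q_config[OF M] F])
  also have "\<dots> = (LINT \<gamma>|M. indicator {\<gamma>. simple_config \<gamma>} \<gamma> *\<^sub>R F (q_config \<gamma>))"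
    by (rule integral_restrict_space[OF simple_config_Int_space[OF M]])
  also have "\<dots> = (LINT \<gamma>|M. q_pullback F \<gamma>)"
    by (intro Bochner_Integration.integral_cong) (auto simp: q_pullback_def)
  finally show ?thesis .
qed

lemma measurable_q_pullback:
  fixes F :: "'a::euclidean_space set \<Rightarrow> real"
  assumes F: "F \<in> borel_measurable config_space"
  shows "q_pullback F \<in> borel_measurable config_space"
proof -
  have "(\<lambda>\<gamma>. F (q_config \<gamma>)) \<in> borel_measurable (restrict_space config_space {\<gamma> :: ('a \<times> 'a list) set. simple_config \<gamma>})"
    by (rule measurable_compose[OF measurable_q_config[OF refl] F])
  thus ?thesis
    unfolding q_pullback_def[abs_def] using simple_config_sets
    by (subst measurable_If_restrict_space_iff) auto
qed

section \<open>The droplet map intertwines \<open>hat_map \<phi>\<close> with \<phi>\<close>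

text \<open>The shift back to relative positions in \<open>hat_map\<close> cancels against the shift
  in \<open>q_mult\<close>, so each droplet is simply moved by \<phi>. Since \<phi> is bijective,
  multiplicities are carried along unchanged.\<close>

lemma q_mult_hat_map:
  fixes \<phi> :: "real^'n \<Rightarrow> real^'n"
  assumes \<phi>: "\<phi> \<in> Diff0"
  shows "q_mult (hat_map \<phi> ` \<gamma>) p = q_mult \<gamma> (inv \<phi> p)"
proof -
  have inj: "inj_on (hat_map \<phi>) \<gamma>"
    by (rule inj_on_inverseI[of _ "hat_map (inv \<phi>)"]) (rule hat_map_inverse[OF \<phi>])
  have count: "count_list (map \<phi> ys) p = count_list ys (inv \<phi> p)" for ys
    using Diff0_inverse[OF \<phi>] by (induction ys) auto
  have shift: "shift (snd (hat_map \<phi> z)) (fst (hat_map \<phi> z)) = map \<phi> (shift (snd z) (fst z))" for z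
    by (simp add: hat_map_eq shift_def o_def)
  have "q_mult (hat_map \<phi> ` \<gamma>) p = (\<Sum>\<^sub>\<infinity>z\<in>hat_map \<phi> ` \<gamma>. of_nat (count_list (shift (snd z) (fst z)) p))"
    by (simp add: q_mult_def case_prod_unfold)
  also have "\<dots> = (\<Sum>\<^sub>\<infinity>z\<in>\<gamma>. of_nat (count_list (shift (snd z) (fst z)) (inv \<phi> p)))"
    by (subst infsum_reindex[OF inj]) (simp add: o_def shift count)
  also have "\<dots> = q_mult \<gamma> (inv \<phi> p)"
    by (simp add: q_mult_def case_prod_unfold)
  finally show ?thesis .
qed

lemma q_config_hat_map:
  assumes \<phi>: "\<phi> \<in> Diff0"
  shows "q_config (hat_map \<phi> ` \<gamma>) = \<phi> ` q_config \<gamma>"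
  using Diff0_inverse[OF \<phi>] by (force simp: q_config_def q_mult_hat_map[OF \<phi>] image_iff)

lemma Diff0_image_configs_iff:
  assumes \<phi>: "\<phi> \<in> Diff0"
  shows "\<phi> ` \<gamma> \<in> configs \<longleftrightarrow> \<gamma> \<in> configs"
proof
  assume "\<phi> ` \<gamma> \<in> configs"
  from image_in_configs[OF this Diff0_continuous_on[OF \<phi>], of "inv \<phi>"] show "\<gamma> \<in> configs"
    using Diff0_inverse[OF \<phi>] by (simp add: image_image)
qed (use Diff0_inverse[OF \<phi>] in \<open>auto intro: image_in_configs[OF _ Diff0_continuous_on[OF Diff0_inv[OF \<phi>]]]\<close>)

lemma simple_config_hat_map:
  assumes \<phi>: "\<phi> \<in> Diff0"
  shows "simple_config (hat_map \<phi> ` \<gamma>) \<longleftrightarrow> simple_config \<gamma>"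
proof -
  have "(\<forall>p. q_mult \<gamma> (inv \<phi> p) \<le> 1) \<longleftrightarrow> (\<forall>p. q_mult \<gamma> p \<le> 1)"
    using Diff0_inverse[OF \<phi>] by metis
  thus ?thesis
    by (simp add: simple_config_def q_mult_hat_map[OF \<phi>] q_config_hat_map[OF \<phi>] Diff0_image_configs_iff[OF \<phi>])
qed

lemma measurable_image_Diff0:
  assumes \<phi>: "\<phi> \<in> Diff0"
  shows "image \<phi> \<in> measurable config_space config_space"
  by (rule measurable_image_config[OF Diff0_continuous_on[OF \<phi>] Diff0_continuous_on[OF Diff0_inv[OF \<phi>]]])
    (rule Diff0_inverse[OF \<phi>])

section \<open>The Gibbs cluster measure\<close>

context cluster_model
begin

abbreviation "gcl \<equiv> cluster_measure g \<eta>"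

lemma sets_gcl [simp, measurable_cong]: "sets gcl = sets config_space"
  by (simp add: cluster_measure_def)

lemma space_gcl [simp]: "space gcl = configs"
  using sets_eq_imp_space_eq[OF sets_gcl] by simp

lemma emeasure_gcl:
  "A \<in> sets config_space \<Longrightarrow> emeasure gcl A = emeasure ghat {\<gamma> \<in> configs. simple_config \<gamma> \<and> q_config \<gamma> \<in> A}"
  unfolding cluster_measure_def by (rule emeasure_q_image) simp

lemma finite_measure_gcl: "finite_measure gcl"
proof
  interpret ghat: prob_space ghat by (rule prob_ghat)
  show "emeasure gcl (space gcl) \<noteq> \<infinity>"
    using emeasure_gcl[OF sets.top[of config_space]] by simp
qed

lemma measurable_image_gcl:
  assumes "\<phi> \<in> Diff0"
  shows "(\<lambda>\<gamma>. \<phi> ` \<gamma>) \<in> measurable gcl config_space"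
  using measurable_image_Diff0[OF assms] by (simp add: measurable_cong_sets[OF sets_gcl refl])

text \<open>By intertwining and invariance of simplicity, pulling \<open>A\<close> back first along
  \<phi> and then along the droplet map is the same as pulling it back along the droplet map and
  then along \<open>hat_map \<phi>\<close>. This moves every question about the image measure up to
  \<open>ghat\<close>.\<close>

lemma emeasure_distr_gcl:
  assumes \<phi>: "\<phi> \<in> Diff0" and A: "A \<in> sets config_space"
  shows "emeasure (distr gcl config_space (\<lambda>\<gamma>. \<phi> ` \<gamma>)) A =
    emeasure (density ghat (\<lambda>\<gamma>. ennreal (hat_density h \<phi> \<gamma>))) {\<gamma> \<in> configs. simple_config \<gamma> \<and> q_config \<gamma> \<in> A}"
proof -
  let ?Q = "{\<gamma> \<in> configs. simple_config \<gamma> \<and> q_config \<gamma> \<in> A}"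
  have hat: "(\<lambda>\<gamma>. hat_map \<phi> ` \<gamma>) \<in> measurable ghat config_space"
    using measurable_image_hat_map[OF \<phi>] by (simp add: measurable_cong_sets[OF sets_ghat refl])
  have "emeasure (distr gcl config_space (\<lambda>\<gamma>. \<phi> ` \<gamma>)) A = emeasure gcl ((\<lambda>\<gamma>. \<phi> ` \<gamma>) -` A \<inter> space gcl)"
    by (rule emeasure_distr[OF measurable_image_gcl[OF \<phi>] A])
  also have "\<dots> = emeasure ghat {\<gamma> \<in> configs. simple_config \<gamma> \<and> q_config \<gamma> \<in> (\<lambda>\<gamma>. \<phi> ` \<gamma>) -` A \<inter> space gcl}"
    using measurable_sets[OF measurable_image_gcl[OF \<phi>] A] by (intro emeasure_gcl) simp
  also have "{\<gamma> \<in> configs. simple_config \<gamma> \<and> q_config \<gamma> \<in> (\<lambda>\<gamma>. \<phi> ` \<gamma>) -` A \<inter> space gcl} =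
      (\<lambda>\<gamma>. hat_map \<phi> ` \<gamma>) -` ?Q \<inter> space ghat"
  proof -
    have "q_config \<gamma> \<in> configs" if "simple_config \<gamma>" for \<gamma> :: "((real^'n) \<times> (real^'n) list) set"
      using that by (simp add: simple_config_def)
    thus ?thesis
      using measurable_space[OF measurable_image_hat_map[OF \<phi>]]
      by (auto simp: simple_config_hat_map[OF \<phi>] q_config_hat_map[OF \<phi>])
  qed
  also have "emeasure ghat \<dots> = emeasure (distr ghat config_space (\<lambda>\<gamma>. hat_map \<phi> ` \<gamma>)) ?Q"
    by (rule emeasure_distr[OF hat q_preimage_sets[OF A], symmetric])
  finally show ?thesis
    by (simp add: distr_ghat_hat_map[OF \<phi>])
qed

text \<open>The density is strictly positive everywhere, so \<open>ghat\<close> and its image have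
  the same null sets; the preimages under the droplet map inherit this.\<close>

lemma gcl_quasi_invariant:
  assumes \<phi>: "\<phi> \<in> Diff0"
  shows "absolutely_continuous gcl (distr gcl config_space (\<lambda>\<gamma>. \<phi> ` \<gamma>))"
    and "absolutely_continuous (distr gcl config_space (\<lambda>\<gamma>. \<phi> ` \<gamma>)) gcl"
proof -
  note [measurable] = measurable_hat_density[OF \<phi> h_meas h_nonneg]
  have null: "Q \<in> null_sets (density ghat (\<lambda>\<gamma>. ennreal (hat_density h \<phi> \<gamma>))) \<longleftrightarrow> Q \<in> null_sets ghat" for Q
  proof -
    have "Q \<in> null_sets (density ghat (\<lambda>\<gamma>. ennreal (hat_density h \<phi> \<gamma>))) \<longleftrightarrow>
        Q \<in> sets ghat \<and> (AE \<gamma> in ghat. \<gamma> \<in> Q \<longrightarrow> ennreal (hat_density h \<phi> \<gamma>) = 0)"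
      by (rule null_sets_density_iff) measurable
    also have "\<dots> \<longleftrightarrow> Q \<in> sets ghat \<and> (AE \<gamma> in ghat. \<gamma> \<notin> Q)"
    proof -
      have "\<not> hat_density h \<phi> \<gamma> \<le> 0" for \<gamma>
        using hat_density_pos[where h = h, OF \<phi> h_nonneg] by (simp add: not_le)
      thus ?thesis by (simp add: ennreal_eq_0_iff)
    qed
    also have "\<dots> \<longleftrightarrow> Q \<in> null_sets ghat"
      using AE_iff_null_sets by (auto dest: null_setsD2)
    finally show ?thesis .
  qed
  have "A \<in> null_sets gcl \<longleftrightarrow> A \<in> null_sets (distr gcl config_space (\<lambda>\<gamma>. \<phi> ` \<gamma>))" for A
  proof (cases "A \<in> sets config_space")
    case True
    thus ?thesis
      using null[of "{\<gamma> \<in> configs. simple_config \<gamma> \<and> q_config \<gamma> \<in> A}"] q_preimage_sets[OF True]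
      by (simp add: null_sets_def emeasure_gcl emeasure_distr_gcl[OF \<phi>])
  qed (auto simp: null_sets_def)
  thus "absolutely_continuous gcl (distr gcl config_space (\<lambda>\<gamma>. \<phi> ` \<gamma>))"
    and "absolutely_continuous (distr gcl config_space (\<lambda>\<gamma>. \<phi> ` \<gamma>)) gcl"
    by (auto simp: absolutely_continuous_def)
qed

text \<open>Duality is checked by integrating \<open>F\<close> against the image of the cluster
  measure: lift the integral to \<open>ghat\<close>, intertwine, and use the density there.\<close>

lemma gcl_density_is_q_adjoint:
  assumes \<phi>: "\<phi> \<in> Diff0"
  shows "is_q_adjoint ghat (hat_density h \<phi>)
    (\<lambda>\<gamma>. enn2real (RN_deriv gcl (distr gcl config_space (\<lambda>\<gamma>. \<phi> ` \<gamma>)) \<gamma>))"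
proof -
  note dens_meas = measurable_hat_density[OF \<phi> h_meas h_nonneg]
  note [measurable] = dens_meas
  let ?N = "distr gcl config_space (\<lambda>\<gamma>. \<phi> ` \<gamma>)"
  interpret ghat: prob_space ghat by (rule prob_ghat)
  interpret gcl: finite_measure gcl by (rule finite_measure_gcl)
  interpret N: finite_measure ?N
    by (rule gcl.finite_measure_distr[OF measurable_image_gcl[OF \<phi>]])
  have hat: "(\<lambda>\<gamma>. hat_map \<phi> ` \<gamma>) \<in> measurable ghat config_space"
    using measurable_image_hat_map[OF \<phi>] by (simp add: measurable_cong_sets[OF sets_ghat refl])
  have sets_N: "sets ?N = sets gcl"
    by simp
  note RN = gcl.RN_deriv_integrable[OF N.sigma_finite_measure_axioms gcl_quasi_invariant(1)[OF \<phi>] sets_N]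
    gcl.RN_deriv_integral[OF N.sigma_finite_measure_axioms gcl_quasi_invariant(1)[OF \<phi>] sets_N]
  \<comment> \<open>The integral of the density is the total mass of the image measure, which is 1;
    with positivity this gives integrability.\<close>
  have "(\<integral>\<^sup>+\<gamma>. ennreal (hat_density h \<phi> \<gamma>) \<partial>ghat) = emeasure (density ghat (\<lambda>\<gamma>. ennreal (hat_density h \<phi> \<gamma>))) (space ghat)"
    using sets.top[of ghat] by (subst emeasure_density) (auto intro!: nn_integral_cong)
  also have "\<dots> = emeasure (distr ghat config_space (\<lambda>\<gamma>. hat_map \<phi> ` \<gamma>)) (space config_space)"
    by (simp add: distr_ghat_hat_map[OF \<phi>])
  also have "\<dots> = 1"
    using prob_space.emeasure_space_1[OF ghat.prob_space_distr[OF hat]] by simp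
  finally have "integrable ghat (hat_density h \<phi>)"
    using hat_density_pos[where h = h, OF \<phi> h_nonneg] by (intro integrableI_nonneg) (auto intro: less_imp_le)
  moreover have "integrable gcl (\<lambda>\<gamma>. enn2real (RN_deriv gcl ?N \<gamma>))"
    using RN(1)[of "\<lambda>_. 1"] by simp
  moreover have "(LINT \<gamma>|gcl. F \<gamma> * enn2real (RN_deriv gcl ?N \<gamma>)) = (LINT \<gamma>|ghat. q_pullback F \<gamma> * hat_density h \<phi> \<gamma>)"
    if F: "F \<in> borel_measurable config_space" for F
  proof -
    have F\<phi>: "(\<lambda>\<gamma>. F (\<phi> ` \<gamma>)) \<in> borel_measurable config_space"
      by (rule measurable_compose[OF measurable_image_Diff0[OF \<phi>] F])
    have "(LINT \<gamma>|gcl. F \<gamma> * enn2real (RN_deriv gcl ?N \<gamma>)) = (LINT \<gamma>|?N. F \<gamma>)"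
      using RN(2)[of F] F by (simp add: mult.commute)
    also have "\<dots> = (LINT \<gamma>|gcl. F (\<phi> ` \<gamma>))"
      by (rule integral_distr[OF measurable_image_gcl[OF \<phi>] F])
    also have "\<dots> = (LINT \<gamma>|ghat. q_pullback (\<lambda>\<gamma>. F (\<phi> ` \<gamma>)) \<gamma>)"
      unfolding cluster_measure_def by (rule integral_q_image[OF sets_ghat F\<phi>])
    also have "\<dots> = (LINT \<gamma>|ghat. q_pullback F (hat_map \<phi> ` \<gamma>))"
      \<comment> \<open>The two branches of \<open>q_pullback\<close> correspond because simplicity
        is invariant under \<open>hat_map \<phi>\<close>.\<close>
      by (simp add: q_pullback_def simple_config_hat_map[OF \<phi>] q_config_hat_map[OF \<phi>] cong: if_cong)
    also have "\<dots> = (LINT \<gamma>|distr ghat config_space (\<lambda>\<gamma>. hat_map \<phi> ` \<gamma>). q_pullback F \<gamma>)"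
      by (rule integral_distr[OF hat measurable_q_pullback[OF F], symmetric])
    also have "\<dots> = (LINT \<gamma>|ghat. hat_density h \<phi> \<gamma> *\<^sub>R q_pullback F \<gamma>)"
      unfolding distr_ghat_hat_map[OF \<phi>]
      using measurable_q_pullback[OF F] dens_meas hat_density_pos[where h = h, OF \<phi> h_nonneg]
      by (intro integral_density) (auto simp: measurable_cong_sets[OF sets_ghat refl] intro: less_imp_le)
    finally show ?thesis by (simp add: mult.commute)
  qed
  ultimately show ?thesis
    unfolding is_q_adjoint_def cluster_measure_def[symmetric] by blast
qed

end

theorem theorem3p5:
  fixes \<theta> :: "(real^'n) measure"
    and \<Phi> :: "(real^'n) set \<Rightarrow> ereal"
    and g :: "(real^'n) set measure"
    and \<kappa> :: "real^'n \<Rightarrow> real"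
    and \<eta> :: "(real^'n) list measure"
    and h :: "(real^'n) list \<Rightarrow> real"
  defines "ghat \<equiv> marked_measure g \<eta>"
    and "gcl \<equiv> cluster_measure g \<eta>"
  assumes theta_borel: "sets \<theta> = sets borel"
    and potential: "interaction_potential \<Phi>"
    and gibbs: "g \<in> gibbs_measures \<theta> \<Phi>"
    and theta_bound: "\<And>B. compact B \<Longrightarrow> (SUP x. emeasure \<theta> ((\<lambda>y. y + x) ` B)) < \<infinity>"
    and corr: "first_correlation \<theta> g \<kappa>"
    and corr_bdd: "bounded (range \<kappa>)"
    and eta_prob: "prob_space \<eta>"
    and eta_sym: "perm_invariant \<eta>"
    and h_meas: "h \<in> borel_measurable borel"
    and h_nonneg: "\<And>ys. 0 \<le> h ys"
    and eta_density: "\<eta> = density list_lborel (\<lambda>ys. ennreal (h ys))"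
    and mean_size: "(\<integral>\<^sup>+ys. of_nat (length ys) \<partial>\<eta>) < \<infinity>"
    and h_pos: "AE ys in list_lborel. h ys > 0"
  shows "\<forall>\<phi>\<in>Diff0.
      absolutely_continuous gcl (distr gcl config_space (\<lambda>\<gamma>. \<phi> ` \<gamma>)) \<and>
      absolutely_continuous (distr gcl config_space (\<lambda>\<gamma>. \<phi> ` \<gamma>)) gcl \<and>
      distr ghat config_space (\<lambda>\<gamma>. hat_map \<phi> ` \<gamma>) =
        density ghat (\<lambda>\<gamma>. ennreal (hat_density h \<phi> \<gamma>)) \<and>
      is_q_adjoint ghat (hat_density h \<phi>)
        (\<lambda>\<gamma>. enn2real (RN_deriv gcl (distr gcl config_space (\<lambda>\<gamma>. \<phi> ` \<gamma>)) \<gamma>))"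
proof -
  have "prob_space g" "sets g = sets config_space"
    using gibbs by (auto simp: gibbs_measures_def)
  interpret cluster_model \<theta> g \<kappa> \<eta> h
    by (rule cluster_model.intro) fact+
  show ?thesis
    unfolding ghat_def gcl_def
    using gcl_quasi_invariant distr_ghat_hat_map gcl_density_is_q_adjoint by blast
qed

end
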